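(* There do not exist $d\in\mathbb{N}$ and a subset $V\subset\mathbb{B}_d$ such that $\operatorname{Mult}(\mathcal{D})$ is algebraically isomorphic to $\operatorname{Mult}(H^2_d|_V)$.
   Context: $\mathbb{N}=\{1,2,3,\dots\}$; $\mathbb{D}$ is the open unit disc in $\mathbb{C}$ and $\mathbb{B}_d$ is the open Euclidean unit ball of $\mathbb{C}^d$. The Dirichlet space is $\mathcal{D} = \{f \text{ holomorphic on } \mathbb{D} : \int_{\mathbb{D}} |f'|^2\, dA < \infty\}$, where $dA$ is normalized area measure on $\mathbb{D}$, with norm $\|f\|^2 = \int_{\mathbb{D}} |f'|^2\, dA + \|f\|_{H^2}^2$, where $\|f\|_{H^2}^2=\sup_{0\le r<1}\int_0^{2\pi}|f(re^{it})|^2\frac{dt}{2\pi}$; it is the reproducing kernel Hilbert space on $\mathbb{D}$ with kernel $k(z,w) = \frac{1}{z\overline{w}} \log\big(\frac{1}{1-z\overline{w}}\big)$ (equal to $1$ when $z\overline w=0$). The Drury--Arveson space $H^2_d$ is the reproducing kernel Hilbert space on $\mathbb{B}_d$ with kernel $K(z,w) = \frac{1}{1-\langle z,w\rangle}$. For $V\subset\mathbb{B}_d$, $H^2_d|_V$ is the reproducing kernel Hilbert space on $V$ whose kernel is the restriction of $K$ to $V\times V$; equivalently $H^2_d|_V=\{f|_V : f\in H^2_d\}$ with the quotient norm. For a reproducing kernel Hilbert space $\mathcal{H}$ of functions on a set $X$, $\operatorname{Mult}(\mathcal{H})$ is the algebra of all functions $\varphi: X\to\mathbb{C}$ with $\varphi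 f \in \mathcal{H}$ for all $f\in\mathcal{H}$. Algebraically isomorphic means isomorphic as complex algebras (no continuity is assumed). *)

theory Defs
  imports "HOL-Analysis.Analysis"
begin

text \<open>
  Throughout, a function on a set \<open>X\<close> is represented by the total function that is \<open>0\<close> outside
  \<open>X\<close>. Equality of representatives is equality on \<open>X\<close>, and sums, products and scalar multiples
  are computed pointwise.
\<close>

definition funs_on :: "'a set \<Rightarrow> ('a \<Rightarrow> complex) set" where
  "funs_on X = {f. \<forall>x. x \<notin> X \<longrightarrow> f x = 0}"

definition kernel_fun :: "'a set \<Rightarrow> ('a \<Rightarrow> 'a \<Rightarrow> complex) \<Rightarrow> 'a \<Rightarrow> 'a \<Rightarrow> complex" where
  "kernel_fun X k w = (\<lambda>z. if z \<in> X then k z w else 0)"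

text \<open>
  \<open>H\<close> with inner product \<open>ip\<close> (linear in the first argument) is the reproducing kernel Hilbert
  space of functions on \<open>X\<close> with kernel \<open>k\<close>. By the Moore-Aronszajn theorem such \<open>H\<close> and
  (on \<open>H\<close>) \<open>ip\<close> exist and are unique for each positive semidefinite \<open>k\<close>. Only the values of \<open>k\<close>
  on \<open>X \<times> X\<close> matter, so the space of a restricted kernel is obtained by shrinking \<open>X\<close>.
\<close>

locale rkhs =
  fixes X :: "'a set"
    and k :: "'a \<Rightarrow> 'a \<Rightarrow> complex"
    and H :: "('a \<Rightarrow> complex) set"
    and ip :: "('a \<Rightarrow> complex) \<Rightarrow> ('a \<Rightarrow> complex) \<Rightarrow> complex"
  assumes funs: "H \<subseteq> funs_on X"
    and zero_mem: "(\<lambda>x. 0) \<in> H"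
    and add_mem: "\<lbrakk>f \<in> H; g \<in> H\<rbrakk> \<Longrightarrow> (\<lambda>x. f x + g x) \<in> H"
    and scale_mem: "f \<in> H \<Longrightarrow> (\<lambda>x. c * f x) \<in> H"
    and ip_add: "\<lbrakk>f \<in> H; g \<in> H; h \<in> H\<rbrakk> \<Longrightarrow> ip (\<lambda>x. f x + g x) h = ip f h + ip g h"
    and ip_scale: "\<lbrakk>f \<in> H; h \<in> H\<rbrakk> \<Longrightarrow> ip (\<lambda>x. c * f x) h = c * ip f h"
    and ip_cnj: "\<lbrakk>f \<in> H; g \<in> H\<rbrakk> \<Longrightarrow> ip g f = cnj (ip f g)"
    and ip_pos: "\<lbrakk>f \<in> H; f \<noteq> (\<lambda>x. 0)\<rbrakk> \<Longrightarrow> 0 < Re (ip f f)"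
    and complete: "\<lbrakk>\<And>n. u n \<in> H;
        \<And>e. 0 < e \<Longrightarrow> \<exists>N. \<forall>m\<ge>N. \<forall>n\<ge>N. sqrt (Re (ip (\<lambda>x. u m x - u n x) (\<lambda>x. u m x - u n x))) < e\<rbrakk>
      \<Longrightarrow> \<exists>f\<in>H. (\<lambda>n. sqrt (Re (ip (\<lambda>x. u n x - f x) (\<lambda>x. u n x - f x)))) \<longlonglongrightarrow> 0"
    and kernel_mem: "w \<in> X \<Longrightarrow> kernel_fun X k w \<in> H"
    and reproducing: "\<lbrakk>w \<in> X; f \<in> H\<rbrakk> \<Longrightarrow> f w = ip f (kernel_fun X k w)"

definition Mult :: "'a set \<Rightarrow> ('a \<Rightarrow> complex) set \<Rightarrow> ('a \<Rightarrow> complex) set" where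
  "Mult X H = {\<phi> \<in> funs_on X. \<forall>f\<in>H. (\<lambda>x. \<phi> x * f x) \<in> H}"

text \<open>
  Isomorphism of complex algebras of functions. A multiplicative bijection automatically maps a
  unit to a unit, so unitality need not be demanded.
\<close>

definition algebra_isomorphic :: "('a \<Rightarrow> complex) set \<Rightarrow> ('b \<Rightarrow> complex) set \<Rightarrow> bool" where
  "algebra_isomorphic A B \<longleftrightarrow>
    (\<exists>\<Phi>. bij_betw \<Phi> A B \<and>
      (\<forall>f\<in>A. \<forall>g\<in>A. \<Phi> (\<lambda>x. f x + g x) = (\<lambda>y. \<Phi> f y + \<Phi> g y)) \<and>
      (\<forall>c. \<forall>f\<in>A. \<Phi> (\<lambda>x. c * f x) = (\<lambda>y. c * \<Phi> f y)) \<and>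
      (\<forall>f\<in>A. \<forall>g\<in>A. \<Phi> (\<lambda>x. f x * g x) = (\<lambda>y. \<Phi> f y * \<Phi> g y)))"

text \<open>
  The Dirichlet space as a set of functions; its norm does not enter the definition of its
  multiplier algebra. The uniform measure on the disc is the normalized area measure.
\<close>

definition dirichlet_space :: "(complex \<Rightarrow> complex) set" where
  "dirichlet_space =
    {f \<in> funs_on (ball 0 1). f holomorphic_on ball 0 1 \<and>
       (\<integral>\<^sup>+z. ennreal ((cmod (deriv f z))\<^sup>2) \<partial>uniform_measure lborel (ball 0 1)) < \<infinity>}"

definition cinner_vec :: "complex ^ 'd \<Rightarrow> complex ^ 'd \<Rightarrow> complex" where
  "cinner_vec z w = (\<Sum>i\<in>UNIV. z $ i * cnj (w $ i))"

definition drury_arveson_kernel :: "complex ^ 'd \<Rightarrow> complex ^ 'd \<Rightarrow> complex" where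
  "drury_arveson_kernel z w = 1 / (1 - cinner_vec z w)"

end

theory Submission imports Defs "HOL-Complex_Analysis.Complex_Analysis" begin

unbundle no fps_syntax

text \<open>
  The proof counts points. Let \<open>\<Phi>\<close> be an isomorphism from the multiplier algebra of the Dirichlet
  space onto that of the Drury-Arveson space restricted to \<open>V\<close>, and let \<open>T\<close> be its inverse. A point
  \<open>z\<close> of the disc gives a character \<open>\<psi> \<mapsto> T \<psi> z\<close>; let \<open>F z\<close> be the vector of its values at the
  coordinate functions. On the circle of radius \<open>1 - \<epsilon>\<close> there are about \<open>\<epsilon> powr (-1/2)\<close> points whose
  images under \<open>F\<close> have mutual distance at least \<open>\<epsilon> powr \<delta>\<close>, where \<open>\<delta> > 0\<close> is at our disposal. The
  unit ball of a space of finite dimension has no room for so many points (\<open>packing\<close>). Such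
  families exist because the Dirichlet kernel grows only logarithmically: one may separate points at
  distance \<open>sqrt \<epsilon>\<close> by logarithms \<open>Ln (1 + \<epsilon> - cnj \<zeta> * z)\<close>, and these are multipliers of size at most
  \<open>\<epsilon> powr (-\<delta>)\<close> (\<open>log_test_test_fun\<close>, \<open>log_test_separates\<close>).

  Two facts carry this separation from the disc to the ball. The first is that a character \<open>\<omega>\<close> over a
  point \<open>p\<close> of the open ball is \<open>\<psi> \<mapsto> \<langle>\<psi>, K\<^sub>p\<rangle>\<close>, where \<open>K\<^sub>p\<close> is the kernel at \<open>p\<close> restricted to \<open>V\<close>,
  although \<open>p\<close> need not be in \<open>V\<close> (\<open>character_is_evaluation\<close>). Hence the values of two characters at
  \<open>\<psi>\<close> differ by at most the norm of \<open>\<psi>\<close> times the norm of \<open>K\<^sub>p - K\<^sub>q\<close>. An automorphism of the ball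
  reduces the claim to \<open>p = 0\<close>. There one has to write a multiplier as a combination of the coordinate
  functions with multipliers as coefficients. Explicit coefficients are available after division by a
  suitable function \<open>\<langle>f, k\<^sub>z f\<rangle>\<close> of \<open>z\<close>: the quotients are contractive because the coordinates form a
  row contraction (\<open>pairing_quotient_bmult\<close>), and the character does not vanish at the reciprocal of the
  denominator (\<open>character_eq_state\<close>).

  The second fact is that \<open>F z\<close> approaches the sphere slowly: \<open>1 - norm (F z)\<close> is at least a constant
  times \<open>(1 - cmod z) powr \<eta>\<close>, for each \<open>\<eta> > 0\<close> (\<open>boundary_distance_bound\<close>). For a unit vector \<open>\<alpha>\<close> let
  \<open>g z = \<langle>F z, \<alpha>\<rangle>\<close>. All powers of \<open>g\<close> are images under \<open>T\<close> of contractive multipliers. A bounded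
  multiplier \<open>h\<close> of the Dirichlet space satisfies \<open>\<bar>deriv h z\<bar> = o(1 / (1 - \<bar>z\<bar>))\<close>, because it may be
  multiplied by an unbounded Dirichlet function such as an iterated logarithm. Applied to all powers of
  \<open>g\<close> this gives the same bound for \<open>\<bar>deriv g z\<bar> / (1 - \<bar>g z\<bar>)\<close>, and integration along a radius yields
  the claim.

  Each of these estimates has to be uniform over a family (a circle of functions, all powers, all
  test functions), while no continuity of \<open>\<Phi>\<close> is given. Uniformity comes three times from the same
  gliding hump argument (\<open>gliding_hump\<close>).
\<close>

section \<open>Hilbert space geometry of a reproducing kernel space\<close>

context rkhs
begin

definition nrm :: "('a \<Rightarrow> complex) \<Rightarrow> real" where
  "nrm f = sqrt (Re (ip f f))"

lemma diff_mem: "f \<in> H \<Longrightarrow> g \<in> H \<Longrightarrow> (\<lambda>x. f x - g x) \<in> H"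
  using add_mem[of f "\<lambda>x. -1 * g x"] scale_mem[of g "-1"] by simp

lemma ip_add2: "\<lbrakk>f \<in> H; g \<in> H; h \<in> H\<rbrakk> \<Longrightarrow> ip f (\<lambda>x. g x + h x) = ip f g + ip f h"
  using ip_cnj[of f "\<lambda>x. g x + h x"] ip_cnj[of f g] ip_cnj[of f h] ip_cnj[of "\<lambda>x. g x + h x" f]
    ip_add[of g h f] add_mem[of g h] by simp

lemma ip_scale2: "\<lbrakk>f \<in> H; g \<in> H\<rbrakk> \<Longrightarrow> ip f (\<lambda>x. c * g x) = cnj c * ip f g"
  using ip_cnj[of f g] ip_cnj[of "\<lambda>x. c * g x" f] ip_scale[of g f c] scale_mem[of g c] by simp

lemma ip_diff: "\<lbrakk>f \<in> H; g \<in> H; h \<in> H\<rbrakk> \<Longrightarrow> ip (\<lambda>x. f x - g x) h = ip f h - ip g h"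
  using ip_add[of f "\<lambda>x. -1 * g x" h] scale_mem[of g "-1"] ip_scale[of g h "-1"] by simp

lemma ip_diff2: "\<lbrakk>f \<in> H; g \<in> H; h \<in> H\<rbrakk> \<Longrightarrow> ip f (\<lambda>x. g x - h x) = ip f g - ip f h"
  using ip_add2[of f g "\<lambda>x. -1 * h x"] scale_mem[of h "-1"] ip_scale2[of f h "-1"] by simp

lemma ip_zero: "f \<in> H \<Longrightarrow> ip (\<lambda>x. 0) f = 0"
  using ip_scale[OF zero_mem, of f 0] by simp

lemma ip_zero2: "f \<in> H \<Longrightarrow> ip f (\<lambda>x. 0) = 0"
  using ip_scale2[OF _ zero_mem, of f 0] by simp

lemma sum_mem: "finite S \<Longrightarrow> (\<And>i. i \<in> S \<Longrightarrow> f i \<in> H) \<Longrightarrow> (\<lambda>x. \<Sum>i\<in>S. f i x) \<in> H"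
  by (induction rule: finite_induct) (auto simp: zero_mem intro: add_mem)

lemma ip_sum: "finite S \<Longrightarrow> (\<And>i. i \<in> S \<Longrightarrow> f i \<in> H) \<Longrightarrow> g \<in> H \<Longrightarrow>
    ip (\<lambda>x. \<Sum>i\<in>S. f i x) g = (\<Sum>i\<in>S. ip (f i) g)"
  by (induction rule: finite_induct) (auto simp: ip_zero ip_add sum_mem)

lemma ip_sum2: "finite S \<Longrightarrow> (\<And>i. i \<in> S \<Longrightarrow> f i \<in> H) \<Longrightarrow> g \<in> H \<Longrightarrow>
    ip g (\<lambda>x. \<Sum>i\<in>S. f i x) = (\<Sum>i\<in>S. ip g (f i))"
  by (induction rule: finite_induct) (auto simp: ip_zero2 ip_add2 sum_mem)

lemma Re_ip_self_ge0: "f \<in> H \<Longrightarrow> 0 \<le> Re (ip f f)"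
  using ip_pos[of f] ip_zero[OF zero_mem] by (cases "f = (\<lambda>x. 0)") (auto intro: less_imp_le)

lemma nrm_ge0: "f \<in> H \<Longrightarrow> 0 \<le> nrm f"
  by (simp add: nrm_def Re_ip_self_ge0)

lemma nrm_sq: "f \<in> H \<Longrightarrow> (nrm f)\<^sup>2 = Re (ip f f)"
  by (simp add: nrm_def Re_ip_self_ge0)

lemma ip_self: "f \<in> H \<Longrightarrow> ip f f = of_real ((nrm f)\<^sup>2)"
proof -
  assume f: "f \<in> H"
  have "Im (ip f f) = Im (cnj (ip f f))"
    using ip_cnj[OF f f] by (rule arg_cong)
  then show ?thesis
    by (simp add: complex_eq_iff nrm_sq[OF f])
qed

lemma nrm_pos: "f \<in> H \<Longrightarrow> f \<noteq> (\<lambda>x. 0) \<Longrightarrow> 0 < nrm f"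
  by (simp add: nrm_def ip_pos)

lemma nrm_zero: "nrm (\<lambda>x. 0) = 0"
  by (simp add: nrm_def ip_zero zero_mem)

lemma Re_ip_comm: "f \<in> H \<Longrightarrow> g \<in> H \<Longrightarrow> Re (ip g f) = Re (ip f g)"
  using ip_cnj[of f g] by simp

lemma nrm_add_sq: "f \<in> H \<Longrightarrow> g \<in> H \<Longrightarrow>
    (nrm (\<lambda>x. f x + g x))\<^sup>2 = (nrm f)\<^sup>2 + (nrm g)\<^sup>2 + 2 * Re (ip f g)"
  by (simp add: nrm_sq add_mem ip_add ip_add2 Re_ip_comm)

lemma nrm_diff_sq: "f \<in> H \<Longrightarrow> g \<in> H \<Longrightarrow>
    (nrm (\<lambda>x. f x - g x))\<^sup>2 = (nrm f)\<^sup>2 + (nrm g)\<^sup>2 - 2 * Re (ip f g)"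
  by (simp add: nrm_sq diff_mem ip_diff ip_diff2 Re_ip_comm)

lemma nrm_scale: "f \<in> H \<Longrightarrow> nrm (\<lambda>x. c * f x) = cmod c * nrm f"
proof -
  assume f: "f \<in> H"
  have "(nrm (\<lambda>x. c * f x))\<^sup>2 = (cmod c * nrm f)\<^sup>2"
    unfolding nrm_sq[OF scale_mem[OF f]] ip_scale[OF f scale_mem[OF f]] ip_scale2[OF f f] ip_self[OF f]
    by (simp add: power_mult_distrib cmod_power2) (simp add: power2_eq_square algebra_simps)
  then show ?thesis
    using power2_eq_iff_nonneg[of "nrm (\<lambda>x. c * f x)" "cmod c * nrm f"] f nrm_ge0 scale_mem[OF f, of c] by simp
qed

lemma cauchy_schwarz:
  assumes f: "f \<in> H" and g: "g \<in> H"
  shows "cmod (ip f g) \<le> nrm f * nrm g"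
proof (cases "g = (\<lambda>x. 0)")
  case True
  then show ?thesis using f by (simp add: ip_zero2 nrm_zero)
next
  case False
  then have gp: "nrm g > 0" using nrm_pos g by blast
  define c where "c = ip f g / of_real ((nrm g)\<^sup>2)"
  have cg: "(\<lambda>x. c * g x) \<in> H" using g by (rule scale_mem)
  have "0 \<le> (nrm (\<lambda>x. f x - c * g x))\<^sup>2" by simp
  also have "\<dots> = (nrm f)\<^sup>2 + (cmod c * nrm g)\<^sup>2 - 2 * Re (cnj c * ip f g)"
    by (simp add: nrm_diff_sq[OF f cg] nrm_scale g ip_scale2 f)
  also have "cnj c * ip f g = of_real ((cmod (ip f g))\<^sup>2 / (nrm g)\<^sup>2)"
    unfolding c_def of_real_divide complex_norm_square by simp
  also have "cmod c * nrm g = cmod (ip f g) / nrm g"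
    unfolding c_def using gp by (simp add: norm_divide power2_eq_square norm_mult)
  finally have "(cmod (ip f g))\<^sup>2 / (nrm g)\<^sup>2 \<le> (nrm f)\<^sup>2"
    by (simp add: power_divide)
  then have "(cmod (ip f g))\<^sup>2 \<le> (nrm f * nrm g)\<^sup>2"
    using gp by (simp add: divide_le_eq power_mult_distrib)
  then show ?thesis
    using f g nrm_ge0 by (meson mult_nonneg_nonneg power2_le_imp_le)
qed

lemma nrm_triangle:
  assumes "f \<in> H" "g \<in> H"
  shows "nrm (\<lambda>x. f x + g x) \<le> nrm f + nrm g"
proof (rule power2_le_imp_le)
  have "Re (ip f g) \<le> nrm f * nrm g"
    using cauchy_schwarz[OF assms] complex_Re_le_cmod order_trans by blast
  then show "(nrm (\<lambda>x. f x + g x))\<^sup>2 \<le> (nrm f + nrm g)\<^sup>2"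
    by (simp add: nrm_add_sq assms power2_sum)
qed (simp add: assms nrm_ge0)

lemma nrm_diff_commute: "f \<in> H \<Longrightarrow> g \<in> H \<Longrightarrow> nrm (\<lambda>x. f x - g x) = nrm (\<lambda>x. g x - f x)"
  using nrm_scale[of "\<lambda>x. f x - g x" "-1"] diff_mem[of f g] by simp

lemma nrm_diff_le:
  assumes "f \<in> H" "g \<in> H"
  shows "nrm f \<le> nrm g + nrm (\<lambda>x. f x - g x)"
  using nrm_triangle[OF assms(2) diff_mem[OF assms]] by simp

lemma nrm_sum_le: "finite S \<Longrightarrow> (\<And>i. i \<in> S \<Longrightarrow> f i \<in> H) \<Longrightarrow> nrm (\<lambda>x. \<Sum>i\<in>S. f i x) \<le> (\<Sum>i\<in>S. nrm (f i))"
proof (induction rule: finite_induct)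
  case empty then show ?case by (simp add: nrm_zero)
next
  case (insert i S)
  then show ?case
    using nrm_triangle[of "f i" "\<lambda>x. \<Sum>i\<in>S. f i x"] sum_mem[of S f] by force
qed

definition kernel_at :: "'a \<Rightarrow> 'a \<Rightarrow> complex" where "kernel_at w = kernel_fun X k w"

lemma kernel_at_mem: "w \<in> X \<Longrightarrow> kernel_at w \<in> H"
  by (simp add: kernel_at_def kernel_mem)

lemma reproduce: "w \<in> X \<Longrightarrow> f \<in> H \<Longrightarrow> ip f (kernel_at w) = f w"
  by (simp add: kernel_at_def reproducing)

lemma eval_le: "w \<in> X \<Longrightarrow> f \<in> H \<Longrightarrow> cmod (f w) \<le> nrm f * nrm (kernel_at w)"
  by (metis cauchy_schwarz kernel_at_mem reproduce)

lemma zero_outside: "f \<in> H \<Longrightarrow> x \<notin> X \<Longrightarrow> f x = 0"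
  using funs by (auto simp: funs_on_def)

lemma Cauchy_limit:
  assumes u: "\<And>n. u n \<in> H"
    and C: "\<And>e. 0 < e \<Longrightarrow> \<exists>N. \<forall>m\<ge>N. \<forall>n\<ge>N. nrm (\<lambda>x. u m x - u n x) < e"
  obtains f where "f \<in> H" "(\<lambda>n. nrm (\<lambda>x. u n x - f x)) \<longlonglongrightarrow> 0" "\<And>x. (\<lambda>n. u n x) \<longlonglongrightarrow> f x"
proof -
  obtain f where f: "f \<in> H" "(\<lambda>n. nrm (\<lambda>x. u n x - f x)) \<longlonglongrightarrow> 0"
    using complete[of u] u C unfolding nrm_def by blast
  have "(\<lambda>n. u n x) \<longlonglongrightarrow> f x" for x
  proof (cases "x \<in> X")
    case True
    have "(\<lambda>n. u n x - f x) \<longlonglongrightarrow> 0"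
    proof (rule Lim_null_comparison)
      show "\<forall>\<^sub>F n in sequentially. norm (u n x - f x) \<le> nrm (\<lambda>x. u n x - f x) * nrm (kernel_at x)"
        using eval_le[OF True diff_mem[OF u f(1)]] by simp
      show "(\<lambda>n. nrm (\<lambda>x. u n x - f x) * nrm (kernel_at x)) \<longlonglongrightarrow> 0"
        using tendsto_mult[OF f(2) tendsto_const, of "nrm (kernel_at x)"] by simp
    qed
    then show ?thesis by (simp add: LIM_zero_iff)
  next
    case False
    then have "u n x = 0" "f x = 0" for n using u f(1) zero_outside by blast+
    then show ?thesis by simp
  qed
  with f that show ?thesis by blast
qed

lemma nrm_tendsto:
  assumes "\<And>n. u n \<in> H" "f \<in> H" "(\<lambda>n. nrm (\<lambda>x. u n x - f x)) \<longlonglongrightarrow> 0"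
  shows "(\<lambda>n. nrm (u n)) \<longlonglongrightarrow> nrm f"
proof -
  have "(\<lambda>n. nrm (u n) - nrm f) \<longlonglongrightarrow> 0"
  proof (rule Lim_null_comparison[OF _ assms(3)])
    show "\<forall>\<^sub>F n in sequentially. norm (nrm (u n) - nrm f) \<le> nrm (\<lambda>x. u n x - f x)"
    proof (rule always_eventually, rule allI)
      fix n show "norm (nrm (u n) - nrm f) \<le> nrm (\<lambda>x. u n x - f x)"
        using nrm_diff_le[OF assms(1)[of n] assms(2)] nrm_diff_le[OF assms(2) assms(1)[of n]]
          nrm_diff_commute[OF assms(2) assms(1)[of n]] by simp
    qed
  qed
  then show ?thesis by (simp add: LIM_zero_iff)
qed

lemma ip_tendsto:
  assumes "\<And>n. u n \<in> H" "f \<in> H" "(\<lambda>n. nrm (\<lambda>x. u n x - f x)) \<longlonglongrightarrow> 0" "g \<in> H"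
  shows "(\<lambda>n. ip g (u n)) \<longlonglongrightarrow> ip g f"
proof -
  have "(\<lambda>n. ip g (u n) - ip g f) \<longlonglongrightarrow> 0"
  proof (rule Lim_null_comparison)
    show "\<forall>\<^sub>F n in sequentially. norm (ip g (u n) - ip g f) \<le> nrm g * nrm (\<lambda>x. u n x - f x)"
      using cauchy_schwarz[OF assms(4) diff_mem[OF assms(1,2)]] by (simp add: ip_diff2 assms)
    show "(\<lambda>n. nrm g * nrm (\<lambda>x. u n x - f x)) \<longlonglongrightarrow> 0"
      using tendsto_mult[OF tendsto_const assms(3), of "nrm g"] by simp
  qed
  then show ?thesis by (simp add: LIM_zero_iff)
qed

lemma series_mem:
  assumes h: "\<And>n. h n \<in> H" and s: "summable (\<lambda>n::nat. nrm (h n))"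
  shows "(\<lambda>x. \<Sum>n. h n x) \<in> H" "nrm (\<lambda>x. \<Sum>n. h n x) \<le> (\<Sum>n. nrm (h n))" "\<And>x. summable (\<lambda>n. h n x)"
proof -
  define u where "u N = (\<lambda>x. \<Sum>n<N. h n x)" for N
  have u: "u N \<in> H" for N unfolding u_def by (intro sum_mem h) auto
  have d: "nrm (\<lambda>x. u m x - u n x) \<le> (\<Sum>i=n..<m. nrm (h i))" if "n \<le> m" for m n
  proof -
    have "(\<lambda>x. u m x - u n x) = (\<lambda>x. \<Sum>i=n..<m. h i x)"
      unfolding u_def lessThan_atLeast0 using that by (simp add: sum_diff_nat_ivl)
    then show ?thesis using nrm_sum_le[of "{n..<m}" h] h by simp
  qed
  have C: "\<exists>N. \<forall>m\<ge>N. \<forall>n\<ge>N. nrm (\<lambda>x. u m x - u n x) < e" if e: "0 < e" for e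
  proof -
    obtain N where N: "\<And>m n. m \<ge> N \<Longrightarrow> norm (\<Sum>i=m..<n. nrm (h i)) < e"
      using s[unfolded summable_Cauchy, rule_format, OF e] by auto
    have "nrm (\<lambda>x. u m x - u n x) < e" if "m \<ge> N" "n \<ge> N" for m n
    proof (cases "n \<le> m")
      case True
      have "(\<Sum>i=n..<m. nrm (h i)) < e" using N[OF that(2), of m] by simp
      with d[OF True] show ?thesis by linarith
    next
      case False
      then have le: "m \<le> n" by simp
      have "(\<Sum>i=m..<n. nrm (h i)) < e" using N[OF that(1), of n] by simp
      with d[OF le] show ?thesis using nrm_diff_commute[OF u[of m] u[of n]] by linarith
    qed
    then show ?thesis by blast
  qed
  obtain f where f: "f \<in> H" "(\<lambda>n. nrm (\<lambda>x. u n x - f x)) \<longlonglongrightarrow> 0" "\<And>x. (\<lambda>n. u n x) \<longlonglongrightarrow> f x"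
    using Cauchy_limit[OF u C] by blast
  have sm: "(\<lambda>n. h n x) sums f x" for x
    using f(3)[of x] by (simp add: sums_def u_def)
  then have eq: "(\<lambda>x. \<Sum>n. h n x) = f" by (auto simp: sums_iff)
  show "(\<lambda>x. \<Sum>n. h n x) \<in> H" using eq f(1) by simp
  show "\<And>x. summable (\<lambda>n. h n x)" using sm sums_summable by blast
  have "nrm f \<le> (\<Sum>n. nrm (h n))"
  proof (rule LIMSEQ_le_const2[OF nrm_tendsto[OF u f(1,2)]])
    have "nrm (u n) \<le> (\<Sum>n. nrm (h n))" for n
    proof -
      have "nrm (u n) \<le> (\<Sum>i<n. nrm (h i))" unfolding u_def by (intro nrm_sum_le h) auto
      also have "\<dots> \<le> (\<Sum>n. nrm (h n))" by (intro sum_le_suminf s) (auto simp: nrm_ge0 h)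
      finally show ?thesis .
    qed
    then show "\<exists>N. \<forall>n\<ge>N. nrm (u n) \<le> (\<Sum>n. nrm (h n))" by blast
  qed
  then show "nrm (\<lambda>x. \<Sum>n. h n x) \<le> (\<Sum>n. nrm (h n))" using eq by simp
qed

end

section \<open>Positive semidefinite kernels\<close>

text \<open>
  Only the real part of the quadratic form is tested, so that Hermitian symmetry never has to be
  established.
\<close>

definition psd :: "'a set \<Rightarrow> ('a \<Rightarrow> 'a \<Rightarrow> complex) \<Rightarrow> bool" where
  "psd X P \<longleftrightarrow> (\<forall>(n::nat) a v. (\<forall>i<n. v i \<in> X) \<longrightarrow>
     0 \<le> Re (\<Sum>i<n. \<Sum>j<n. cnj (a i) * a j * P (v i) (v j)))"

lemma psdD: "psd X P \<Longrightarrow> \<forall>i<n. v i \<in> X \<Longrightarrow>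
    0 \<le> Re (\<Sum>i<n. \<Sum>j<n. cnj (a i) * a j * P (v i) (v j))" for n :: nat
  unfolding psd_def by blast

lemma psd_cong: "psd X P \<Longrightarrow> (\<And>z w. z \<in> X \<Longrightarrow> w \<in> X \<Longrightarrow> P z w = Q z w) \<Longrightarrow> psd X Q"
proof -
  assume P: "psd X P" and eq: "\<And>z w. z \<in> X \<Longrightarrow> w \<in> X \<Longrightarrow> P z w = Q z w"
  show "psd X Q" unfolding psd_def
  proof (intro allI impI)
    fix n :: nat and a v assume v: "\<forall>i<n. v i \<in> X"
    have "(\<Sum>i<n. \<Sum>j<n. cnj (a i) * a j * Q (v i) (v j)) = (\<Sum>i<n. \<Sum>j<n. cnj (a i) * a j * P (v i) (v j))"
      by (intro sum.cong refl) (use v eq in auto)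
    then show "0 \<le> Re (\<Sum>i<n. \<Sum>j<n. cnj (a i) * a j * Q (v i) (v j))"
      using psdD[OF P v] by simp
  qed
qed

lemma psd_add: "psd X P \<Longrightarrow> psd X Q \<Longrightarrow> psd X (\<lambda>z w. P z w + Q z w)"
  unfolding psd_def by (simp add: algebra_simps sum.distrib)

lemma psd_zero: "psd X (\<lambda>z w. 0)"
  unfolding psd_def by simp

lemma psd_sum: "finite S \<Longrightarrow> (\<And>i. i \<in> S \<Longrightarrow> psd X (P i)) \<Longrightarrow> psd X (\<lambda>z w. \<Sum>i\<in>S. P i z w)"
  by (induction rule: finite_induct) (auto simp: psd_zero intro: psd_add)

lemma psd_rank_one: "psd X P \<Longrightarrow> psd X (\<lambda>z w. \<beta> z * cnj (\<beta> w) * P z w)"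
  unfolding psd_def
proof (intro allI impI)
  fix n :: nat and a :: "nat \<Rightarrow> complex" and v :: "nat \<Rightarrow> 'a"
  assume P: "\<forall>(n::nat) a v. (\<forall>i<n. v i \<in> X) \<longrightarrow> 0 \<le> Re (\<Sum>i<n. \<Sum>j<n. cnj (a i) * a j * P (v i) (v j))"
    and v: "\<forall>i<n. v i \<in> X"
  have "0 \<le> Re (\<Sum>i<n. \<Sum>j<n. cnj (a i * cnj (\<beta> (v i))) * (a j * cnj (\<beta> (v j))) * P (v i) (v j))"
    using P[rule_format, of n v "\<lambda>i. a i * cnj (\<beta> (v i))"] v by simp
  then show "0 \<le> Re (\<Sum>i<n. \<Sum>j<n. cnj (a i) * a j * (\<beta> (v i) * cnj (\<beta> (v j)) * P (v i) (v j)))"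
    by (simp add: mult_ac)
qed

lemma psd_limit:
  assumes "\<And>N::nat. psd X (P N)" "\<And>z w. z \<in> X \<Longrightarrow> w \<in> X \<Longrightarrow> (\<lambda>N. P N z w) \<longlonglongrightarrow> Q z w"
  shows "psd X Q"
  unfolding psd_def
proof (intro allI impI)
  fix n :: nat and a :: "nat \<Rightarrow> complex" and v :: "nat \<Rightarrow> 'a"
  assume v: "\<forall>i<n. v i \<in> X"
  have "(\<lambda>N. Re (\<Sum>i<n. \<Sum>j<n. cnj (a i) * a j * P N (v i) (v j)))
     \<longlonglongrightarrow> Re (\<Sum>i<n. \<Sum>j<n. cnj (a i) * a j * Q (v i) (v j))"
    by (intro tendsto_Re tendsto_sum tendsto_mult tendsto_const assms(2)) (use v in auto)
  moreover have "0 \<le> Re (\<Sum>i<n. \<Sum>j<n. cnj (a i) * a j * P N (v i) (v j))" for N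
    using psdD[OF assms(1)] v by blast
  ultimately show "0 \<le> Re (\<Sum>i<n. \<Sum>j<n. cnj (a i) * a j * Q (v i) (v j))"
    using LIMSEQ_le_const by blast
qed

lemma cinner_vec_norm: "cinner_vec z z = of_real ((norm z)\<^sup>2)"
  unfolding cinner_vec_def norm_vec_def L2_set_def
  by (simp add: sum_nonneg complex_norm_square[symmetric])

lemma cinner_vec_commute: "cinner_vec w z = cnj (cinner_vec z w)"
  unfolding cinner_vec_def by (simp add: mult.commute)

lemma cinner_vec_le: "cmod (cinner_vec z w) \<le> norm z * norm w"
proof -
  have "cmod (cinner_vec z w) \<le> (\<Sum>i\<in>UNIV. \<bar>cmod (z $ i)\<bar> * \<bar>cmod (w $ i)\<bar>)"
    unfolding cinner_vec_def by (rule order_trans[OF norm_sum]) (simp add: norm_mult)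
  also have "\<dots> \<le> norm z * norm w"
    unfolding norm_vec_def by (rule L2_set_mult_ineq)
  finally show ?thesis .
qed

lemma cinner_vec_lt1: "norm z < 1 \<Longrightarrow> norm w \<le> 1 \<Longrightarrow> cmod (cinner_vec z w) < 1"
  using cinner_vec_le[of z w] by (smt (verit) mult_left_le norm_ge_zero)

text \<open>
  This case of the Schur product theorem needs no factorisation of \<open>P\<close>: multiplying by the inner product
  adds up finitely many rank one scalings of \<open>P\<close>.
\<close>

lemma psd_mult_cinner_power:
  assumes "psd X P"
  shows "psd X (\<lambda>z w. cinner_vec (b z) (b w) ^ n * P z w)"
proof (induction n)
  case 0 then show ?case using assms by simp
next
  case (Suc n)
  have "psd X (\<lambda>z w. \<Sum>i\<in>UNIV. b z $ i * cnj (b w $ i) * (cinner_vec (b z) (b w) ^ n * P z w))"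
    by (rule psd_sum) (auto intro: psd_rank_one[OF Suc.IH])
  then show ?case
    by (rule psd_cong) (simp add: cinner_vec_def sum_distrib_right[symmetric] mult.assoc[symmetric])
qed

text \<open>
  The quotient is the sum of the geometric series, whose partial sums are covered by the previous lemma.
\<close>

lemma psd_divide_one_minus_cinner:
  assumes P: "psd X P" and b: "\<And>z. z \<in> X \<Longrightarrow> norm (b z) < 1"
  shows "psd X (\<lambda>z w. P z w / (1 - cinner_vec (b z) (b w)))"
proof (rule psd_limit)
  show "psd X (\<lambda>z w. \<Sum>n<N. cinner_vec (b z) (b w) ^ n * P z w)" for N
    by (rule psd_sum) (auto intro: psd_mult_cinner_power[OF P])
  fix z w assume "z \<in> X" "w \<in> X"
  then have "cmod (cinner_vec (b z) (b w)) < 1"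
    using b cinner_vec_lt1 less_imp_le by blast
  then have "(\<lambda>n. cinner_vec (b z) (b w) ^ n * P z w) sums (1 / (1 - cinner_vec (b z) (b w)) * P z w)"
    by (intro sums_mult2 geometric_sums)
  then show "(\<lambda>N. \<Sum>n<N. cinner_vec (b z) (b w) ^ n * P z w) \<longlonglongrightarrow> P z w / (1 - cinner_vec (b z) (b w))"
    by (simp add: sums_def)
qed

section \<open>Membership and the span of the kernel functions\<close>

context rkhs
begin

definition kernel_comb :: "nat \<Rightarrow> (nat \<Rightarrow> complex) \<Rightarrow> (nat \<Rightarrow> 'a) \<Rightarrow> 'a \<Rightarrow> complex" where
  "kernel_comb n a v = (\<lambda>x. \<Sum>i<n. a i * kernel_at (v i) x)"

lemma kernel_comb_mem: "\<forall>i<n. v i \<in> X \<Longrightarrow> kernel_comb n a v \<in> H"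
  unfolding kernel_comb_def by (intro sum_mem scale_mem kernel_at_mem) auto

lemma ip_kernel_comb:
  assumes "\<forall>i<n. v i \<in> X" "q \<in> H"
  shows "ip q (kernel_comb n a v) = (\<Sum>i<n. cnj (a i) * q (v i))"
proof -
  have "ip q (kernel_comb n a v) = (\<Sum>i<n. ip q (\<lambda>x. a i * kernel_at (v i) x))"
    unfolding kernel_comb_def by (intro ip_sum2 scale_mem kernel_at_mem) (use assms in auto)
  also have "\<dots> = (\<Sum>i<n. cnj (a i) * q (v i))"
    using assms by (intro sum.cong refl) (simp add: ip_scale2 kernel_at_mem reproduce)
  finally show ?thesis .
qed

lemma nrm_kernel_comb_sq:
  assumes "\<forall>i<n. v i \<in> X"
  shows "(nrm (kernel_comb n a v))\<^sup>2 = Re (\<Sum>i<n. \<Sum>j<n. cnj (a i) * a j * k (v i) (v j))"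
proof -
  have "ip (kernel_comb n a v) (kernel_comb n a v) = (\<Sum>i<n. cnj (a i) * (\<Sum>j<n. a j * kernel_at (v j) (v i)))"
    by (subst ip_kernel_comb[OF assms kernel_comb_mem[OF assms]]) (auto simp: kernel_comb_def)
  also have "\<dots> = (\<Sum>i<n. \<Sum>j<n. cnj (a i) * a j * k (v i) (v j))"
    unfolding sum_distrib_left
    using assms by (intro sum.cong refl) (simp add: kernel_at_def kernel_fun_def mult.assoc)
  finally show ?thesis by (simp only: nrm_sq[OF kernel_comb_mem[OF assms]])
qed

lemma psd_kernel: "psd X k"
  unfolding psd_def
proof (intro allI impI)
  fix n :: nat and a v assume v: "\<forall>i<n. v i \<in> X"
  show "0 \<le> Re (\<Sum>i<n. \<Sum>j<n. cnj (a i) * a j * k (v i) (v j))"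
    unfolding nrm_kernel_comb_sq[OF v, symmetric] by simp
qed

lemma sum_append:
  fixes f g :: "nat \<Rightarrow> complex"
  shows "(\<Sum>i<n. f i) + (\<Sum>i<m. g i) = (\<Sum>i<n+m. if i < n then f i else g (i - n))"
  by (induction m) (auto simp: add.assoc[symmetric])

text \<open>
  A function \<open>q\<close> prescribes a conjugate linear functional on combinations of kernel functions. The functional
  is kept as the set of its pairs of argument and value, because the coefficients of a combination are
  not determined by the combination.
\<close>

definition span_pairs :: "('a \<Rightarrow> complex) \<Rightarrow> (('a \<Rightarrow> complex) \<times> complex) set" where
  "span_pairs q = {(g, l). \<exists>n a v. (\<forall>i<n. v i \<in> X) \<and> g = kernel_comb n a v \<and> l = (\<Sum>i<n. cnj (a i) * q (v i))}"

lemma span_pairsI: "\<forall>i<n. v i \<in> X \<Longrightarrow> (kernel_comb n a v, \<Sum>i<n. cnj (a i) * q (v i)) \<in> span_pairs q"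
  unfolding span_pairs_def by blast

lemma span_pairs_mem: "(g, l) \<in> span_pairs q \<Longrightarrow> g \<in> H"
  unfolding span_pairs_def using kernel_comb_mem by auto

lemma span_pairs_add:
  assumes "(g, l) \<in> span_pairs q" "(g', l') \<in> span_pairs q"
  shows "(\<lambda>x. g x + g' x, l + l') \<in> span_pairs q"
proof -
  obtain n a v where 1: "\<forall>i<n. v i \<in> X" "g = kernel_comb n a v" "l = (\<Sum>i<n. cnj (a i) * q (v i))"
    using assms(1) unfolding span_pairs_def by auto
  obtain m a' v' where 2: "\<forall>i<m. v' i \<in> X" "g' = kernel_comb m a' v'" "l' = (\<Sum>i<m. cnj (a' i) * q (v' i))"
    using assms(2) unfolding span_pairs_def by auto
  define A where "A i = (if i < n then a i else a' (i - n))" for i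
  define V where "V i = (if i < n then v i else v' (i - n))" for i
  have "\<forall>i<n + m. V i \<in> X"
    using 1(1) 2(1) by (auto simp: V_def)
  then have "(kernel_comb (n+m) A V, \<Sum>i<n+m. cnj (A i) * q (V i)) \<in> span_pairs q"
    by (rule span_pairsI)
  moreover have "kernel_comb (n+m) A V = (\<lambda>x. g x + g' x)"
    unfolding 1(2) 2(2) kernel_comb_def sum_append A_def V_def by (intro ext sum.cong) auto
  moreover have "(\<Sum>i<n+m. cnj (A i) * q (V i)) = l + l'"
    unfolding 1(3) 2(3) sum_append A_def V_def by (intro sum.cong) auto
  ultimately show ?thesis by simp
qed

lemma span_pairs_scale:
  assumes "(g, l) \<in> span_pairs q"
  shows "(\<lambda>x. c * g x, cnj c * l) \<in> span_pairs q"
proof -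
  obtain n a v where 1: "\<forall>i<n. v i \<in> X" "g = kernel_comb n a v" "l = (\<Sum>i<n. cnj (a i) * q (v i))"
    using assms(1) unfolding span_pairs_def by auto
  have "(kernel_comb n (\<lambda>i. c * a i) v, \<Sum>i<n. cnj (c * a i) * q (v i)) \<in> span_pairs q"
    by (rule span_pairsI) (rule 1)
  moreover have "kernel_comb n (\<lambda>i. c * a i) v = (\<lambda>x. c * g x)"
    unfolding 1(2) kernel_comb_def sum_distrib_left mult.assoc ..
  moreover have "(\<Sum>i<n. cnj (c * a i) * q (v i)) = cnj c * l"
    unfolding 1(3) sum_distrib_left complex_cnj_mult mult.assoc ..
  ultimately show ?thesis by simp
qed

lemma span_pairs_kernel_at: "x \<in> X \<Longrightarrow> (kernel_at x, q x) \<in> span_pairs q"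
  using span_pairsI[of 1 "\<lambda>_. x" "\<lambda>_. 1" q] by (simp add: kernel_comb_def)

lemma span_pairs_ip: "(g, l) \<in> span_pairs q \<Longrightarrow> q \<in> H \<Longrightarrow> l = ip q g"
proof -
  assume "(g, l) \<in> span_pairs q" and q: "q \<in> H"
  then obtain n a v where v: "\<forall>i<n. v i \<in> X"
    and gl: "g = kernel_comb n a v" "l = (\<Sum>i<n. cnj (a i) * q (v i))"
    unfolding span_pairs_def by auto
  show "l = ip q g" unfolding gl by (rule ip_kernel_comb[symmetric, OF v q])
qed

text \<open>
  This is the Riesz representation of the functional given by \<open>q\<close>, together with the density of the kernel
  functions. The representing element is the limit of combinations that nearly minimise the functional
  \<open>\<parallel>g\<parallel>\<^sup>2 - 2 Re (l g)\<close>.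
\<close>

lemma riesz_limit:
  assumes q: "q \<in> funs_on X" and M: "0 \<le> M"
    and bd: "\<And>n a v. \<forall>i<n. v i \<in> X \<Longrightarrow>
      cmod (\<Sum>i<n. cnj (a i) * q (v i)) \<le> M * nrm (kernel_comb n a v)"
  shows "\<exists>g l. q \<in> H \<and> nrm q \<le> M \<and> (\<forall>j::nat. (g j, l j) \<in> span_pairs q) \<and>
    (\<lambda>j. nrm (\<lambda>x. g j x - q x)) \<longlonglongrightarrow> 0"
proof -
  define J where "J = (\<lambda>(g, l). (nrm g)\<^sup>2 - 2 * Re l)"
  define m where "m = (INF p\<in>span_pairs q. J p)"
  have lb: "cmod l \<le> M * nrm g" if gl: "(g, l) \<in> span_pairs q" for g l
  proof -
    obtain n a v where v: "\<forall>i<n. v i \<in> X"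
      and eq: "g = kernel_comb n a v" "l = (\<Sum>i<n. cnj (a i) * q (v i))"
      using gl unfolding span_pairs_def by auto
    show ?thesis unfolding eq by (rule bd[OF v])
  qed
  have "- M\<^sup>2 \<le> J p" if "p \<in> span_pairs q" for p
  proof -
    obtain g l where p: "p = (g, l)" by fastforce
    have "Re l \<le> M * nrm g"
      using lb[of g l] that complex_Re_le_cmod[of l] by (simp add: p)
    moreover have "0 \<le> (nrm g - M)\<^sup>2" by simp
    ultimately show ?thesis by (simp add: p J_def power2_diff mult.commute mult.left_commute)
  qed
  then have bdd: "bdd_below (J ` span_pairs q)" by (rule bdd_belowI2)
  have mle: "m \<le> J p" if "p \<in> span_pairs q" for p
    unfolding m_def by (rule cINF_lower[OF bdd that])
  have ne: "span_pairs q \<noteq> {}"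
    using span_pairsI[of 0] by blast
  have "\<exists>p. p \<in> span_pairs q \<and> J p < m + 1 / Suc j" for j
  proof -
    have "m < m + 1 / Suc j" by simp
    then show ?thesis unfolding m_def using cINF_less_iff[OF ne bdd] by blast
  qed
  then obtain p where p: "\<And>j. p j \<in> span_pairs q" "\<And>j. J (p j) < m + 1 / Suc j"
    by metis
  define g where "g j = fst (p j)" for j
  define l where "l j = snd (p j)" for j
  have gl: "(g j, l j) \<in> span_pairs q" for j using p(1) by (simp add: g_def l_def)
  have Jlt: "(nrm (g j))\<^sup>2 - 2 * Re (l j) < m + 1 / Suc j" for j
    using p(2)[of j] by (simp add: J_def g_def l_def split_beta)
  have gH: "g j \<in> H" for j using gl span_pairs_mem by blast
  \<comment> \<open>The parallelogram law turns near-minimality of J into the Cauchy property.\<close>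
  have par: "(nrm (\<lambda>x. g i x - g j x))\<^sup>2 < 2 * (1 / Suc i) + 2 * (1 / Suc j)" for i j
  proof -
    have "(\<lambda>x. (1/2) * (g i x + g j x), cnj (1/2) * (l i + l j)) \<in> span_pairs q"
      by (intro span_pairs_scale[where g = "\<lambda>x. g i x + g j x"] span_pairs_add gl)
    then have "m \<le> J (\<lambda>x. (1/2) * (g i x + g j x), cnj (1/2) * (l i + l j))" by (rule mle)
    also have "\<dots> = ((nrm (g i))\<^sup>2 + (nrm (g j))\<^sup>2 + 2 * Re (ip (g i) (g j))) / 4 - Re (l i) - Re (l j)"
    proof -
      have "nrm (\<lambda>x. (1/2) * (g i x + g j x)) = (1/2) * nrm (\<lambda>x. g i x + g j x)"
        using nrm_scale[OF add_mem[OF gH[of i] gH[of j]], of "1/2"] by (simp del: divide_inverse)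
      then have "(nrm (\<lambda>x. (1/2) * (g i x + g j x)))\<^sup>2 = (nrm (\<lambda>x. g i x + g j x))\<^sup>2 / 4"
        by (simp only: power_mult_distrib) (simp add: power_divide)
      then show ?thesis
        unfolding J_def prod.case nrm_add_sq[OF gH gH] by (simp add: field_simps)
    qed
    finally have mid: "m \<le> ((nrm (g i))\<^sup>2 + (nrm (g j))\<^sup>2 + 2 * Re (ip (g i) (g j))) / 4 - Re (l i) - Re (l j)" .
    have "A + B - 2 * R < 2 * e + 2 * e'"
      if "m \<le> (A + B + 2 * R) / 4 - a - b" "A - 2 * a < m + e" "B - 2 * b < m + e'" for A B R a b e e' :: real
      using that by (simp add: field_simps)
    then show ?thesis
      unfolding nrm_diff_sq[OF gH gH] using mid Jlt by blast
  qed
  have C: "\<exists>N. \<forall>i\<ge>N. \<forall>j\<ge>N. nrm (\<lambda>x. g i x - g j x) < e" if e: "0 < e" for e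
  proof -
    obtain N where N: "inverse (real (Suc N)) < e\<^sup>2 / 4"
      using reals_Archimedean[of "e\<^sup>2 / 4"] e by auto
    have "nrm (\<lambda>x. g i x - g j x) < e" if "i \<ge> N" "j \<ge> N" for i j
    proof -
      have "1 / real (Suc i) \<le> 1 / real (Suc N)" "1 / real (Suc j) \<le> 1 / real (Suc N)"
        using that by (auto intro!: divide_left_mono)
      then have "(nrm (\<lambda>x. g i x - g j x))\<^sup>2 < e\<^sup>2"
        using par[of i j] N by (simp add: inverse_eq_divide)
      then show ?thesis using e power2_less_imp_less by fastforce
    qed
    then show ?thesis by blast
  qed
  obtain f where f: "f \<in> H" "(\<lambda>n. nrm (\<lambda>x. g n x - f x)) \<longlonglongrightarrow> 0" "\<And>x. (\<lambda>n. g n x) \<longlonglongrightarrow> f x"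
    using Cauchy_limit[of g, OF gH C] by blast
  \<comment> \<open>Varying a near-minimiser in the direction of a kernel function identifies the limit.\<close>
  have "f x = q x" for x
  proof (cases "x \<in> X")
    case x: True
    define \<kappa> where "\<kappa> = (nrm (kernel_at x))\<^sup>2"
    have var: "0 \<le> 2 * Re (cnj t * (f x - q x)) + (cmod t)\<^sup>2 * \<kappa>" for t
    proof -
      have "- (1 / Suc j) \<le> 2 * Re (cnj t * (g j x - q x)) + (cmod t)\<^sup>2 * \<kappa>" for j
      proof -
        have "(\<lambda>y. g j y + t * kernel_at x y, l j + cnj t * q x) \<in> span_pairs q"
          by (intro span_pairs_add span_pairs_scale span_pairs_kernel_at gl x)
        then have "m \<le> J (\<lambda>y. g j y + t * kernel_at x y, l j + cnj t * q x)" by (rule mle)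
        also have "\<dots> = (nrm (g j))\<^sup>2 - 2 * Re (l j) + (cmod t)\<^sup>2 * \<kappa> + 2 * Re (cnj t * (g j x - q x))"
          unfolding J_def prod.case \<kappa>_def using x
          by (simp add: nrm_add_sq gH scale_mem kernel_at_mem nrm_scale power_mult_distrib ip_scale2 reproduce
              right_diff_distrib)
        finally show ?thesis using Jlt[of j] by simp
      qed
      moreover have "(\<lambda>j. 2 * Re (cnj t * (g j x - q x)) + (cmod t)\<^sup>2 * \<kappa>) \<longlonglongrightarrow>
          2 * Re (cnj t * (f x - q x)) + (cmod t)\<^sup>2 * \<kappa>"
        by (intro tendsto_intros f(3))
      moreover have "(\<lambda>j. - (1 / real (Suc j))) \<longlonglongrightarrow> 0"
        using tendsto_minus[OF LIMSEQ_inverse_real_of_nat] by (simp add: inverse_eq_divide)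
      ultimately show ?thesis
        using LIMSEQ_le by blast
    qed
    define s where "s = 1 / (\<kappa> + 1)"
    have k0: "0 \<le> \<kappa>" by (simp add: \<kappa>_def)
    define \<delta> where "\<delta> = f x - q x"
    have "cnj (- of_real s * \<delta>) * \<delta> = - (of_real s * (\<delta> * cnj \<delta>))"
      by simp
    also have "\<delta> * cnj \<delta> = of_real ((cmod \<delta>)\<^sup>2)" by (rule complex_norm_square[symmetric])
    finally have "cnj (- of_real s * \<delta>) * \<delta> = of_real (- (s * (cmod \<delta>)\<^sup>2))"
      by (simp only: of_real_minus of_real_mult)
    then have "Re (cnj (- of_real s * \<delta>) * \<delta>) = - (s * (cmod \<delta>)\<^sup>2)"
      by (simp only: Re_complex_of_real)
    moreover have "(cmod (- of_real s * \<delta>))\<^sup>2 = s\<^sup>2 * (cmod \<delta>)\<^sup>2"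
      by (simp add: norm_mult power_mult_distrib)
    ultimately have "0 \<le> 2 * - (s * (cmod \<delta>)\<^sup>2) + s\<^sup>2 * (cmod \<delta>)\<^sup>2 * \<kappa>"
      using var[of "- of_real s * \<delta>"] unfolding \<delta>_def[symmetric] by (simp only:)
    then have "0 \<le> (cmod \<delta>)\<^sup>2 * (s * (s * \<kappa> - 2))"
      by (simp add: power2_eq_square algebra_simps)
    moreover have "s * (s * \<kappa> - 2) < 0"
      using k0 by (intro mult_pos_neg) (auto simp: s_def field_simps)
    ultimately have "(cmod \<delta>)\<^sup>2 \<le> 0"
      using mult_pos_neg[of "(cmod \<delta>)\<^sup>2" "s * (s * \<kappa> - 2)"] by linarith
    then show ?thesis by (simp add: \<delta>_def)
  next
    case False
    then show ?thesis using f(1) zero_outside q by (simp add: funs_on_def)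
  qed
  then have fq: "f = q" by auto
  have qH: "q \<in> H" using f(1) fq by simp
  have l: "l j = ip q (g j)" for j using span_pairs_ip[OF gl qH] .
  have conv: "(\<lambda>n. nrm (\<lambda>x. g n x - q x)) \<longlonglongrightarrow> 0" using f(2) fq by simp
  have "(\<lambda>j. cmod (ip q (g j))) \<longlonglongrightarrow> cmod (ip q q)"
    by (intro tendsto_norm ip_tendsto gH qH conv)
  moreover have "(\<lambda>j. M * nrm (g j)) \<longlonglongrightarrow> M * nrm q"
    by (intro tendsto_mult tendsto_const nrm_tendsto gH qH conv)
  moreover have "cmod (ip q (g j)) \<le> M * nrm (g j)" for j
    using lb[OF gl[of j]] l by simp
  ultimately have "cmod (ip q q) \<le> M * nrm q"
    using LIMSEQ_le by blast
  then have "(nrm q)\<^sup>2 \<le> M * nrm q" using ip_self[OF qH] by (simp add: norm_power)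
  then have "nrm q \<le> M"
    using M nrm_ge0[OF qH] by (cases "nrm q = 0") (auto simp: power2_eq_square)
  then show ?thesis using qH gl conv by blast
qed

lemma mem_of_kernel_bound:
  assumes "q \<in> funs_on X" "0 \<le> M"
    and "\<And>n a v. \<forall>i<n. v i \<in> X \<Longrightarrow>
      cmod (\<Sum>i<n. cnj (a i) * q (v i)) \<le> M * nrm (kernel_comb n a v)"
  shows "q \<in> H" "nrm q \<le> M"
  using riesz_limit[OF assms] by auto

lemma kernel_span_dense:
  assumes q: "q \<in> H"
  shows "\<exists>u. (\<forall>j. \<exists>n a v. (\<forall>i<n. v i \<in> X) \<and> u j = kernel_comb n a v) \<and>
    (\<lambda>j::nat. nrm (\<lambda>x. u j x - q x)) \<longlonglongrightarrow> 0"
proof -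
  have "q \<in> funs_on X" using funs q by blast
  moreover have "cmod (\<Sum>i<n. cnj (a i) * q (v i)) \<le> nrm q * nrm (kernel_comb n a v)"
    if v: "\<forall>i<n. v i \<in> X" for n a v
    unfolding ip_kernel_comb[OF v q, symmetric] by (rule cauchy_schwarz[OF q kernel_comb_mem[OF v]])
  ultimately obtain g l where gl: "\<And>j::nat. (g j, l j) \<in> span_pairs q"
    and lim: "(\<lambda>j. nrm (\<lambda>x. g j x - q x)) \<longlonglongrightarrow> 0"
    using riesz_limit[OF _ nrm_ge0[OF q], of q] by auto
  have "\<exists>n a v. (\<forall>i<n. v i \<in> X) \<and> g j = kernel_comb n a v" for j
    using gl[of j] unfolding span_pairs_def by auto
  with lim show ?thesis by blast
qed

end

section \<open>Bounded multipliers and row contractions\<close>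

lemma cmod_sum_sq:
  fixes a :: "nat \<Rightarrow> complex"
  shows "of_real ((cmod (\<Sum>i<n. cnj (a i) * f (v i)))\<^sup>2) = (\<Sum>i<n. \<Sum>j<n. cnj (a i) * a j * (f (v i) * cnj (f (v j))))"
  unfolding complex_norm_square cnj_sum sum_product
  by (intro sum.cong refl) simp

context rkhs
begin

text \<open>
  Multipliers with an explicit norm bound. All the multipliers that have to be bounded come with such a
  bound, which replaces an appeal to the closed graph theorem.
\<close>

definition bmult :: "('a \<Rightarrow> complex) \<Rightarrow> real \<Rightarrow> bool" where
  "bmult \<psi> M \<longleftrightarrow> \<psi> \<in> funs_on X \<and> (\<forall>f\<in>H. (\<lambda>x. \<psi> x * f x) \<in> H \<and> nrm (\<lambda>x. \<psi> x * f x) \<le> M * nrm f)"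

lemma bmult_Mult: "bmult \<psi> M \<Longrightarrow> \<psi> \<in> Mult X H"
  unfolding bmult_def Mult_def by blast

lemma bmult_le: "bmult \<psi> M \<Longrightarrow> M \<le> M' \<Longrightarrow> bmult \<psi> M'"
  unfolding bmult_def by (meson mult_right_mono nrm_ge0 order_trans)

lemma bmult_mult:
  assumes "bmult \<psi> M" "bmult \<phi> N" "0 \<le> M"
  shows "bmult (\<lambda>x. \<psi> x * \<phi> x) (M * N)"
  unfolding bmult_def
proof (intro conjI ballI)
  show "(\<lambda>x. \<psi> x * \<phi> x) \<in> funs_on X" using assms by (auto simp: bmult_def funs_on_def)
  fix f assume f: "f \<in> H"
  have 1: "(\<lambda>x. \<phi> x * f x) \<in> H" "nrm (\<lambda>x. \<phi> x * f x) \<le> N * nrm f"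
    using assms(2) f by (auto simp: bmult_def)
  have 2: "(\<lambda>x. \<psi> x * (\<phi> x * f x)) \<in> H" "nrm (\<lambda>x. \<psi> x * (\<phi> x * f x)) \<le> M * nrm (\<lambda>x. \<phi> x * f x)"
    using assms(1) 1(1) by (auto simp: bmult_def)
  show "(\<lambda>x. \<psi> x * \<phi> x * f x) \<in> H" using 2(1) by (simp add: mult.assoc)
  show "nrm (\<lambda>x. \<psi> x * \<phi> x * f x) \<le> M * N * nrm f"
    using 2(2) mult_left_mono[OF 1(2) assms(3)] by (simp add: mult.assoc)
qed

lemma bmult_power:
  assumes "bmult \<psi> M" "0 \<le> M" "f \<in> H"
  shows "(\<lambda>x. \<psi> x ^ n * f x) \<in> H \<and> nrm (\<lambda>x. \<psi> x ^ n * f x) \<le> M ^ n * nrm f"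
proof (induction n)
  case 0 then show ?case using assms by simp
next
  case (Suc n)
  have "(\<lambda>x. \<psi> x * (\<psi> x ^ n * f x)) \<in> H"
    "nrm (\<lambda>x. \<psi> x * (\<psi> x ^ n * f x)) \<le> M * nrm (\<lambda>x. \<psi> x ^ n * f x)"
    using assms(1) Suc by (auto simp: bmult_def)
  moreover have "M * nrm (\<lambda>x. \<psi> x ^ n * f x) \<le> M * (M ^ n * nrm f)"
    using Suc assms(2) by (intro mult_left_mono) auto
  ultimately show ?case by (simp add: mult.assoc)
qed

lemma neumann_series:
  assumes b: "bmult \<psi> M" and M: "0 \<le> M" "M < 1" and f: "f \<in> H"
  obtains g where "g \<in> H" "\<And>x. (1 - \<psi> x) * g x = f x"
proof -
  define h where "h n = (\<lambda>x. \<psi> x ^ n * f x)" for n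
  have h: "h n \<in> H" "nrm (h n) \<le> M ^ n * nrm f" for n
    using bmult_power[OF b M(1) f] by (auto simp: h_def)
  have s: "summable (\<lambda>n. nrm (h n))"
  proof (rule summable_comparison_test')
    show "summable (\<lambda>n. M ^ n * nrm f)" using M by (intro summable_mult2 summable_geometric) auto
    show "norm (nrm (h n)) \<le> M ^ n * nrm f" if "n \<ge> 0" for n using h[of n] nrm_ge0 by simp
  qed
  note sm = series_mem[OF h(1) s]
  have "(1 - \<psi> x) * (\<Sum>n. h n x) = f x" for x
  proof -
    have "(\<Sum>n. h n x) = h 0 x + (\<Sum>n. h (Suc n) x)"
      using suminf_split_head[OF sm(3)[of x]] by simp
    also have "(\<Sum>n. h (Suc n) x) = \<psi> x * (\<Sum>n. h n x)"
      using suminf_mult[OF sm(3)[of x], of "\<psi> x"] by (simp add: h_def mult.assoc)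
    finally show ?thesis by (simp add: h_def algebra_simps)
  qed
  with sm(1) that show thesis by blast
qed

end

text \<open>
  The kernel has the form \<open>e z * cnj (e w) / (1 - \<langle>b z, b w\<rangle>)\<close>. The Drury-Arveson kernel has this form with
  \<open>b\<close> the identity and \<open>e = 1\<close>, but also with \<open>b\<close> the automorphism of the ball that sends a given point \<open>p\<close>
  to \<open>0\<close> and \<open>e\<close> the normalised kernel function at \<open>p\<close>.
\<close>

locale ball_rkhs = rkhs X k H ip for X :: "'a set" and k H ip +
  fixes b :: "'a \<Rightarrow> complex ^ 'd" and e :: "'a \<Rightarrow> complex"
  assumes b_lt: "z \<in> X \<Longrightarrow> norm (b z) < 1"
    and e_fun: "e \<in> funs_on X"
    and e_nz: "z \<in> X \<Longrightarrow> e z \<noteq> 0"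
    and ker: "\<lbrakk>z \<in> X; w \<in> X\<rbrakk> \<Longrightarrow> k z w * (1 - cinner_vec (b z) (b w)) = e z * cnj (e w)"
begin

lemma ker_split: "\<lbrakk>z \<in> X; w \<in> X\<rbrakk> \<Longrightarrow> k z w = e z * cnj (e w) + cinner_vec (b z) (b w) * k z w"
  using ker[of z w] by (simp add: algebra_simps)

lemma cinner_b_lt: "\<lbrakk>z \<in> X; w \<in> X\<rbrakk> \<Longrightarrow> cmod (cinner_vec (b z) (b w)) < 1"
  using cinner_vec_lt1 b_lt less_imp_le by blast

lemma cinner_b_ne: "\<lbrakk>z \<in> X; w \<in> X\<rbrakk> \<Longrightarrow> 1 - cinner_vec (b z) (b w) \<noteq> 0"
  using cinner_b_lt[of z w] by auto

lemma nrm_kernel_comb_split: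
  assumes v: "\<forall>i<n. v i \<in> X"
  shows "(nrm (kernel_comb n a v))\<^sup>2 = (cmod (\<Sum>i<n. cnj (a i) * e (v i)))\<^sup>2 +
    Re (\<Sum>i<n. \<Sum>j<n. cnj (a i) * a j * (cinner_vec (b (v i)) (b (v j)) * k (v i) (v j)))"
proof -
  have "(\<Sum>i<n. \<Sum>j<n. cnj (a i) * a j * k (v i) (v j)) =
    (\<Sum>i<n. \<Sum>j<n. cnj (a i) * a j * (e (v i) * cnj (e (v j)))) +
    (\<Sum>i<n. \<Sum>j<n. cnj (a i) * a j * (cinner_vec (b (v i)) (b (v j)) * k (v i) (v j)))"
    unfolding sum.distrib[symmetric]
  proof (intro sum.cong refl)
    fix i j assume "i \<in> {..<n}" "j \<in> {..<n}"
    then have s: "k (v i) (v j) = e (v i) * cnj (e (v j)) + cinner_vec (b (v i)) (b (v j)) * k (v i) (v j)"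
      using v by (intro ker_split) auto
    show "cnj (a i) * a j * k (v i) (v j) = cnj (a i) * a j * (e (v i) * cnj (e (v j))) +
       cnj (a i) * a j * (cinner_vec (b (v i)) (b (v j)) * k (v i) (v j))"
      by (rule trans[OF arg_cong[OF s, of "\<lambda>t. cnj (a i) * a j * t"] distrib_left])
  qed
  moreover have "(\<Sum>i<n. \<Sum>j<n. cnj (a i) * a j * (e (v i) * cnj (e (v j)))) =
      of_real ((cmod (\<Sum>i<n. cnj (a i) * e (v i)))\<^sup>2)"
    by (rule cmod_sum_sq[symmetric])
  ultimately show ?thesis
    unfolding nrm_kernel_comb_sq[OF v] by (simp only: plus_complex.sel Re_complex_of_real)
qed

text \<open>
  Removing the rank one kernel given by \<open>e\<close> leaves \<open>\<langle>b z, b w\<rangle> * k z w\<close>, which is positive.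
\<close>

lemma e_mem: "e \<in> H" and e_nrm: "nrm e \<le> 1"
proof -
  have bd: "cmod (\<Sum>i<n. cnj (a i) * e (v i)) \<le> 1 * nrm (kernel_comb n a v)" if v: "\<forall>i<n. v i \<in> X" for n a v
  proof -
    have p: "psd X (\<lambda>z w. cinner_vec (b z) (b w) * k z w)"
      using psd_mult_cinner_power[OF psd_kernel, of b 1] by simp
    have "0 \<le> Re (\<Sum>i<n. \<Sum>j<n. cnj (a i) * a j * (cinner_vec (b (v i)) (b (v j)) * k (v i) (v j)))"
      by (rule psdD[OF p v])
    then have "(cmod (\<Sum>i<n. cnj (a i) * e (v i)))\<^sup>2 \<le> (nrm (kernel_comb n a v))\<^sup>2"
      unfolding nrm_kernel_comb_split[OF v] by (simp only: le_add_same_cancel1)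
    then have "cmod (\<Sum>i<n. cnj (a i) * e (v i)) \<le> nrm (kernel_comb n a v)"
      by (rule power2_le_imp_le) (rule nrm_ge0[OF kernel_comb_mem[OF v]])
    then show ?thesis by (simp only: mult_1)
  qed
  show "e \<in> H" by (rule mem_of_kernel_bound(1)[OF e_fun zero_le_one bd])
  show "nrm e \<le> 1" by (rule mem_of_kernel_bound(2)[OF e_fun zero_le_one bd])
qed

definition row :: "('d \<Rightarrow> 'a \<Rightarrow> complex) \<Rightarrow> 'a \<Rightarrow> complex" where
  "row h = (\<lambda>x. \<Sum>i\<in>UNIV. b x $ i * h i x)"

text \<open>
  The adjoint of the row maps the kernel function at \<open>w\<close> to its multiples by \<open>cnj (b w $ i)\<close>, and
  \<open>ker_split\<close> computes the norm of the image.
\<close>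

lemma row_kernel_comb:
  assumes h: "\<And>i. h i \<in> H" and v: "\<forall>i<n. v i \<in> X"
  shows "(cmod (\<Sum>j<n. cnj (a j) * row h (v j)))\<^sup>2 \<le>
    (\<Sum>i\<in>UNIV. (nrm (h i))\<^sup>2) * ((nrm (kernel_comb n a v))\<^sup>2 - (cmod (\<Sum>i<n. cnj (a i) * e (v i)))\<^sup>2)"
proof -
  \<comment> \<open>The image of the combination under the adjoint of the row.\<close>
  define c where "c i = kernel_comb n (\<lambda>j. a j * cnj (b (v j) $ i)) v" for i
  have c: "c i \<in> H" for i unfolding c_def by (rule kernel_comb_mem[OF v])
  have "(\<Sum>j<n. cnj (a j) * row h (v j)) = (\<Sum>j<n. \<Sum>i\<in>UNIV. cnj (a j * cnj (b (v j) $ i)) * h i (v j))"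
    unfolding row_def sum_distrib_left by (intro sum.cong refl) (simp add: mult.assoc)
  also have "\<dots> = (\<Sum>i\<in>UNIV. ip (h i) (c i))"
    unfolding c_def ip_kernel_comb[OF v h] by (rule sum.swap)
  finally have eq: "(\<Sum>j<n. cnj (a j) * row h (v j)) = (\<Sum>i\<in>UNIV. ip (h i) (c i))" .
  have "cmod (\<Sum>i\<in>UNIV. ip (h i) (c i)) \<le> (\<Sum>i\<in>UNIV. \<bar>nrm (h i)\<bar> * \<bar>nrm (c i)\<bar>)"
    by (rule order_trans[OF norm_sum])
       (use cauchy_schwarz[OF h c] nrm_ge0[OF h] nrm_ge0[OF c] in \<open>auto intro!: sum_mono\<close>)
  also have "\<dots> \<le> L2_set (\<lambda>i. nrm (h i)) UNIV * L2_set (\<lambda>i. nrm (c i)) UNIV"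
    by (rule L2_set_mult_ineq)
  finally have "(cmod (\<Sum>i\<in>UNIV. ip (h i) (c i)))\<^sup>2 \<le> (L2_set (\<lambda>i. nrm (h i)) UNIV * L2_set (\<lambda>i. nrm (c i)) UNIV)\<^sup>2"
    by (rule power_mono) simp
  also have "\<dots> = (\<Sum>i\<in>UNIV. (nrm (h i))\<^sup>2) * (\<Sum>i\<in>UNIV. (nrm (c i))\<^sup>2)"
    unfolding power_mult_distrib L2_set_def by (simp add: sum_nonneg)
  also have "(\<Sum>i\<in>UNIV. (nrm (c i))\<^sup>2) = (nrm (kernel_comb n a v))\<^sup>2 - (cmod (\<Sum>i<n. cnj (a i) * e (v i)))\<^sup>2"
  proof -
    have "(\<Sum>i\<in>UNIV. (nrm (c i))\<^sup>2) = Re (\<Sum>i\<in>UNIV. \<Sum>l<n. \<Sum>j<n. cnj (a l * cnj (b (v l) $ i)) * (a j * cnj (b (v j) $ i)) * k (v l) (v j))"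
      unfolding c_def nrm_kernel_comb_sq[OF v] Re_sum ..
    also have "(\<Sum>i\<in>UNIV. \<Sum>l<n. \<Sum>j<n. cnj (a l * cnj (b (v l) $ i)) * (a j * cnj (b (v j) $ i)) * k (v l) (v j)) =
      (\<Sum>l<n. \<Sum>j<n. \<Sum>i\<in>UNIV. cnj (a l * cnj (b (v l) $ i)) * (a j * cnj (b (v j) $ i)) * k (v l) (v j))"
      by (rule trans[OF sum.swap sum.cong[OF refl sum.swap]])
    also have "\<dots> = (\<Sum>l<n. \<Sum>j<n. cnj (a l) * a j * (cinner_vec (b (v l)) (b (v j)) * k (v l) (v j)))"
      unfolding cinner_vec_def sum_distrib_left sum_distrib_right
      by (intro sum.cong refl) (simp add: mult_ac)
    finally show ?thesis unfolding nrm_kernel_comb_split[OF v] by (simp only: add_diff_cancel_left')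
  qed
  finally show ?thesis unfolding eq .
qed

lemma row_mem:
  assumes h: "\<And>i. h i \<in> H"
  shows "row h \<in> H"
proof (rule mem_of_kernel_bound(1)[where M = "sqrt (\<Sum>i\<in>UNIV. (nrm (h i))\<^sup>2)"])
  show "row h \<in> funs_on X" unfolding funs_on_def row_def using zero_outside[OF h] by simp
  show "0 \<le> sqrt (\<Sum>i\<in>UNIV. (nrm (h i))\<^sup>2)" by (simp add: sum_nonneg)
  fix n :: nat and a v assume v: "\<forall>i<n. v i \<in> X"
  have "(cmod (\<Sum>j<n. cnj (a j) * row h (v j)))\<^sup>2 \<le> (\<Sum>i\<in>UNIV. (nrm (h i))\<^sup>2) * (nrm (kernel_comb n a v))\<^sup>2"
    by (rule order_trans[OF row_kernel_comb[OF h v]]) (intro mult_left_mono sum_nonneg, auto)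
  also have "\<dots> = (sqrt (\<Sum>i\<in>UNIV. (nrm (h i))\<^sup>2) * nrm (kernel_comb n a v))\<^sup>2"
    by (simp add: power_mult_distrib sum_nonneg)
  finally show "cmod (\<Sum>j<n. cnj (a j) * row h (v j)) \<le> sqrt (\<Sum>i\<in>UNIV. (nrm (h i))\<^sup>2) * nrm (kernel_comb n a v)"
    by (rule power2_le_imp_le) (intro mult_nonneg_nonneg nrm_ge0 kernel_comb_mem v real_sqrt_ge_zero sum_nonneg zero_le_power2)
qed

text \<open>
  Besides contractivity of the row this records the defect \<open>\<bar>\<langle>e, g\<rangle>\<bar>\<^sup>2\<close>. It forces \<open>e\<close> to be orthogonal to
  the range of the row as soon as \<open>e\<close> has norm one.
\<close>

lemma row_ip:
  assumes h: "\<And>i. h i \<in> H" and g: "g \<in> H"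
  shows "(cmod (ip (row h) g))\<^sup>2 \<le> (\<Sum>i\<in>UNIV. (nrm (h i))\<^sup>2) * ((nrm g)\<^sup>2 - (cmod (ip e g))\<^sup>2)"
proof -
  obtain u where uc: "\<forall>j. \<exists>n a v. (\<forall>i<n. v i \<in> X) \<and> u j = kernel_comb n a v"
    and lim': "(\<lambda>j::nat. nrm (\<lambda>x. u j x - g x)) \<longlonglongrightarrow> 0"
    using kernel_span_dense[OF g] by (elim exE conjE)
  have u: "u j \<in> H" for j using uc kernel_comb_mem by metis
  have le: "(cmod (ip (row h) (u j)))\<^sup>2 \<le> (\<Sum>i\<in>UNIV. (nrm (h i))\<^sup>2) * ((nrm (u j))\<^sup>2 - (cmod (ip e (u j)))\<^sup>2)" for j
  proof -
    obtain n a v where v: "\<forall>i<n. v i \<in> X" and uj: "u j = kernel_comb n a v"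
      using uc by metis
    show ?thesis
      unfolding uj ip_kernel_comb[OF v row_mem[OF h]] ip_kernel_comb[OF v e_mem] by (rule row_kernel_comb[OF h v])
  qed
  have "(\<lambda>j. (cmod (ip (row h) (u j)))\<^sup>2) \<longlonglongrightarrow> (cmod (ip (row h) g))\<^sup>2"
    by (intro tendsto_intros ip_tendsto u g lim' row_mem h)
  moreover have "(\<lambda>j. (\<Sum>i\<in>UNIV. (nrm (h i))\<^sup>2) * ((nrm (u j))\<^sup>2 - (cmod (ip e (u j)))\<^sup>2)) \<longlonglongrightarrow>
      (\<Sum>i\<in>UNIV. (nrm (h i))\<^sup>2) * ((nrm g)\<^sup>2 - (cmod (ip e g))\<^sup>2)"
    by (intro tendsto_intros ip_tendsto nrm_tendsto u g lim' e_mem)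
  ultimately show ?thesis
    by (rule LIMSEQ_le) (use le in blast)
qed

lemma row_nrm:
  assumes h: "\<And>i. h i \<in> H"
  shows "(nrm (row h))\<^sup>2 \<le> (\<Sum>i\<in>UNIV. (nrm (h i))\<^sup>2)"
proof (cases "nrm (row h) = 0")
  case False
  note rm = row_mem[of h, OF h]
  have "((nrm (row h))\<^sup>2)\<^sup>2 \<le> (\<Sum>i\<in>UNIV. (nrm (h i))\<^sup>2) * ((nrm (row h))\<^sup>2 - (cmod (ip e (row h)))\<^sup>2)"
    using row_ip[of h, OF h rm] unfolding ip_self[OF rm] norm_of_real by simp
  also have "\<dots> \<le> (\<Sum>i\<in>UNIV. (nrm (h i))\<^sup>2) * (nrm (row h))\<^sup>2"
    by (intro mult_left_mono sum_nonneg) auto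
  finally have "(nrm (row h))\<^sup>2 * (nrm (row h))\<^sup>2 \<le> (\<Sum>i\<in>UNIV. (nrm (h i))\<^sup>2) * (nrm (row h))\<^sup>2"
    by (simp only: power2_eq_square[of "(nrm (row h))\<^sup>2"])
  then show ?thesis by (rule mult_right_le_imp_le) (use False in simp)
qed (simp add: sum_nonneg)

lemma coord_mult_mem: "f \<in> H \<Longrightarrow> (\<lambda>x. b x $ i * f x) \<in> H"
proof -
  assume f: "f \<in> H"
  have "row (\<lambda>l. if l = i then f else (\<lambda>x. 0)) \<in> H"
    by (rule row_mem) (simp add: f zero_mem)
  moreover have "row (\<lambda>l. if l = i then f else (\<lambda>x. 0)) = (\<lambda>x. b x $ i * f x)"
    unfolding row_def by (intro ext) (simp add: if_distrib[of "\<lambda>g. g _"] if_distrib[of "(*) _"] cong: if_cong)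
  ultimately show ?thesis by simp
qed

lemma cinner_bmult:
  assumes f: "f \<in> H"
  shows "(\<lambda>x. cinner_vec (b x) \<alpha> * f x) \<in> H" "nrm (\<lambda>x. cinner_vec (b x) \<alpha> * f x) \<le> norm \<alpha> * nrm f"
proof -
  define h where "h i = (\<lambda>x. cnj (\<alpha> $ i) * f x)" for i
  have h: "h i \<in> H" for i unfolding h_def using f by (rule scale_mem)
  have eq: "row h = (\<lambda>x. cinner_vec (b x) \<alpha> * f x)"
    unfolding row_def h_def cinner_vec_def sum_distrib_right by (simp add: mult.assoc)
  show "(\<lambda>x. cinner_vec (b x) \<alpha> * f x) \<in> H" using row_mem[of h] h eq by simp
  have "(nrm (row h))\<^sup>2 \<le> (norm \<alpha> * nrm f)\<^sup>2"
    using row_nrm[of h, OF h] unfolding h_def nrm_scale[OF f] complex_mod_cnj power_mult_distrib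
      sum_distrib_right[symmetric] by (simp add: norm_vec_def L2_set_def sum_nonneg)
  then show "nrm (\<lambda>x. cinner_vec (b x) \<alpha> * f x) \<le> norm \<alpha> * nrm f"
    unfolding eq by (rule power2_le_imp_le) (use nrm_ge0[OF f] in simp)
qed

text \<open>
  The resolvent at \<open>1\<close> of multiplication by \<open>\<langle>b x, \<alpha>\<rangle>\<close>.
\<close>

definition szego :: "complex ^ 'd \<Rightarrow> ('a \<Rightarrow> complex) \<Rightarrow> 'a \<Rightarrow> complex" where
  "szego \<alpha> f = (\<lambda>x. f x / (1 - cinner_vec (b x) \<alpha>))"

lemma szego_mem:
  assumes f: "f \<in> H" and \<alpha>: "norm \<alpha> < 1"
  shows "szego \<alpha> f \<in> H"
proof -
  define \<psi> where "\<psi> x = (if x \<in> X then cinner_vec (b x) \<alpha> else 0)" for x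
  have eq: "(\<lambda>x. \<psi> x * g x) = (\<lambda>x. cinner_vec (b x) \<alpha> * g x)" if "g \<in> H" for g
    using zero_outside[OF that] by (auto simp: \<psi>_def)
  have "bmult \<psi> (norm \<alpha>)"
    unfolding bmult_def
  proof (intro conjI ballI)
    show "\<psi> \<in> funs_on X" by (simp add: \<psi>_def funs_on_def)
    fix g assume g: "g \<in> H"
    show "(\<lambda>x. \<psi> x * g x) \<in> H" "nrm (\<lambda>x. \<psi> x * g x) \<le> norm \<alpha> * nrm g"
      unfolding eq[OF g] by (rule cinner_bmult[OF g])+
  qed
  then obtain g where g: "g \<in> H" "\<And>x. (1 - \<psi> x) * g x = f x"
    using neumann_series[OF _ norm_ge_zero \<alpha> f] by blast
  have "g = szego \<alpha> f"
  proof
    fix x show "g x = szego \<alpha> f x"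
    proof (cases "x \<in> X")
      case True
      then have "1 - cinner_vec (b x) \<alpha> \<noteq> 0"
        using cinner_vec_lt1[of "b x" \<alpha>] b_lt \<alpha> by auto
      with g(2)[of x] True show ?thesis by (simp add: szego_def \<psi>_def field_simps)
    qed (use zero_outside[OF g(1)] zero_outside[OF f] in \<open>simp add: szego_def\<close>)
  qed
  with g show ?thesis by simp
qed

end

section \<open>Quotients of pairings are multipliers\<close>

context rkhs
begin

lemma nrm_lin_sq:
  fixes n :: nat
  assumes h: "\<forall>j<n. h j \<in> H"
  shows "(nrm (\<lambda>x. \<Sum>j<n. a j * h j x))\<^sup>2 = Re (\<Sum>p<n. \<Sum>j<n. cnj (a p) * a j * ip (h j) (h p))"
proof -
  have hs: "(\<lambda>x. c * h j x) \<in> H" if "j \<in> {..<n}" for j c using h that by (simp add: scale_mem)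
  have S: "(\<lambda>x. \<Sum>j<n. a j * h j x) \<in> H" by (rule sum_mem) (simp_all add: hs)
  have "ip (\<lambda>x. \<Sum>j<n. a j * h j x) (\<lambda>x. \<Sum>j<n. a j * h j x) =
      (\<Sum>p<n. ip (\<lambda>x. \<Sum>j<n. a j * h j x) (\<lambda>x. a p * h p x))"
    by (rule ip_sum2) (simp_all add: hs S)
  also have "\<dots> = (\<Sum>p<n. \<Sum>j<n. ip (\<lambda>x. a j * h j x) (\<lambda>x. a p * h p x))"
    by (intro sum.cong refl ip_sum) (simp_all add: hs)
  also have "\<dots> = (\<Sum>p<n. \<Sum>j<n. cnj (a p) * a j * ip (h j) (h p))"
    using h by (intro sum.cong refl) (simp add: ip_scale ip_scale2 scale_mem)
  finally show ?thesis
    by (simp only: nrm_sq[OF S])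
qed

lemma psd_gram:
  assumes "\<And>z. z \<in> X \<Longrightarrow> Y z \<in> H"
  shows "psd X (\<lambda>z w. ip (Y w) (Y z))"
  unfolding psd_def
proof (intro allI impI)
  fix n :: nat and a v assume v: "\<forall>i<n. v i \<in> X"
  have "(nrm (\<lambda>x. \<Sum>j<n. a j * Y (v j) x))\<^sup>2 = Re (\<Sum>p<n. \<Sum>j<n. cnj (a p) * a j * ip (Y (v j)) (Y (v p)))"
    by (rule nrm_lin_sq) (use v assms in auto)
  then show "0 \<le> Re (\<Sum>p<n. \<Sum>j<n. cnj (a p) * a j * ip (Y (v j)) (Y (v p)))"
    by (metis zero_le_power2)
qed

lemma psd_imp_bmult:
  assumes c: "c \<in> funs_on X" and M: "0 \<le> M"
    and p: "psd X (\<lambda>z w. (of_real (M\<^sup>2) - c z * cnj (c w)) * k z w)"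
  shows "bmult c M"
proof -
  have bd: "cmod (\<Sum>i<n. cnj (a i) * (c (v i) * f (v i))) \<le> (M * nrm f) * nrm (kernel_comb n a v)"
    if f: "f \<in> H" and v: "\<forall>i<n. v i \<in> X" for f n a v
  proof -
    define g where "g = kernel_comb n (\<lambda>i. a i * cnj (c (v i))) v"
    have g: "g \<in> H" unfolding g_def by (rule kernel_comb_mem[OF v])
    have "(\<Sum>i<n. cnj (a i) * (c (v i) * f (v i))) = ip f g"
      unfolding g_def ip_kernel_comb[OF v f] by (intro sum.cong refl) simp
    moreover have "cmod (ip f g) \<le> nrm f * nrm g" by (rule cauchy_schwarz[OF f g])
    moreover have "nrm g \<le> M * nrm (kernel_comb n a v)"
    proof (rule power2_le_imp_le)
      have "0 \<le> Re (\<Sum>i<n. \<Sum>j<n. cnj (a i) * a j * ((of_real (M\<^sup>2) - c (v i) * cnj (c (v j))) * k (v i) (v j)))"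
        by (rule psdD[OF p v])
      also have "(\<Sum>i<n. \<Sum>j<n. cnj (a i) * a j * ((of_real (M\<^sup>2) - c (v i) * cnj (c (v j))) * k (v i) (v j))) =
        of_real (M\<^sup>2) * (\<Sum>i<n. \<Sum>j<n. cnj (a i) * a j * k (v i) (v j)) -
        (\<Sum>i<n. \<Sum>j<n. cnj (a i * cnj (c (v i))) * (a j * cnj (c (v j))) * k (v i) (v j))"
        unfolding sum_distrib_left sum_subtractf[symmetric]
        by (intro sum.cong refl) (simp add: algebra_simps)
      also have "Re \<dots> = M\<^sup>2 * (nrm (kernel_comb n a v))\<^sup>2 - (nrm g)\<^sup>2"
        unfolding g_def nrm_kernel_comb_sq[OF v] minus_complex.sel Re_complex_of_real
        by (simp only: times_complex.sel Re_complex_of_real Im_complex_of_real mult_zero_left diff_zero)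
      finally show "(nrm g)\<^sup>2 \<le> (M * nrm (kernel_comb n a v))\<^sup>2" by (simp add: power_mult_distrib)
      show "0 \<le> M * nrm (kernel_comb n a v)" using M nrm_ge0[OF kernel_comb_mem[OF v]] by simp
    qed
    then have "nrm f * nrm g \<le> nrm f * (M * nrm (kernel_comb n a v))"
      by (rule mult_left_mono) (rule nrm_ge0[OF f])
    ultimately show ?thesis by (simp add: mult_ac)
  qed
  show ?thesis unfolding bmult_def
  proof (intro conjI ballI c)
    fix f assume f: "f \<in> H"
    have q: "(\<lambda>x. c x * f x) \<in> funs_on X" "0 \<le> M * nrm f"
      using c M nrm_ge0[OF f] by (auto simp: funs_on_def)
    show "(\<lambda>x. c x * f x) \<in> H" by (rule mem_of_kernel_bound(1)[OF q bd[OF f]])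
    show "nrm (\<lambda>x. c x * f x) \<le> M * nrm f" by (rule mem_of_kernel_bound(2)[OF q bd[OF f]])
  qed
qed

end

context ball_rkhs
begin

lemma psd_mult_kernel:
  assumes "psd X P"
  shows "psd X (\<lambda>z w. P z w * k z w)"
proof (rule psd_cong[OF psd_rank_one[OF psd_divide_one_minus_cinner[where b = b, OF assms b_lt], of e]])
  fix z w assume zw: "z \<in> X" "w \<in> X"
  show "e z * cnj (e w) * (P z w / (1 - cinner_vec (b z) (b w))) = P z w * k z w"
    unfolding ker[OF zw, symmetric] using cinner_b_ne[OF zw] by simp
qed

lemma szego_eq:
  assumes "f \<in> H" "z \<in> X"
  shows "szego (b z) f x = f x + cinner_vec (b x) (b z) * szego (b z) f x"
proof (cases "x \<in> X")
  case True
  then show ?thesis using cinner_b_ne[OF True assms(2)] by (simp add: szego_def field_simps)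
qed (use zero_outside[OF assms(1)] in \<open>simp add: szego_def\<close>)

lemma szego_b_mem: "f \<in> H \<Longrightarrow> z \<in> X \<Longrightarrow> szego (b z) f \<in> H"
  using szego_mem b_lt by blast

text \<open>
  In the notation \<open>k\<^sub>z\<close> for multiplication by \<open>1 / (1 - \<langle>b x, b z\<rangle>)\<close> this is \<open>\<langle>f, k\<^sub>z f\<rangle>\<close>.
\<close>

definition pairing_den :: "('a \<Rightarrow> complex) \<Rightarrow> 'a \<Rightarrow> complex" where
  "pairing_den f z = ip f (szego (b z) f)"

definition pairing_num :: "('a \<Rightarrow> complex) \<Rightarrow> ('a \<Rightarrow> complex) \<Rightarrow> 'd \<Rightarrow> 'a \<Rightarrow> complex" where
  "pairing_num f g i z = ip f (\<lambda>x. b x $ i * szego (b z) g x)"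

text \<open>
  Put \<open>a = k\<^sub>z f\<close>. Then \<open>a - f\<close> is \<open>a\<close> multiplied by \<open>\<langle>b x, b z\<rangle>\<close>, hence not longer than \<open>a\<close>.
\<close>

lemma pairing_den_Re:
  assumes f: "f \<in> H" and z: "z \<in> X"
  shows "(nrm f)\<^sup>2 / 2 \<le> Re (pairing_den f z)"
proof -
  define a where "a = szego (b z) f"
  have a: "a \<in> H" unfolding a_def by (rule szego_b_mem[OF f z])
  have eq: "(\<lambda>x. cinner_vec (b x) (b z) * a x) = (\<lambda>x. a x - f x)"
    using szego_eq[OF f z] unfolding a_def[symmetric] by (simp add: fun_eq_iff algebra_simps)
  have "nrm (\<lambda>x. a x - f x) \<le> norm (b z) * nrm a"
    using cinner_bmult(2)[OF a, of "b z"] unfolding eq .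
  also have "\<dots> \<le> nrm a" using b_lt[OF z] nrm_ge0[OF a] by (intro mult_left_le_one_le) auto
  finally have "(nrm (\<lambda>x. a x - f x))\<^sup>2 \<le> (nrm a)\<^sup>2"
    by (rule power_mono) (rule nrm_ge0[OF diff_mem[OF a f]])
  then show ?thesis
    unfolding nrm_diff_sq[OF a f] pairing_den_def a_def[symmetric] Re_ip_comm[OF f a] by simp
qed

lemma pairing_den_ne:
  assumes "f \<in> H" "f \<noteq> (\<lambda>x. 0)" "z \<in> X"
  shows "pairing_den f z \<noteq> 0"
proof
  assume "pairing_den f z = 0"
  with pairing_den_Re[OF assms(1,3)] have "(nrm f)\<^sup>2 \<le> 0" by simp
  then show False using nrm_pos[OF assms(1,2)] by simp
qed

text \<open>
  The numerators combine with the coordinate functions to the pairing of \<open>f\<close> with \<open>k\<^sub>z g - g\<close>.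
\<close>

lemma sum_pairing_num:
  assumes f: "f \<in> H" and g: "g \<in> H" and z: "z \<in> X"
  shows "(\<Sum>i\<in>UNIV. b z $ i * pairing_num f g i z) = ip f (szego (b z) g) - ip f g"
proof -
  define S where "S = szego (b z) g"
  have S: "S \<in> H" unfolding S_def by (rule szego_b_mem[OF g z])
  have "ip f S - ip f g = ip f (\<lambda>x. S x - g x)" by (simp add: ip_diff2 f S g)
  also have "(\<lambda>x. S x - g x) = (\<lambda>x. \<Sum>i\<in>UNIV. cnj (b z $ i) * (b x $ i * S x))"
  proof
    fix x
    have "S x - g x = cinner_vec (b x) (b z) * S x"
      using szego_eq[OF g z, of x] unfolding S_def[symmetric] by (simp add: algebra_simps)
    also have "\<dots> = (\<Sum>i\<in>UNIV. cnj (b z $ i) * (b x $ i * S x))"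
      unfolding cinner_vec_def sum_distrib_right by (intro sum.cong refl) (simp add: mult_ac)
    finally show "S x - g x = (\<Sum>i\<in>UNIV. cnj (b z $ i) * (b x $ i * S x))" .
  qed
  also have "ip f \<dots> = (\<Sum>i\<in>UNIV. ip f (\<lambda>x. cnj (b z $ i) * (b x $ i * S x)))"
    by (rule ip_sum2) (auto intro!: scale_mem coord_mult_mem S f)
  also have "\<dots> = (\<Sum>i\<in>UNIV. b z $ i * pairing_num f g i z)"
    unfolding pairing_num_def S_def[symmetric]
    by (intro sum.cong refl) (simp add: ip_scale2[OF f coord_mult_mem[OF S]])
  finally show ?thesis by (simp add: S_def)
qed

text \<open>
  Let \<open>c\<close> be the quotient and \<open>Y\<^sub>z = b\<^sub>i k\<^sub>z g - cnj (c z) k\<^sub>z f\<close>, which is orthogonal to \<open>f\<close> by the choice of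
  \<open>c\<close>. The resolvent equation says that the row maps the tuple with \<open>g\<close> in place \<open>i\<close> plus the tuple
  \<open>cnj (b z) Y\<^sub>z\<close> to \<open>Y\<^sub>z + cnj (c z) f\<close>. As \<open>Y\<^sub>z\<close> is orthogonal to \<open>f\<close> and to \<open>g\<close>, contractivity of the row
  becomes the positivity of
  \<open>\<parallel>g\<parallel>\<^sup>2 - \<parallel>f\<parallel>\<^sup>2 c z cnj (c w) - (1 - \<langle>b z, b w\<rangle>) \<langle>Y\<^sub>w, Y\<^sub>z\<rangle>\<close>. Multiplication by the kernel turns the last term
  into a positive kernel, and what remains says that \<open>c\<close> is a multiplier of norm at most \<open>\<parallel>g\<parallel> / \<parallel>f\<parallel>\<close>.
\<close>

lemma pairing_quotient_bmult:
  assumes f: "f \<in> H" and f0: "f \<noteq> (\<lambda>x. 0)" and g: "g \<in> H"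
    and orth: "\<And>z. z \<in> X \<Longrightarrow>
      ip (\<lambda>x. b x $ i * szego (b z) g x - cnj (pairing_num f g i z / pairing_den f z) * szego (b z) f x) g = 0"
  shows "bmult (\<lambda>z. if z \<in> X then pairing_num f g i z / pairing_den f z else 0) (nrm g / nrm f)"
proof -
  define c where "c z = (if z \<in> X then pairing_num f g i z / pairing_den f z else 0)" for z
  define Y where "Y z = (\<lambda>x. b x $ i * szego (b z) g x - cnj (c z) * szego (b z) f x)" for z
  have Y: "Y z \<in> H" if "z \<in> X" for z
    unfolding Y_def by (intro diff_mem coord_mult_mem scale_mem szego_b_mem f g that)
  have Yg: "ip (Y z) g = 0" if "z \<in> X" for z
    using orth[OF that] that by (simp add: Y_def c_def)
  have Yf: "ip (Y z) f = 0" if z: "z \<in> X" for z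
  proof -
    have "ip f (Y z) = pairing_num f g i z - c z * pairing_den f z"
      unfolding Y_def pairing_num_def pairing_den_def
      by (subst ip_diff2) (auto intro!: coord_mult_mem scale_mem szego_b_mem f g z simp: ip_scale2 szego_b_mem f g z)
    then have "ip f (Y z) = 0" using z pairing_den_ne[OF f f0 z] by (simp add: c_def)
    then show ?thesis using ip_cnj[OF f Y[OF z]] by simp
  qed
  have Yeq: "Y z x + cnj (c z) * f x = b x $ i * g x + cinner_vec (b x) (b z) * Y z x" if z: "z \<in> X" for z x
  proof -
    have "Y z x - cinner_vec (b x) (b z) * Y z x =
      b x $ i * (szego (b z) g x - cinner_vec (b x) (b z) * szego (b z) g x) -
      cnj (c z) * (szego (b z) f x - cinner_vec (b x) (b z) * szego (b z) f x)"
      unfolding Y_def by (simp add: algebra_simps)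
    also have "szego (b z) g x - cinner_vec (b x) (b z) * szego (b z) g x = g x"
      using szego_eq[OF g z, of x] by (simp add: algebra_simps)
    also have "szego (b z) f x - cinner_vec (b x) (b z) * szego (b z) f x = f x"
      using szego_eq[OF f z, of x] by (simp add: algebra_simps)
    finally show ?thesis by (simp add: algebra_simps)
  qed
  define D where "D z w = of_real ((nrm g)\<^sup>2) - of_real ((nrm f)\<^sup>2) * (c z * cnj (c w)) -
    (1 - cinner_vec (b z) (b w)) * ip (Y w) (Y z)" for z w
  have "psd X D" unfolding psd_def
  proof (intro allI impI)
    fix n :: nat and a v assume v: "\<forall>i<n. v i \<in> X"
    define \<eta> where "\<eta> = (\<lambda>x. \<Sum>j<n. a j * Y (v j) x)"
    define A where "A = (\<Sum>j<n. a j)"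
    define \<Gamma> where "\<Gamma> = (\<Sum>j<n. a j * cnj (c (v j)))"
    define \<zeta> where "\<zeta> l = (\<lambda>x. \<Sum>j<n. (a j * cnj (b (v j) $ l)) * Y (v j) x)" for l
    \<comment> \<open>Contractivity of the row will be applied to this tuple.\<close>
    define \<xi> where "\<xi> l = (\<lambda>x. (if l = i then A else 0) * g x + \<zeta> l x)" for l
    have Yv: "Y (v j) \<in> H" if "j < n" for j using v Y that by blast
    have \<eta>: "\<eta> \<in> H" unfolding \<eta>_def by (intro sum_mem scale_mem Yv) auto
    have \<zeta>: "\<zeta> l \<in> H" for l unfolding \<zeta>_def by (intro sum_mem scale_mem Yv) auto
    have \<xi>: "\<xi> l \<in> H" for l unfolding \<xi>_def by (intro add_mem scale_mem g \<zeta>)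
    have \<eta>f: "ip \<eta> f = 0"
    proof -
      have "ip \<eta> f = (\<Sum>j<n. ip (\<lambda>x. a j * Y (v j) x) f)"
        unfolding \<eta>_def by (rule ip_sum) (auto intro!: scale_mem Yv f)
      also have "\<dots> = 0"
        by (rule sum.neutral) (use v in \<open>auto simp: ip_scale Yv f Yf\<close>)
      finally show ?thesis .
    qed
    have \<zeta>g: "ip g (\<zeta> l) = 0" for l
    proof -
      have "ip (\<zeta> l) g = (\<Sum>j<n. ip (\<lambda>x. (a j * cnj (b (v j) $ l)) * Y (v j) x) g)"
        unfolding \<zeta>_def by (rule ip_sum) (auto intro!: scale_mem Yv g)
      also have "\<dots> = 0"
        by (rule sum.neutral) (use v in \<open>auto simp: ip_scale Yv g Yg\<close>)
      finally show ?thesis using ip_cnj[OF \<zeta>[of l] g] by simp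
    qed
    have row\<xi>: "row \<xi> = (\<lambda>x. \<eta> x + \<Gamma> * f x)"
    proof
      fix x
      have "row \<xi> x = (\<Sum>l\<in>UNIV. b x $ l * ((if l = i then A else 0) * g x)) + (\<Sum>l\<in>UNIV. b x $ l * \<zeta> l x)"
        unfolding row_def \<xi>_def by (simp add: distrib_left sum.distrib)
      also have "(\<Sum>l\<in>UNIV. b x $ l * ((if l = i then A else 0) * g x)) = (\<Sum>l\<in>UNIV. if l = i then b x $ i * (A * g x) else 0)"
        by (rule sum.cong) auto
      also have "\<dots> = b x $ i * (A * g x)" by simp
      also have "\<dots> = (\<Sum>j<n. a j * (b x $ i * g x))"
        unfolding A_def sum_distrib_right[symmetric] by (simp add: mult_ac)
      also have "(\<Sum>l\<in>UNIV. b x $ l * \<zeta> l x) = (\<Sum>l\<in>UNIV. \<Sum>j<n. b x $ l * ((a j * cnj (b (v j) $ l)) * Y (v j) x))"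
        unfolding \<zeta>_def sum_distrib_left ..
      also have "\<dots> = (\<Sum>j<n. \<Sum>l\<in>UNIV. b x $ l * ((a j * cnj (b (v j) $ l)) * Y (v j) x))"
        by (rule sum.swap)
      also have "\<dots> = (\<Sum>j<n. a j * (cinner_vec (b x) (b (v j)) * Y (v j) x))"
        unfolding cinner_vec_def sum_distrib_right sum_distrib_left
        by (intro sum.cong refl) (simp add: mult_ac)
      also have "(\<Sum>j<n. a j * (b x $ i * g x)) + \<dots> = (\<Sum>j<n. a j * (Y (v j) x + cnj (c (v j)) * f x))"
        unfolding sum.distrib[symmetric] distrib_left[symmetric]
        using v by (intro sum.cong refl) (simp add: Yeq)
      also have "\<dots> = \<eta> x + \<Gamma> * f x"
        unfolding \<eta>_def \<Gamma>_def sum_distrib_right sum.distrib[symmetric]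
        by (intro sum.cong refl) (simp add: algebra_simps)
      finally show "row \<xi> x = \<eta> x + \<Gamma> * f x" .
    qed
    have "(nrm (row \<xi>))\<^sup>2 = (nrm \<eta>)\<^sup>2 + (cmod \<Gamma>)\<^sup>2 * (nrm f)\<^sup>2"
      unfolding row\<xi> nrm_add_sq[OF \<eta> scale_mem[OF f]] ip_scale2[OF \<eta> f] \<eta>f nrm_scale[OF f]
      by (simp add: power_mult_distrib)
    moreover have "(nrm (\<xi> l))\<^sup>2 = (if l = i then (cmod A)\<^sup>2 * (nrm g)\<^sup>2 else 0) + (nrm (\<zeta> l))\<^sup>2" for l
      unfolding \<xi>_def nrm_add_sq[OF scale_mem[OF g] \<zeta>] ip_scale[OF g \<zeta>] \<zeta>g nrm_scale[OF g]
      by (simp add: power_mult_distrib)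
    then have "(\<Sum>l\<in>UNIV. (nrm (\<xi> l))\<^sup>2) = (cmod A)\<^sup>2 * (nrm g)\<^sup>2 + (\<Sum>l\<in>UNIV. (nrm (\<zeta> l))\<^sup>2)"
      by (simp add: sum.distrib)
    ultimately have main: "(nrm \<eta>)\<^sup>2 + (cmod \<Gamma>)\<^sup>2 * (nrm f)\<^sup>2 \<le>
        (cmod A)\<^sup>2 * (nrm g)\<^sup>2 + (\<Sum>l\<in>UNIV. (nrm (\<zeta> l))\<^sup>2)"
      using row_nrm[of \<xi>, OF \<xi>] by simp
    have 1: "(nrm \<eta>)\<^sup>2 = Re (\<Sum>p<n. \<Sum>j<n. cnj (a p) * a j * ip (Y (v j)) (Y (v p)))"
      unfolding \<eta>_def by (rule nrm_lin_sq) (use Yv in auto)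
    have 2: "(\<Sum>l\<in>UNIV. (nrm (\<zeta> l))\<^sup>2) =
      Re (\<Sum>p<n. \<Sum>j<n. cnj (a p) * a j * (cinner_vec (b (v p)) (b (v j)) * ip (Y (v j)) (Y (v p))))"
    proof -
      have "(nrm (\<zeta> l))\<^sup>2 = Re (\<Sum>p<n. \<Sum>j<n. cnj (a p * cnj (b (v p) $ l)) * (a j * cnj (b (v j) $ l)) * ip (Y (v j)) (Y (v p)))" for l
        unfolding \<zeta>_def by (rule nrm_lin_sq) (use Yv in auto)
      then have "(\<Sum>l\<in>UNIV. (nrm (\<zeta> l))\<^sup>2) = Re (\<Sum>l\<in>UNIV. \<Sum>p<n. \<Sum>j<n. cnj (a p * cnj (b (v p) $ l)) * (a j * cnj (b (v j) $ l)) * ip (Y (v j)) (Y (v p)))"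
        unfolding Re_sum[of _ UNIV] by (simp only:)
      also have "(\<Sum>l\<in>UNIV. \<Sum>p<n. \<Sum>j<n. cnj (a p * cnj (b (v p) $ l)) * (a j * cnj (b (v j) $ l)) * ip (Y (v j)) (Y (v p)))
        = (\<Sum>p<n. \<Sum>j<n. \<Sum>l\<in>UNIV. cnj (a p * cnj (b (v p) $ l)) * (a j * cnj (b (v j) $ l)) * ip (Y (v j)) (Y (v p)))"
        by (rule trans[OF sum.swap sum.cong[OF refl sum.swap]])
      also have "\<dots> = (\<Sum>p<n. \<Sum>j<n. cnj (a p) * a j * (cinner_vec (b (v p)) (b (v j)) * ip (Y (v j)) (Y (v p))))"
        unfolding cinner_vec_def sum_distrib_left sum_distrib_right
        by (intro sum.cong refl) (simp add: mult_ac)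
      finally show ?thesis .
    qed
    have 3: "of_real ((cmod \<Gamma>)\<^sup>2) = (\<Sum>p<n. \<Sum>j<n. cnj (a p) * a j * (c (v p) * cnj (c (v j))))"
    proof -
      have "cmod \<Gamma> = cmod (cnj \<Gamma>)" by simp
      also have "cnj \<Gamma> = (\<Sum>j<n. cnj (a j) * c (v j))" unfolding \<Gamma>_def cnj_sum by simp
      finally show ?thesis using cmod_sum_sq[where a = a and n = n and f = c and v = v] by simp
    qed
    have 4: "of_real ((cmod A)\<^sup>2) = (\<Sum>p<n. \<Sum>j<n. cnj (a p) * a j * 1)"
    proof -
      have "cmod A = cmod (cnj A)" by simp
      also have "cnj A = (\<Sum>j<n. cnj (a j) * 1)" unfolding A_def cnj_sum by simp
      finally show ?thesis using cmod_sum_sq[where a = a and n = n and f = "\<lambda>_. 1" and v = v] by simp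
    qed
    have "(\<Sum>p<n. \<Sum>j<n. cnj (a p) * a j * D (v p) (v j)) =
      of_real ((nrm g)\<^sup>2) * (\<Sum>p<n. \<Sum>j<n. cnj (a p) * a j * 1) -
      of_real ((nrm f)\<^sup>2) * (\<Sum>p<n. \<Sum>j<n. cnj (a p) * a j * (c (v p) * cnj (c (v j)))) -
      (\<Sum>p<n. \<Sum>j<n. cnj (a p) * a j * ip (Y (v j)) (Y (v p))) +
      (\<Sum>p<n. \<Sum>j<n. cnj (a p) * a j * (cinner_vec (b (v p)) (b (v j)) * ip (Y (v j)) (Y (v p))))"
      unfolding sum_distrib_left sum_subtractf[symmetric] sum.distrib[symmetric] D_def
      by (intro sum.cong refl) (simp add: algebra_simps)
    then have "Re (\<Sum>p<n. \<Sum>j<n. cnj (a p) * a j * D (v p) (v j)) =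
      (nrm g)\<^sup>2 * (cmod A)\<^sup>2 - (nrm f)\<^sup>2 * (cmod \<Gamma>)\<^sup>2 - (nrm \<eta>)\<^sup>2 + (\<Sum>l\<in>UNIV. (nrm (\<zeta> l))\<^sup>2)"
      unfolding 1 2 3[symmetric] 4[symmetric] of_real_mult[symmetric] plus_complex.sel minus_complex.sel Re_complex_of_real
      by (simp only: plus_complex.sel minus_complex.sel Re_complex_of_real)
    then show "0 \<le> Re (\<Sum>p<n. \<Sum>j<n. cnj (a p) * a j * D (v p) (v j))"
      using main by (simp add: mult.commute)
  qed
  then have "psd X (\<lambda>z w. D z w * k z w)" by (rule psd_mult_kernel)
  moreover have "psd X (\<lambda>z w. e z * cnj (e w) * ip (Y w) (Y z))"
    by (rule psd_rank_one[OF psd_gram[OF Y]])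
  ultimately have "psd X (\<lambda>z w. D z w * k z w + e z * cnj (e w) * ip (Y w) (Y z))"
    by (rule psd_add)
  then have "psd X (\<lambda>z w. of_real (1 / nrm f) * cnj (of_real (1 / nrm f)) * (D z w * k z w + e z * cnj (e w) * ip (Y w) (Y z)))"
    by (rule psd_rank_one)
  then have "psd X (\<lambda>z w. (of_real ((nrm g / nrm f)\<^sup>2) - c z * cnj (c w)) * k z w)"
  proof (rule psd_cong)
    fix z w assume zw: "z \<in> X" "w \<in> X"
    have "D z w * k z w + e z * cnj (e w) * ip (Y w) (Y z) =
      (of_real ((nrm g)\<^sup>2) - of_real ((nrm f)\<^sup>2) * (c z * cnj (c w))) * k z w"
      unfolding D_def ker[OF zw, symmetric] by (simp add: algebra_simps)
    then show "of_real (1 / nrm f) * cnj (of_real (1 / nrm f)) * (D z w * k z w + e z * cnj (e w) * ip (Y w) (Y z)) =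
      (of_real ((nrm g / nrm f)\<^sup>2) - c z * cnj (c w)) * k z w"
      using nrm_pos[OF f f0] by (simp add: field_simps power2_eq_square)
  qed
  then have "bmult c (nrm g / nrm f)"
    by (rule psd_imp_bmult[rotated 2]) (use nrm_ge0[OF f] nrm_ge0[OF g] in \<open>auto simp: funs_on_def c_def\<close>)
  then show ?thesis unfolding c_def .
qed

end

section \<open>Characters that vanish on the coordinate functions\<close>

definition one_on :: "'a set \<Rightarrow> 'a \<Rightarrow> complex" where
  "one_on X = (\<lambda>x. if x \<in> X then 1 else 0)"

text \<open>
  Being unital excludes the zero functional. Boundedness is a consequence, see \<open>character_bmult_le\<close>.
\<close>

definition character_on :: "'a set \<Rightarrow> ('a \<Rightarrow> complex) set \<Rightarrow> (('a \<Rightarrow> complex) \<Rightarrow> complex) \<Rightarrow> bool" where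
  "character_on X A \<omega> \<longleftrightarrow>
     (\<forall>f\<in>A. \<forall>g\<in>A. \<omega> (\<lambda>x. f x + g x) = \<omega> f + \<omega> g) \<and>
     (\<forall>c. \<forall>f\<in>A. \<omega> (\<lambda>x. c * f x) = c * \<omega> f) \<and>
     (\<forall>f\<in>A. \<forall>g\<in>A. \<omega> (\<lambda>x. f x * g x) = \<omega> f * \<omega> g) \<and>
     \<omega> (one_on X) = 1"

lemma character_add: "character_on X A \<omega> \<Longrightarrow> f \<in> A \<Longrightarrow> g \<in> A \<Longrightarrow> \<omega> (\<lambda>x. f x + g x) = \<omega> f + \<omega> g"
  and character_scale: "character_on X A \<omega> \<Longrightarrow> f \<in> A \<Longrightarrow> \<omega> (\<lambda>x. c * f x) = c * \<omega> f"
  and character_mult: "character_on X A \<omega> \<Longrightarrow> f \<in> A \<Longrightarrow> g \<in> A \<Longrightarrow> \<omega> (\<lambda>x. f x * g x) = \<omega> f * \<omega> g"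
  and character_one: "character_on X A \<omega> \<Longrightarrow> \<omega> (one_on X) = 1"
  unfolding character_on_def by blast+

context rkhs
begin

lemma MultD: "\<phi> \<in> Mult X H \<Longrightarrow> f \<in> H \<Longrightarrow> (\<lambda>x. \<phi> x * f x) \<in> H"
  by (simp add: Mult_def)

lemma Mult_outside: "\<phi> \<in> Mult X H \<Longrightarrow> x \<notin> X \<Longrightarrow> \<phi> x = 0"
  by (simp add: Mult_def funs_on_def)

lemma MultI: "(\<And>x. x \<notin> X \<Longrightarrow> \<phi> x = 0) \<Longrightarrow> (\<And>f. f \<in> H \<Longrightarrow> (\<lambda>x. \<phi> x * f x) \<in> H) \<Longrightarrow> \<phi> \<in> Mult X H"
  by (simp add: Mult_def funs_on_def)

lemma one_on_mult: "f \<in> H \<Longrightarrow> (\<lambda>x. one_on X x * f x) = f"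
  using zero_outside[of f] by (auto simp: one_on_def)

lemma Mult_one: "one_on X \<in> Mult X H"
  by (rule MultI) (simp_all add: one_on_mult, simp add: one_on_def)

lemma Mult_add: "\<phi> \<in> Mult X H \<Longrightarrow> \<psi> \<in> Mult X H \<Longrightarrow> (\<lambda>x. \<phi> x + \<psi> x) \<in> Mult X H"
  by (rule MultI) (simp_all add: Mult_outside distrib_right add_mem MultD)

lemma Mult_diff: "\<phi> \<in> Mult X H \<Longrightarrow> \<psi> \<in> Mult X H \<Longrightarrow> (\<lambda>x. \<phi> x - \<psi> x) \<in> Mult X H"
  by (rule MultI) (simp_all add: Mult_outside left_diff_distrib diff_mem MultD)

lemma Mult_scale: "\<phi> \<in> Mult X H \<Longrightarrow> (\<lambda>x. c * \<phi> x) \<in> Mult X H"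
  by (rule MultI) (simp_all add: Mult_outside mult.assoc scale_mem MultD)

lemma Mult_mult: "\<phi> \<in> Mult X H \<Longrightarrow> \<psi> \<in> Mult X H \<Longrightarrow> (\<lambda>x. \<phi> x * \<psi> x) \<in> Mult X H"
  by (rule MultI) (simp_all add: Mult_outside mult.assoc MultD)

lemma Mult_zero: "(\<lambda>x. 0) \<in> Mult X H"
  by (rule MultI) (simp_all add: zero_mem)

lemma Mult_sum: "finite S \<Longrightarrow> (\<And>i. i \<in> S \<Longrightarrow> \<phi> i \<in> Mult X H) \<Longrightarrow> (\<lambda>x. \<Sum>i\<in>S. \<phi> i x) \<in> Mult X H"
  by (induction rule: finite_induct) (auto simp: Mult_zero intro: Mult_add)

lemma character_diff:
  assumes "character_on X (Mult X H) \<omega>" "\<phi> \<in> Mult X H" "\<psi> \<in> Mult X H"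
  shows "\<omega> (\<lambda>x. \<phi> x - \<psi> x) = \<omega> \<phi> - \<omega> \<psi>"
  using character_add[OF assms(1,2) Mult_scale[OF assms(3)], of "-1"]
    character_scale[OF assms(1,3), of "-1"] by simp

lemma character_zero: "character_on X (Mult X H) \<omega> \<Longrightarrow> \<omega> (\<lambda>x. 0) = 0"
  using character_scale[OF _ Mult_zero, of X \<omega> 0] by simp

lemma character_sum:
  assumes "character_on X (Mult X H) \<omega>"
  shows "finite S \<Longrightarrow> (\<And>i. i \<in> S \<Longrightarrow> \<phi> i \<in> Mult X H) \<Longrightarrow> \<omega> (\<lambda>x. \<Sum>i\<in>S. \<phi> i x) = (\<Sum>i\<in>S. \<omega> (\<phi> i))"
proof (induction rule: finite_induct)
  case empty then show ?case using character_zero[OF assms] by simp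
next
  case (insert i S)
  then show ?case
    using character_add[OF assms, of "\<phi> i" "\<lambda>x. \<Sum>i\<in>S. \<phi> i x"] Mult_sum[of S \<phi>] by simp
qed

end

context ball_rkhs
begin

definition coord :: "'d \<Rightarrow> 'a \<Rightarrow> complex" where
  "coord i = (\<lambda>x. if x \<in> X then b x $ i else 0)"

lemma coord_Mult: "coord i \<in> Mult X H"
proof (rule MultI)
  fix f assume f: "f \<in> H"
  have "(\<lambda>x. coord i x * f x) = (\<lambda>x. b x $ i * f x)"
    using zero_outside[OF f] by (auto simp: coord_def)
  then show "(\<lambda>x. coord i x * f x) \<in> H" using coord_mult_mem[OF f] by simp
qed (simp add: coord_def)

text \<open>
  Multiplying \<open>e\<close> by \<open>k\<^sub>z\<close> gives the kernel function at \<open>z\<close> up to the factor \<open>cnj (e z)\<close>.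
\<close>

lemma ip_szego_e:
  assumes f: "f \<in> H" and z: "z \<in> X"
  shows "ip f (szego (b z) e) = f z / e z"
proof -
  have "kernel_at z = (\<lambda>x. cnj (e z) * szego (b z) e x)"
  proof
    fix x show "kernel_at z x = cnj (e z) * szego (b z) e x"
    proof (cases "x \<in> X")
      case True
      then have "k x z = e x * cnj (e z) / (1 - cinner_vec (b x) (b z))"
        using ker[OF True z] cinner_b_ne[OF True z] by (simp add: eq_divide_eq)
      then show ?thesis using True by (simp add: kernel_at_def kernel_fun_def szego_def)
    qed (use e_fun in \<open>simp add: kernel_at_def kernel_fun_def szego_def funs_on_def\<close>)
  qed
  then have "f z = e z * ip f (szego (b z) e)"
    using reproduce[OF z f] ip_scale2[OF f szego_b_mem[OF e_mem z], of "cnj (e z)"] by simp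
  then show ?thesis using e_nz[OF z] by simp
qed

text \<open>
  The function \<open>h\<close> is a combination of the coordinate functions whose coefficients are the multipliers
  of \<open>pairing_quotient_bmult\<close>.
\<close>

lemma character_quotient:
  assumes \<omega>: "character_on X (Mult X H) \<omega>" and \<omega>0: "\<And>i. \<omega> (coord i) = 0"
    and f: "f \<in> H" and f0: "f \<noteq> (\<lambda>x. 0)" and g: "g \<in> H"
    and orth: "\<And>i z. z \<in> X \<Longrightarrow>
      ip (\<lambda>x. b x $ i * szego (b z) g x - cnj (pairing_num f g i z / pairing_den f z) * szego (b z) f x) g = 0"
  defines "h \<equiv> (\<lambda>z. if z \<in> X then (ip f (szego (b z) g) - ip f g) / pairing_den f z else 0)"
  shows "h \<in> Mult X H" "\<omega> h = 0"
proof -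
  define c where "c i = (\<lambda>z. if z \<in> X then pairing_num f g i z / pairing_den f z else 0)" for i
  have c: "c i \<in> Mult X H" for i
    unfolding c_def by (rule bmult_Mult[OF pairing_quotient_bmult[OF f f0 g orth]])
  have h: "h = (\<lambda>z. \<Sum>i\<in>UNIV. coord i z * c i z)"
    unfolding h_def c_def coord_def
    by (auto simp: fun_eq_iff sum_pairing_num[OF f g, symmetric] sum_divide_distrib)
  show "h \<in> Mult X H" unfolding h by (rule Mult_sum) (simp_all add: Mult_mult coord_Mult c)
  have "\<omega> h = (\<Sum>i\<in>UNIV. \<omega> (\<lambda>z. coord i z * c i z))"
    unfolding h by (rule character_sum[OF \<omega>]) (simp_all add: Mult_mult coord_Mult c)
  also have "\<dots> = 0"
    by (simp add: character_mult[OF \<omega> coord_Mult c] \<omega>0)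
  finally show "\<omega> h = 0" .
qed

lemma orth_self:
  assumes f: "f \<in> H" and f0: "f \<noteq> (\<lambda>x. 0)" and z: "z \<in> X"
  shows "ip (\<lambda>x. b x $ i * szego (b z) f x - cnj (pairing_num f f i z / pairing_den f z) * szego (b z) f x) f = 0"
proof -
  note S = szego_b_mem[OF f z]
  have "ip (\<lambda>x. b x $ i * szego (b z) f x - cnj (pairing_num f f i z / pairing_den f z) * szego (b z) f x) f =
    cnj (pairing_num f f i z) - cnj (pairing_num f f i z / pairing_den f z) * cnj (pairing_den f z)"
    unfolding ip_diff[OF coord_mult_mem[OF S] scale_mem[OF S] f] ip_scale[OF S f] pairing_num_def pairing_den_def
      ip_cnj[OF f coord_mult_mem[OF S]] ip_cnj[OF f S] ..
  also have "\<dots> = 0" using pairing_den_ne[OF f f0 z] by simp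
  finally show ?thesis .
qed

text \<open>
  With \<open>f = g = e\<close> the denominator is \<open>1\<close> and \<open>character_quotient\<close> gives \<open>\<parallel>e\<parallel> = 1\<close>; hence \<open>e\<close> is orthogonal to
  the range of the row. Now let \<open>\<psi>\<close> satisfy \<open>\<langle>\<psi> e, e\<rangle> = 0\<close> and put \<open>f = \<psi> e\<close>. The choice \<open>g = f\<close> shows that
  \<open>1 - \<parallel>f\<parallel>\<^sup>2 / \<langle>f, k\<^sub>z f\<rangle>\<close> is a multiplier in the kernel of the character. The choice \<open>g = e\<close>, admissible because
  \<open>e\<close> is orthogonal to the range of the row and to \<open>f\<close>, shows the same for \<open>\<psi> / \<langle>f, k\<^sub>z f\<rangle>\<close>. Together they give
  \<open>\<omega> \<psi> = 0\<close>.
\<close>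

theorem character_eq_state:
  assumes \<omega>: "character_on X (Mult X H) \<omega>" and \<omega>0: "\<And>i. \<omega> (coord i) = 0"
  shows "nrm e = 1" and "\<And>\<psi>. \<psi> \<in> Mult X H \<Longrightarrow> \<omega> \<psi> = ip (\<lambda>x. \<psi> x * e x) e"
proof -
  have "X \<noteq> {}"
  proof
    assume "X = {}"
    then have "one_on X = (\<lambda>x. 0)" by (simp add: one_on_def)
    then show False using character_one[OF \<omega>] character_zero[OF \<omega>] by simp
  qed
  then have e0: "e \<noteq> (\<lambda>x. 0)" using e_nz by (metis equals0I)
  note e = e_mem
  have den_e: "pairing_den e z = 1" if "z \<in> X" for z
    unfolding pairing_den_def ip_szego_e[OF e that] using e_nz[OF that] by simp
  have "(\<lambda>z. if z \<in> X then (ip e (szego (b z) e) - ip e e) / pairing_den e z else 0) =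
      (\<lambda>x. (1 - ip e e) * one_on X x)"
    by (auto simp: fun_eq_iff one_on_def den_e ip_szego_e[OF e] e_nz)
  then have "\<omega> (\<lambda>x. (1 - ip e e) * one_on X x) = 0"
    using character_quotient(2)[OF \<omega> \<omega>0 e e0 e orth_self[OF e e0]] by simp
  then have ee: "ip e e = 1"
    by (simp add: character_scale[OF \<omega> Mult_one] character_one[OF \<omega>])
  show ne: "nrm e = 1" using ee by (simp add: nrm_def)
  have coord_e: "ip e (\<lambda>x. b x $ i * h x) = 0" if h: "h \<in> H" for h i
  proof -
    define \<delta> where "\<delta> l = (if l = i then h else (\<lambda>x. 0))" for l
    have \<delta>: "\<delta> l \<in> H" for l by (simp add: \<delta>_def h zero_mem)
    have "row \<delta> = (\<lambda>x. b x $ i * h x)"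
      unfolding row_def \<delta>_def by (intro ext) (simp add: if_distrib[of "\<lambda>g. g _"] if_distrib[of "(*) _"] cong: if_cong)
    then have "(cmod (ip (\<lambda>x. b x $ i * h x) e))\<^sup>2 \<le> 0"
      using row_ip[of \<delta> e, OF \<delta> e] ee ne by simp
    then show ?thesis using ip_cnj[OF coord_mult_mem[OF h] e] by simp
  qed
  have szego_e: "ip e (szego (b z) h) = ip e h" if "h \<in> H" "z \<in> X" for h z
    using sum_pairing_num[OF e that] coord_e[OF szego_b_mem[OF that]] unfolding pairing_num_def by simp
  fix \<psi> assume \<psi>: "\<psi> \<in> Mult X H"
  define c where "c = ip (\<lambda>x. \<psi> x * e x) e"
  define \<psi>0 where "\<psi>0 = (\<lambda>x. \<psi> x - c * one_on X x)"
  have \<psi>0: "\<psi>0 \<in> Mult X H" unfolding \<psi>0_def by (intro Mult_diff Mult_scale Mult_one \<psi>)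
  have \<omega>\<psi>0: "\<omega> \<psi>0 = \<omega> \<psi> - c"
    unfolding \<psi>0_def character_diff[OF \<omega> \<psi> Mult_scale[OF Mult_one]] character_scale[OF \<omega> Mult_one]
      character_one[OF \<omega>] by simp
  define f where "f = (\<lambda>x. \<psi>0 x * e x)"
  have f: "f \<in> H" unfolding f_def by (rule MultD[OF \<psi>0 e])
  have fe: "ip f e = 0"
  proof -
    have "f = (\<lambda>x. \<psi> x * e x - c * e x)"
      using zero_outside[OF e] by (auto simp: f_def \<psi>0_def one_on_def fun_eq_iff algebra_simps)
    then show ?thesis
      using ip_diff[OF MultD[OF \<psi> e] scale_mem[OF e] e, of c] ip_scale[OF e e, of c] ee by (simp add: c_def)
  qed
  have ef: "ip e f = 0" using ip_cnj[OF f e] fe by simp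
  have "\<omega> \<psi>0 = 0"
  proof (cases "f = (\<lambda>x. 0)")
    case True
    then have "\<psi>0 x = 0" for x
      using e_nz[of x] Mult_outside[OF \<psi>0, of x] by (cases "x \<in> X") (auto simp: f_def fun_eq_iff)
    then have "\<psi>0 = (\<lambda>x. 0)" by auto
    then show ?thesis using character_zero[OF \<omega>] by simp
  next
    case f0: False
    define h1 where "h1 = (\<lambda>z. if z \<in> X then (ip f (szego (b z) f) - ip f f) / pairing_den f z else 0)"
    have h1: "h1 \<in> Mult X H" "\<omega> h1 = 0"
      unfolding h1_def using character_quotient[OF \<omega> \<omega>0 f f0 f orth_self[OF f f0]] by auto
    have orth: "ip (\<lambda>x. b x $ i * szego (b z) e x - cnj (pairing_num f e i z / pairing_den f z) * szego (b z) f x) e = 0"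
      if z: "z \<in> X" for i z
    proof -
      note S = szego_b_mem[OF e z] and T = szego_b_mem[OF f z]
      have "ip (\<lambda>x. b x $ i * szego (b z) e x) e = 0"
        using ip_cnj[OF e coord_mult_mem[OF S]] coord_e[OF S] by simp
      moreover have "ip (szego (b z) f) e = 0"
        using ip_cnj[OF e T] szego_e[OF f z] ef by simp
      ultimately show ?thesis
        unfolding ip_diff[OF coord_mult_mem[OF S] scale_mem[OF T] e] ip_scale[OF T e] by simp
    qed
    define h2 where "h2 = (\<lambda>z. if z \<in> X then (ip f (szego (b z) e) - ip f e) / pairing_den f z else 0)"
    have h2: "h2 \<in> Mult X H" "\<omega> h2 = 0"
      unfolding h2_def using character_quotient[OF \<omega> \<omega>0 f f0 e orth] by auto
    have eq: "(\<lambda>x. \<psi>0 x * (one_on X x - h1 x)) = (\<lambda>x. ip f f * h2 x)"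
    proof
      fix x show "\<psi>0 x * (one_on X x - h1 x) = ip f f * h2 x"
      proof (cases "x \<in> X")
        case x: True
        have "ip f (szego (b x) e) = \<psi>0 x"
          unfolding ip_szego_e[OF f x] using e_nz[OF x] by (simp add: f_def)
        then have "h2 x = \<psi>0 x / pairing_den f x" using x fe by (simp add: h2_def)
        moreover have "one_on X x - h1 x = ip f f / pairing_den f x"
          using x pairing_den_ne[OF f f0 x] by (simp add: one_on_def h1_def pairing_den_def[symmetric] diff_divide_distrib)
        ultimately show ?thesis by simp
      qed (simp add: Mult_outside[OF \<psi>0] h2_def)
    qed
    have "\<omega> \<psi>0 * (1 - 0) = ip f f * 0"
      using arg_cong[OF eq, of \<omega>]
      unfolding character_mult[OF \<omega> \<psi>0 Mult_diff[OF Mult_one h1(1)]] character_scale[OF \<omega> h2(1)]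
        character_diff[OF \<omega> Mult_one h1(1)] character_one[OF \<omega>] h1(2) h2(2) .
    then show ?thesis by simp
  qed
  then show "\<omega> \<psi> = ip (\<lambda>x. \<psi> x * e x) e" using \<omega>\<psi>0 by (simp add: c_def)
qed

end

section \<open>Characters of multiplier algebras on subsets of the ball\<close>

lemma cinner_diff_left: "cinner_vec (x - y) w = cinner_vec x w - cinner_vec y w"
  unfolding cinner_vec_def by (simp add: left_diff_distrib sum_subtractf)

text \<open>
  The involutive automorphism of the unit ball that exchanges \<open>p\<close> and \<open>0\<close>, in a form without division by
  the norm of \<open>p\<close>.
\<close>

definition ball_moebius :: "complex ^ 'd \<Rightarrow> complex ^ 'd \<Rightarrow> complex ^ 'd" where
  "ball_moebius p z = (let s = of_real (sqrt (1 - (norm p)\<^sup>2)) in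
     (\<chi> i. ((1 - cinner_vec z p / (1 + s)) * p $ i - s * z $ i) / (1 - cinner_vec z p)))"

lemma ball_moebius_identity:
  fixes p z w :: "complex ^ 'd"
  assumes p: "norm p < 1" and z: "norm z < 1" and w: "norm w < 1"
  shows "1 - cinner_vec (ball_moebius p z) (ball_moebius p w) =
    of_real (1 - (norm p)\<^sup>2) * (1 - cinner_vec z w) / ((1 - cinner_vec z p) * cnj (1 - cinner_vec w p))"
proof -
  define s :: complex where "s = of_real (sqrt (1 - (norm p)\<^sup>2))"
  define \<alpha> where "\<alpha> = cinner_vec z p"
  define \<beta> where "\<beta> = cinner_vec w p"
  have p2: "(norm p)\<^sup>2 < 1" using p by (simp add: abs_square_less_1)
  have s2: "s\<^sup>2 = of_real (1 - (norm p)\<^sup>2)" unfolding s_def of_real_power[symmetric] using p2 by simp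
  have pn: "of_real ((norm p)\<^sup>2) = 1 - s\<^sup>2" unfolding s2 by simp
  have cs: "cnj s = s" by (simp add: s_def)
  have s1: "1 + s \<noteq> 0"
  proof
    assume "1 + s = 0"
    then have "Re (1 + s) = 0" by (simp only: zero_complex.sel)
    moreover have "Re (1 + s) = 1 + sqrt (1 - (norm p)\<^sup>2)" by (simp add: s_def)
    moreover have "sqrt (1 - (norm p)\<^sup>2) \<ge> 0" using p2 by simp
    ultimately show False by linarith
  qed
  have "cmod \<alpha> < 1" "cmod \<beta> < 1" unfolding \<alpha>_def \<beta>_def
    by (rule cinner_vec_lt1; use z w p in simp)+
  then have ne: "1 - \<alpha> \<noteq> 0" "1 - cnj \<beta> \<noteq> 0"
    by (metis complex_cnj_cancel_iff complex_cnj_one less_irrefl norm_one right_minus_eq)+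
  define A where "A = 1 - \<alpha> / (1 + s)"
  define B where "B = 1 - cnj \<beta> / (1 + s)"
  have mz: "ball_moebius p z $ i = (A * p $ i - s * z $ i) / (1 - \<alpha>)" for i
    unfolding ball_moebius_def Let_def s_def[symmetric] \<alpha>_def[symmetric] A_def by simp
  have mw: "cnj (ball_moebius p w $ i) = (B * cnj (p $ i) - s * cnj (w $ i)) / (1 - cnj \<beta>)" for i
    unfolding ball_moebius_def Let_def s_def[symmetric] \<beta>_def[symmetric] B_def by (simp add: cs)
  have "cinner_vec (ball_moebius p z) (ball_moebius p w) =
    (\<Sum>i\<in>UNIV. (A * p $ i - s * z $ i) * (B * cnj (p $ i) - s * cnj (w $ i)) / ((1 - \<alpha>) * (1 - cnj \<beta>)))"
    unfolding cinner_vec_def[of "ball_moebius p z"] mz mw by simp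
  also have "\<dots> = (\<Sum>i\<in>UNIV. (A * p $ i - s * z $ i) * (B * cnj (p $ i) - s * cnj (w $ i))) / ((1 - \<alpha>) * (1 - cnj \<beta>))"
    by (rule sum_divide_distrib[symmetric])
  also have "(\<Sum>i\<in>UNIV. (A * p $ i - s * z $ i) * (B * cnj (p $ i) - s * cnj (w $ i))) =
    A * B * (\<Sum>i\<in>UNIV. p $ i * cnj (p $ i)) - A * s * (\<Sum>i\<in>UNIV. p $ i * cnj (w $ i))
     - s * B * (\<Sum>i\<in>UNIV. z $ i * cnj (p $ i)) + s * s * (\<Sum>i\<in>UNIV. z $ i * cnj (w $ i))"
    unfolding sum_distrib_left sum_subtractf[symmetric] sum.distrib[symmetric]
    by (intro sum.cong refl) (simp add: algebra_simps)
  also have "\<dots> = A * B * (1 - s\<^sup>2) - A * s * cnj \<beta> - s * B * \<alpha> + s\<^sup>2 * cinner_vec z w"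
    unfolding cinner_vec_def[symmetric] \<alpha>_def[symmetric] cinner_vec_commute[of p w] \<beta>_def[symmetric] cinner_vec_norm pn
    by (simp add: power2_eq_square)
  also have "A * B * (1 - s\<^sup>2) - A * s * cnj \<beta> - s * B * \<alpha> = (1 - \<alpha>) * (1 - cnj \<beta>) - s\<^sup>2"
  proof -
    define t where "t = 1 / (1 + s)"
    have t: "t * (1 + s) = 1" using s1 by (simp add: t_def)
    have AB: "A = 1 - \<alpha> * t" "B = 1 - cnj \<beta> * t" by (simp_all add: A_def B_def t_def)
    show ?thesis unfolding AB using t by algebra
  qed
  finally have "cinner_vec (ball_moebius p z) (ball_moebius p w) =
    ((1 - \<alpha>) * (1 - cnj \<beta>) - s\<^sup>2 + s\<^sup>2 * cinner_vec z w) / ((1 - \<alpha>) * (1 - cnj \<beta>))" .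
  moreover have N: "(1 - \<alpha>) * (1 - cnj \<beta>) \<noteq> 0" using ne by simp
  ultimately have "1 - cinner_vec (ball_moebius p z) (ball_moebius p w) = s\<^sup>2 * (1 - cinner_vec z w) / ((1 - \<alpha>) * (1 - cnj \<beta>))"
    using N by (simp add: diff_divide_distrib add_divide_distrib right_diff_distrib)
  then show ?thesis by (simp add: s2 \<alpha>_def \<beta>_def)
qed

lemma norm_ball_moebius_lt1:
  fixes p z :: "complex ^ 'd"
  assumes p: "norm p < 1" and z: "norm z < 1"
  shows "norm (ball_moebius p z) < 1"
proof -
  have ne: "1 - cinner_vec z p \<noteq> 0" using cinner_vec_lt1[of z p] p z by auto
  have "complex_of_real (1 - (norm (ball_moebius p z))\<^sup>2) =
     of_real ((1 - (norm p)\<^sup>2) * (1 - (norm z)\<^sup>2) / (cmod (1 - cinner_vec z p))\<^sup>2)"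
    using ball_moebius_identity[OF p z z] unfolding cinner_vec_norm complex_norm_square[symmetric] by simp
  then have "1 - (norm (ball_moebius p z))\<^sup>2 = (1 - (norm p)\<^sup>2) * (1 - (norm z)\<^sup>2) / (cmod (1 - cinner_vec z p))\<^sup>2"
    by (simp only: of_real_eq_iff)
  also have "\<dots> > 0" using p z ne by (intro divide_pos_pos mult_pos_pos) (auto simp: abs_square_less_1)
  finally show ?thesis by (simp add: abs_square_less_1)
qed

locale drury_arveson_rkhs = rkhs V drury_arveson_kernel H ip
  for V :: "(complex ^ 'd) set" and H ip +
  assumes V_ball: "V \<subseteq> ball 0 1"
begin

lemma V_norm: "z \<in> V \<Longrightarrow> norm z < 1"
  using V_ball by auto

lemma cinner_ne: "z \<in> V \<Longrightarrow> norm p < 1 \<Longrightarrow> 1 - cinner_vec z p \<noteq> 0"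
  using cinner_vec_lt1[of z p] V_norm[of z] by auto

sublocale id: ball_rkhs V drury_arveson_kernel H ip "\<lambda>z. z" "one_on V"
proof
  fix z w assume "z \<in> V" "w \<in> V"
  then show "drury_arveson_kernel z w * (1 - cinner_vec z w) = one_on V z * cnj (one_on V w)"
    using cinner_ne[of z w] V_norm[of w] by (simp add: drury_arveson_kernel_def one_on_def)
qed (auto simp: V_norm one_on_def funs_on_def)

definition lin :: "complex ^ 'd \<Rightarrow> complex ^ 'd \<Rightarrow> complex" where
  "lin \<alpha> = (\<lambda>x. if x \<in> V then cinner_vec x \<alpha> else 0)"

definition kp :: "complex ^ 'd \<Rightarrow> complex ^ 'd \<Rightarrow> complex" where
  "kp p = (\<lambda>x. if x \<in> V then 1 / (1 - cinner_vec x p) else 0)"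

lemma lin_bmult: "bmult (lin \<alpha>) (norm \<alpha>)"
  unfolding bmult_def
proof (intro conjI ballI)
  show "lin \<alpha> \<in> funs_on V" by (simp add: lin_def funs_on_def)
  fix f assume f: "f \<in> H"
  have eq: "(\<lambda>x. lin \<alpha> x * f x) = (\<lambda>x. cinner_vec x \<alpha> * f x)"
    using zero_outside[OF f] by (auto simp: lin_def)
  show "(\<lambda>x. lin \<alpha> x * f x) \<in> H" "nrm (\<lambda>x. lin \<alpha> x * f x) \<le> norm \<alpha> * nrm f"
    unfolding eq by (rule id.cinner_bmult[OF f])+
qed

lemma lin_Mult: "lin \<alpha> \<in> Mult V H"
  by (rule bmult_Mult[OF lin_bmult])

lemma lin_sum: "lin \<alpha> = (\<lambda>x. \<Sum>i\<in>UNIV. cnj (\<alpha> $ i) * id.coord i x)"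
  unfolding lin_def id.coord_def cinner_vec_def by (auto simp: fun_eq_iff mult.commute)

definition pt :: "((complex ^ 'd \<Rightarrow> complex) \<Rightarrow> complex) \<Rightarrow> complex ^ 'd" where
  "pt \<omega> = (\<chi> i. \<omega> (id.coord i))"

lemma character_lin:
  assumes "character_on V (Mult V H) \<omega>"
  shows "\<omega> (lin \<alpha>) = cinner_vec (pt \<omega>) \<alpha>"
proof -
  have "\<omega> (lin \<alpha>) = (\<Sum>i\<in>UNIV. \<omega> (\<lambda>x. cnj (\<alpha> $ i) * id.coord i x))"
    unfolding lin_sum by (rule character_sum[OF assms]) (simp_all add: Mult_scale id.coord_Mult)
  also have "\<dots> = (\<Sum>i\<in>UNIV. cnj (\<alpha> $ i) * \<omega> (id.coord i))"
    by (simp add: character_scale[OF assms id.coord_Mult])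
  finally show ?thesis by (simp add: cinner_vec_def pt_def mult.commute)
qed

lemma Mult_mem: "\<psi> \<in> Mult V H \<Longrightarrow> \<psi> \<in> H"
proof -
  assume \<psi>: "\<psi> \<in> Mult V H"
  have "(\<lambda>x. \<psi> x * one_on V x) = \<psi>" using Mult_outside[OF \<psi>] by (auto simp: one_on_def)
  then show ?thesis using MultD[OF \<psi> id.e_mem] by simp
qed

definition one_minus_lin :: "complex ^ 'd \<Rightarrow> complex ^ 'd \<Rightarrow> complex" where
  "one_minus_lin p = (\<lambda>x. one_on V x - lin p x)"

lemma one_minus_lin_Mult: "one_minus_lin p \<in> Mult V H"
  unfolding one_minus_lin_def by (rule Mult_diff[OF Mult_one lin_Mult])

lemma character_one_minus_lin:
  assumes "character_on V (Mult V H) \<omega>"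
  shows "\<omega> (one_minus_lin q) = 1 - cinner_vec (pt \<omega>) q"
  unfolding one_minus_lin_def character_diff[OF assms Mult_one lin_Mult] character_one[OF assms]
    character_lin[OF assms] ..

lemma kp_Mult:
  assumes "norm p < 1"
  shows "kp p \<in> Mult V H"
proof (rule MultI)
  fix f assume f: "f \<in> H"
  have "(\<lambda>x. kp p x * f x) = id.szego p f"
    using zero_outside[OF f] by (auto simp: kp_def id.szego_def)
  then show "(\<lambda>x. kp p x * f x) \<in> H" using id.szego_mem[OF f assms] by simp
qed (simp add: kp_def)

lemma character_kp:
  assumes \<omega>: "character_on V (Mult V H) \<omega>" and q: "norm q < 1"
  shows "\<omega> (kp q) * (1 - cinner_vec (pt \<omega>) q) = 1"
proof -
  have "(\<lambda>x. kp q x * one_minus_lin q x) = one_on V"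
    using cinner_ne[OF _ q] by (auto simp: kp_def one_minus_lin_def lin_def one_on_def)
  then show ?thesis
    using character_mult[OF \<omega> kp_Mult[OF q] one_minus_lin_Mult[of q]] character_one[OF \<omega>]
      character_one_minus_lin[OF \<omega>, of q] by simp
qed

text \<open>
  In the description of the kernel by the automorphism at \<open>p\<close> the character vanishes on the coordinate
  functions, so \<open>character_eq_state\<close> applies with \<open>e\<close> a multiple of \<open>kp p\<close>. Applied to the multiplier
  \<open>\<psi> x * (1 - \<langle>x, p\<rangle>)\<close> it yields the asserted pairing.
\<close>

theorem character_is_evaluation:
  assumes \<omega>: "character_on V (Mult V H) \<omega>" and p: "norm (pt \<omega>) < 1" and \<psi>: "\<psi> \<in> Mult V H"
  shows "\<omega> \<psi> = ip \<psi> (kp (pt \<omega>))"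
proof -
  define p where "p = pt \<omega>"
  define s where "s = sqrt (1 - (norm p)\<^sup>2)"
  have p1: "norm p < 1" using p by (simp add: p_def)
  have p2: "(norm p)\<^sup>2 < 1" using p1 by (simp add: abs_square_less_1)
  have s: "0 < s" "s\<^sup>2 = 1 - (norm p)\<^sup>2" using p2 by (simp_all add: s_def)
  define e where "e = (\<lambda>x. of_real s * kp p x)"
  interpret m: ball_rkhs V drury_arveson_kernel H ip "ball_moebius p" e
  proof
    fix z assume z: "z \<in> V"
    show "norm (ball_moebius p z) < 1" by (rule norm_ball_moebius_lt1[OF p1 V_norm[OF z]])
    show "e z \<noteq> 0" using s cinner_ne[OF z p1] z by (simp add: e_def kp_def)
    fix w assume w: "w \<in> V"
    have "e z * cnj (e w) = of_real (s\<^sup>2) / ((1 - cinner_vec z p) * cnj (1 - cinner_vec w p))"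
      using z w by (simp add: e_def kp_def power2_eq_square)
    moreover have "1 - cinner_vec z w \<noteq> 0" using cinner_ne[OF z V_norm[OF w]] .
    ultimately show "drury_arveson_kernel z w * (1 - cinner_vec (ball_moebius p z) (ball_moebius p w)) = e z * cnj (e w)"
      unfolding ball_moebius_identity[OF p1 V_norm[OF z] V_norm[OF w]] drury_arveson_kernel_def s(2) by simp
  qed (simp add: e_def kp_def funs_on_def)
  have pp: "cinner_vec p p = of_real ((norm p)\<^sup>2)" by (rule cinner_vec_norm)
  have R: "\<omega> (one_minus_lin p) = of_real (s\<^sup>2)"
    using character_one_minus_lin[OF \<omega>, of p] unfolding p_def[symmetric] pp s(2) by simp
  have "\<omega> (m.coord i) = 0" for i
  proof -
    \<comment> \<open>The automorphism vanishes at p; after clearing its denominator the character can be applied.\<close>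
    define t :: complex where "t = 1 / (1 + of_real s)"
    have s1: "1 + complex_of_real s \<noteq> 0"
      using s(1) by (metis add_pos_pos less_irrefl of_real_1 of_real_add of_real_eq_0_iff zero_less_one)
    have ts: "t * (1 + of_real s) = 1" using s1 by (simp add: t_def)
    have "(\<lambda>x. m.coord i x * one_minus_lin p x) =
      (\<lambda>x. p $ i * (one_on V x - t * lin p x) - of_real s * id.coord i x)"
    proof
      fix x show "m.coord i x * one_minus_lin p x = p $ i * (one_on V x - t * lin p x) - of_real s * id.coord i x"
      proof (cases "x \<in> V")
        case True
        then show ?thesis using cinner_ne[OF True p1]
          by (simp add: m.coord_def ball_moebius_def Let_def s_def[symmetric] one_minus_lin_def lin_def one_on_def
            id.coord_def t_def mult.commute)
      qed (simp add: m.coord_def one_on_def lin_def id.coord_def)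
    qed
    then have "\<omega> (m.coord i) * \<omega> (one_minus_lin p) = \<omega> (\<lambda>x. p $ i * (one_on V x - t * lin p x) - of_real s * id.coord i x)"
      using character_mult[OF \<omega> m.coord_Mult[of i] one_minus_lin_Mult[of p]] by (simp only:)
    also have "\<dots> = p $ i * (1 - t * cinner_vec p p) - of_real s * p $ i"
      by (simp add: character_diff[OF \<omega>] character_scale[OF \<omega>] Mult_diff Mult_scale Mult_one lin_Mult
        id.coord_Mult character_one[OF \<omega>] character_lin[OF \<omega>] p_def pt_def)
    also have "\<dots> = 0"
    proof -
      have "cinner_vec p p = 1 - (of_real s)\<^sup>2" unfolding pp using s(2) by (simp flip: of_real_power)
      then show ?thesis using ts by algebra
    qed
    finally have "\<omega> (m.coord i) * of_real (s\<^sup>2) = 0" unfolding R .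
    then show ?thesis using s(1) by simp
  qed
  note state = m.character_eq_state(2)[OF \<omega> this]
  define \<psi>' where "\<psi>' = (\<lambda>x. \<psi> x * one_minus_lin p x)"
  have \<psi>': "\<psi>' \<in> Mult V H" unfolding \<psi>'_def by (rule Mult_mult[OF \<psi> one_minus_lin_Mult])
  have "(\<lambda>x. \<psi>' x * e x) = (\<lambda>x. of_real s * \<psi> x)"
    using Mult_outside[OF \<psi>] cinner_ne[OF _ p1]
    by (auto simp: \<psi>'_def e_def kp_def one_minus_lin_def one_on_def lin_def fun_eq_iff)
  then have "\<omega> \<psi>' = ip (\<lambda>x. of_real s * \<psi> x) (\<lambda>x. of_real s * kp p x)"
    using state[OF \<psi>'] by (simp add: e_def)
  also have "\<dots> = of_real (s\<^sup>2) * ip \<psi> (kp p)"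
    using Mult_mem[OF \<psi>] Mult_mem[OF kp_Mult[OF p1]]
    by (simp add: ip_scale ip_scale2 scale_mem power2_eq_square)
  also have "\<omega> \<psi>' = \<omega> \<psi> * of_real (s\<^sup>2)"
    unfolding \<psi>'_def character_mult[OF \<omega> \<psi> one_minus_lin_Mult] R ..
  finally show ?thesis using s(1) by (simp add: p_def)
qed

text \<open>
  By \<open>character_is_evaluation\<close> the pairings of the two kernel functions are given by the Drury-Arveson
  kernel at \<open>p\<close> and \<open>q\<close>, just as if both points were in \<open>V\<close>.
\<close>

lemma nrm_kp_diff_le:
  assumes \<omega>: "character_on V (Mult V H) \<omega>" and \<omega>': "character_on V (Mult V H) \<omega>'"
    and m: "0 < m" "m \<le> 1 - norm (pt \<omega>)" "m \<le> 1 - norm (pt \<omega>')"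
  shows "(nrm (\<lambda>x. kp (pt \<omega>) x - kp (pt \<omega>') x))\<^sup>2 \<le> 2 * norm (pt \<omega> - pt \<omega>') / m\<^sup>2"
proof -
  have half: "cmod (\<omega> (kp (pt \<omega>)) - \<omega> (kp (pt \<omega>'))) \<le> norm (pt \<omega> - pt \<omega>') / m\<^sup>2"
    if \<omega>: "character_on V (Mult V H) \<omega>" and le: "m \<le> 1 - norm (pt \<omega>)" "m \<le> 1 - norm (pt \<omega>')"
    for \<omega> \<omega>'
  proof -
    define p q where "p = pt \<omega>" and "q = pt \<omega>'"
    have pq: "norm p \<le> 1 - m" "norm q \<le> 1 - m" using le by (auto simp: p_def q_def)
    then have lt: "norm p < 1" "norm q < 1" using m(1) by auto
    have ab: "\<omega> (kp p) * (1 - cinner_vec p p) = 1" "\<omega> (kp q) * (1 - cinner_vec p q) = 1"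
      using character_kp[OF \<omega>] lt by (auto simp: p_def)
    have lb: "m \<le> cmod (1 - cinner_vec p r)" if "norm r \<le> 1 - m" for r
    proof -
      have "cmod (cinner_vec p r) \<le> norm p * norm r" by (rule cinner_vec_le)
      also have "\<dots> \<le> (1 - m) * 1" using pq that m norm_ge_zero[of p] norm_ge_zero[of r] by (intro mult_mono) linarith+
      finally show ?thesis using norm_triangle_ineq2[of 1 "cinner_vec p r"] by simp
    qed
    have ne: "1 - cinner_vec p p \<noteq> 0" "1 - cinner_vec p q \<noteq> 0"
      using lb[OF pq(1)] lb[OF pq(2)] m(1) by auto
    have "\<omega> (kp p) - \<omega> (kp q) = (cinner_vec p p - cinner_vec p q) / ((1 - cinner_vec p p) * (1 - cinner_vec p q))"
    proof -
      have "\<omega> (kp p) = 1 / (1 - cinner_vec p p)" "\<omega> (kp q) = 1 / (1 - cinner_vec p q)"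
        using ab ne by (auto simp: eq_divide_eq)
      then show ?thesis using ne by (simp add: diff_frac_eq)
    qed
    also have "cinner_vec p p - cinner_vec p q = cnj (cinner_vec (p - q) p)"
      unfolding cinner_diff_left complex_cnj_diff cinner_vec_commute[symmetric] ..
    finally have "cmod (\<omega> (kp p) - \<omega> (kp q)) = cmod (cinner_vec (p - q) p) / (cmod (1 - cinner_vec p p) * cmod (1 - cinner_vec p q))"
      by (simp add: norm_divide norm_mult)
    also have "\<dots> \<le> norm (p - q) / (m * m)"
    proof (rule frac_le)
      have "cmod (cinner_vec (p - q) p) \<le> norm (p - q) * norm p" by (rule cinner_vec_le)
      also have "\<dots> \<le> norm (p - q)" using lt by (simp add: mult_left_le)
      finally show "cmod (cinner_vec (p - q) p) \<le> norm (p - q)" .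
      show "m * m \<le> cmod (1 - cinner_vec p p) * cmod (1 - cinner_vec p q)"
        using lb pq m by (intro mult_mono) auto
    qed (use m in auto)
    finally show ?thesis by (simp add: p_def q_def power2_eq_square)
  qed
  have lt: "norm (pt \<omega>) < 1" "norm (pt \<omega>') < 1" using m by auto
  define P Q where "P = kp (pt \<omega>)" and "Q = kp (pt \<omega>')"
  have PM: "P \<in> Mult V H" "Q \<in> Mult V H" unfolding P_def Q_def using kp_Mult lt by auto
  have PH: "P \<in> H" "Q \<in> H" using Mult_mem PM by auto
  have "of_real ((nrm (\<lambda>x. P x - Q x))\<^sup>2) = ip (\<lambda>x. P x - Q x) (\<lambda>x. P x - Q x)"
    by (rule ip_self[symmetric, OF diff_mem[OF PH]])
  also have "\<dots> = (ip P P - ip Q P) - (ip P Q - ip Q Q)"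
    by (simp add: ip_diff ip_diff2 diff_mem PH)
  also have "\<dots> = (\<omega> P - \<omega> Q) + (\<omega>' Q - \<omega>' P)"
    using character_is_evaluation[OF \<omega> lt(1)] character_is_evaluation[OF \<omega>' lt(2)] PM
    by (simp add: P_def Q_def)
  finally have "(nrm (\<lambda>x. P x - Q x))\<^sup>2 = cmod ((\<omega> P - \<omega> Q) + (\<omega>' Q - \<omega>' P))"
    by (metis abs_power2 norm_of_real)
  also have "\<dots> \<le> norm (pt \<omega> - pt \<omega>') / m\<^sup>2 + norm (pt \<omega>' - pt \<omega>) / m\<^sup>2"
    using half[OF \<omega> m(2,3)] half[OF \<omega>' m(3,2)] unfolding P_def[symmetric] Q_def[symmetric]
    by (intro norm_triangle_mono) auto
  finally show ?thesis by (simp add: P_def Q_def norm_minus_commute)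
qed

theorem character_difference_le:
  assumes \<omega>: "character_on V (Mult V H) \<omega>" and \<omega>': "character_on V (Mult V H) \<omega>'"
    and m: "0 < m" "m \<le> 1 - norm (pt \<omega>)" "m \<le> 1 - norm (pt \<omega>')" and \<psi>: "\<psi> \<in> Mult V H"
  shows "cmod (\<omega> \<psi> - \<omega>' \<psi>) \<le> nrm \<psi> * sqrt (2 * norm (pt \<omega> - pt \<omega>')) / m"
proof -
  have lt: "norm (pt \<omega>) < 1" "norm (pt \<omega>') < 1" using m by auto
  define P Q where "P = kp (pt \<omega>)" and "Q = kp (pt \<omega>')"
  have PH: "P \<in> H" "Q \<in> H" unfolding P_def Q_def using Mult_mem kp_Mult lt by auto
  note \<psi>H = Mult_mem[OF \<psi>]
  have "\<omega> \<psi> - \<omega>' \<psi> = ip \<psi> (\<lambda>x. P x - Q x)"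
    using character_is_evaluation[OF \<omega> lt(1) \<psi>] character_is_evaluation[OF \<omega>' lt(2) \<psi>]
    by (simp add: P_def Q_def ip_diff2 \<psi>H PH[unfolded P_def Q_def])
  then have "cmod (\<omega> \<psi> - \<omega>' \<psi>) \<le> nrm \<psi> * nrm (\<lambda>x. P x - Q x)"
    using cauchy_schwarz[OF \<psi>H diff_mem[OF PH]] by simp
  also have "\<dots> \<le> nrm \<psi> * (sqrt (2 * norm (pt \<omega> - pt \<omega>')) / m)"
  proof (rule mult_left_mono[OF _ nrm_ge0[OF \<psi>H]])
    have "nrm (\<lambda>x. P x - Q x) \<le> sqrt (2 * norm (pt \<omega> - pt \<omega>') / m\<^sup>2)"
      using nrm_kp_diff_le[OF \<omega> \<omega>' m] by (simp add: P_def Q_def real_le_rsqrt)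
    then show "nrm (\<lambda>x. P x - Q x) \<le> sqrt (2 * norm (pt \<omega> - pt \<omega>')) / m"
      using m(1) by (simp add: real_sqrt_divide)
  qed
  finally show ?thesis by simp
qed

text \<open>
  If \<open>c = \<omega> \<psi>\<close> were larger than \<open>M\<close>, the Neumann series would invert \<open>1 - \<psi> / c\<close>, which the character
  annihilates.
\<close>

lemma character_bmult_le:
  assumes \<omega>: "character_on V (Mult V H) \<omega>" and b: "bmult \<psi> M" and M: "0 \<le> M"
  shows "cmod (\<omega> \<psi>) \<le> M"
proof (rule ccontr)
  define c where "c = \<omega> \<psi>"
  assume "\<not> cmod (\<omega> \<psi>) \<le> M"
  then have c: "M < cmod c" by (simp add: c_def)
  then have c0: "c \<noteq> 0" using M by auto
  define \<phi> where "\<phi> = (\<lambda>x. (1 / c) * \<psi> x)"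
  have \<psi>: "\<psi> \<in> Mult V H" by (rule bmult_Mult[OF b])
  have \<phi>: "bmult \<phi> (M / cmod c)"
    unfolding bmult_def
  proof (intro conjI ballI)
    show "\<phi> \<in> funs_on V" using b by (auto simp: bmult_def \<phi>_def funs_on_def)
    fix f assume "f \<in> H"
    then have g: "(\<lambda>x. \<psi> x * f x) \<in> H" "nrm (\<lambda>x. \<psi> x * f x) \<le> M * nrm f"
      using b by (auto simp: bmult_def)
    have eq: "(\<lambda>x. \<phi> x * f x) = (\<lambda>x. (1 / c) * (\<psi> x * f x))" by (simp add: \<phi>_def)
    show "(\<lambda>x. \<phi> x * f x) \<in> H" unfolding eq by (rule scale_mem[OF g(1)])
    show "nrm (\<lambda>x. \<phi> x * f x) \<le> M / cmod c * nrm f"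
      unfolding eq nrm_scale[OF g(1)] using g(2) c0 by (simp add: norm_divide divide_right_mono)
  qed
  have q: "0 \<le> M / cmod c" "M / cmod c < 1" using M c by (auto simp: divide_less_eq)
  obtain r where r: "r \<in> H" "\<And>x. (1 - \<phi> x) * r x = one_on V x"
    using neumann_series[OF \<phi> q id.e_mem] by blast
  have rM: "r \<in> Mult V H"
  proof (rule MultI)
    fix f assume f: "f \<in> H"
    obtain g where g: "g \<in> H" "\<And>x. (1 - \<phi> x) * g x = f x"
      using neumann_series[OF \<phi> q f] by blast
    have "g = (\<lambda>x. r x * f x)"
    proof
      fix x show "g x = r x * f x"
      proof (cases "x \<in> V")
        case True
        then have "(1 - \<phi> x) * r x = 1" using r(2)[of x] by (simp add: one_on_def)
        then show ?thesis using g(2)[of x] by algebra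
      qed (use zero_outside[OF g(1)] zero_outside[OF f] in simp)
    qed
    then show "(\<lambda>x. r x * f x) \<in> H" using g(1) by simp
  qed (use zero_outside[OF r(1)] in simp)
  have \<phi>M: "\<phi> \<in> Mult V H" by (rule bmult_Mult[OF \<phi>])
  have eq: "(\<lambda>x. (one_on V x - \<phi> x) * r x) = one_on V"
  proof
    fix x show "(one_on V x - \<phi> x) * r x = one_on V x"
      using r(2)[of x] zero_outside[OF r(1), of x] by (cases "x \<in> V") (auto simp: one_on_def)
  qed
  have "\<omega> (\<lambda>x. (one_on V x - \<phi> x) * r x) = 1" unfolding eq by (rule character_one[OF \<omega>])
  moreover have "\<omega> \<phi> = 1"
    unfolding \<phi>_def character_scale[OF \<omega> \<psi>] using c0 by (simp add: c_def)
  ultimately show False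
    unfolding character_mult[OF \<omega> Mult_diff[OF Mult_one \<phi>M] rM] character_diff[OF \<omega> Mult_one \<phi>M]
      character_one[OF \<omega>] by simp
qed

lemma norm_pt_le1:
  assumes "character_on V (Mult V H) \<omega>"
  shows "norm (pt \<omega>) \<le> 1"
proof -
  have "cmod (\<omega> (lin (pt \<omega>))) \<le> norm (pt \<omega>)"
    by (rule character_bmult_le[OF assms lin_bmult]) simp
  then have "(norm (pt \<omega>))\<^sup>2 \<le> norm (pt \<omega>)"
    unfolding character_lin[OF assms] cinner_vec_norm norm_of_real by simp
  then have le: "norm (pt \<omega>) * norm (pt \<omega>) \<le> 1 * norm (pt \<omega>)" by (simp add: power2_eq_square)
  show ?thesis
  proof (cases "pt \<omega> = 0")
    case False
    then show ?thesis by (intro mult_right_le_imp_le[OF le]) simp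
  qed simp
qed

definition linpow :: "complex ^ 'd \<Rightarrow> nat \<Rightarrow> complex ^ 'd \<Rightarrow> complex" where
  "linpow \<alpha> n = (\<lambda>x. if x \<in> V then cinner_vec x \<alpha> ^ n else 0)"

lemma linpow_Suc: "linpow \<alpha> (Suc n) = (\<lambda>x. lin \<alpha> x * linpow \<alpha> n x)"
  by (auto simp: linpow_def lin_def)

lemma linpow_0: "linpow \<alpha> 0 = one_on V"
  by (auto simp: linpow_def one_on_def)

lemma linpow_bmult:
  assumes "norm \<alpha> \<le> 1"
  shows "bmult (linpow \<alpha> n) 1"
proof (induction n)
  case 0
  have "one_on V \<in> funs_on V" by (simp add: one_on_def funs_on_def)
  then show ?case by (simp add: linpow_0 bmult_def one_on_mult)
next
  case (Suc n)
  show ?case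
    unfolding linpow_Suc using bmult_mult[OF bmult_le[OF lin_bmult assms] Suc] by simp
qed

lemma character_linpow:
  assumes \<omega>: "character_on V (Mult V H) \<omega>" and \<alpha>: "norm \<alpha> \<le> 1"
  shows "\<omega> (linpow \<alpha> n) = cinner_vec (pt \<omega>) \<alpha> ^ n"
proof (induction n)
  case 0 then show ?case by (simp add: linpow_0 character_one[OF \<omega>])
next
  case (Suc n)
  then show ?case
    unfolding linpow_Suc character_mult[OF \<omega> lin_Mult bmult_Mult[OF linpow_bmult[OF \<alpha>]]] character_lin[OF \<omega>]
    by simp
qed

lemma bmult_series:
  assumes b: "\<And>k. bmult (b k) 1" and c: "\<And>k::nat. cmod (c k) \<le> (1/3)^k"
  shows "bmult (\<lambda>x. \<Sum>k. c k * b k x) (3/2)" "\<And>x. summable (\<lambda>k. c k * b k x)"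
proof -
  have bf: "(\<lambda>x. c k * b k x * f x) \<in> H" "nrm (\<lambda>x. c k * b k x * f x) \<le> (1/3)^k * nrm f" if f: "f \<in> H" for f k
  proof -
    have g: "(\<lambda>x. b k x * f x) \<in> H" "nrm (\<lambda>x. b k x * f x) \<le> nrm f"
      using b[of k] f by (auto simp: bmult_def)
    have eq: "(\<lambda>x. c k * b k x * f x) = (\<lambda>x. c k * (b k x * f x))" by (simp add: mult.assoc)
    show "(\<lambda>x. c k * b k x * f x) \<in> H" unfolding eq by (rule scale_mem[OF g(1)])
    show "nrm (\<lambda>x. c k * b k x * f x) \<le> (1/3)^k * nrm f"
      unfolding eq nrm_scale[OF g(1)] by (rule mult_mono[OF c g(2)]) (auto intro: nrm_ge0[OF g(1)])
  qed
  have geos: "(\<lambda>k. (1/3)^k * nrm f) sums (3/2 * nrm f)" for f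
    using sums_mult2[OF geometric_sums[of "1/3::real"], of "nrm f"] by simp
  have geo: "summable (\<lambda>k. (1/3)^k * nrm f)" "(\<Sum>k. (1/3)^k * nrm f) = 3/2 * nrm f" for f
    using geos[of f] by (simp_all only: sums_iff)
  have sn: "summable (\<lambda>k. nrm (\<lambda>x. c k * b k x * f x))" if f: "f \<in> H" for f
    by (rule summable_comparison_test'[OF geo(1)[of f]]) (use bf[OF f] nrm_ge0 in simp)
  show sm: "summable (\<lambda>k. c k * b k x)" for x
  proof (cases "x \<in> V")
    case True
    then show ?thesis
      using series_mem(3)[OF bf(1)[OF id.e_mem] sn[OF id.e_mem], of x] by (simp add: one_on_def)
  next
    case False
    then have "b k x = 0" for k using b[of k] by (auto simp: bmult_def funs_on_def)
    then show ?thesis by simp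
  qed
  show "bmult (\<lambda>x. \<Sum>k. c k * b k x) (3/2)"
    unfolding bmult_def
  proof (intro conjI ballI)
    show "(\<lambda>x. \<Sum>k. c k * b k x) \<in> funs_on V"
      using b by (auto simp: bmult_def funs_on_def)
    fix f assume f: "f \<in> H"
    have eq: "(\<lambda>x. (\<Sum>k. c k * b k x) * f x) = (\<lambda>x. \<Sum>k. c k * b k x * f x)"
      by (simp add: suminf_mult2[OF sm])
    show "(\<lambda>x. (\<Sum>k. c k * b k x) * f x) \<in> H"
      unfolding eq by (rule series_mem(1)[OF bf(1)[OF f] sn[OF f]])
    have "nrm (\<lambda>x. \<Sum>k. c k * b k x * f x) \<le> (\<Sum>k. nrm (\<lambda>x. c k * b k x * f x))"
      by (rule series_mem(2)[OF bf(1)[OF f] sn[OF f]])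
    also have "\<dots> \<le> (\<Sum>k. (1/3)^k * nrm f)"
      by (rule suminf_le[OF bf(2)[OF f] sn[OF f] geo(1)])
    finally show "nrm (\<lambda>x. (\<Sum>k. c k * b k x) * f x) \<le> 3/2 * nrm f"
      unfolding eq geo(2) .
  qed
qed

text \<open>
  The tails of the series are multipliers of small norm, and characters are contractive.
\<close>

lemma character_series:
  assumes \<omega>: "character_on V (Mult V H) \<omega>"
    and b: "\<And>k. bmult (b k) 1" and c: "\<And>k::nat. cmod (c k) \<le> (1/3)^k"
  shows "(\<lambda>k. c k * \<omega> (b k)) sums \<omega> (\<lambda>x. \<Sum>k. c k * b k x)"
proof -
  have bM: "b k \<in> Mult V H" for k by (rule bmult_Mult[OF b])
  have tail: "cmod (\<omega> (\<lambda>x. \<Sum>k. c k * b k x) - (\<Sum>k<N. c k * \<omega> (b k))) \<le> (1/3)^N * (3/2)" for N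
  proof -
    \<comment> \<open>Rescaled tail coefficients satisfy the same bound, so the tail is a multiplier of norm 3/2 divided by 3^N.\<close>
    define c' where "c' k = 3^N * c (k + N)" for k
    have c': "cmod (c' k) \<le> (1/3)^k" for k
    proof -
      have "3^N * cmod (c (k + N)) \<le> 3^N * (1/3)^(k+N)" by (intro mult_left_mono c) simp
      then show ?thesis by (simp add: c'_def norm_mult norm_power power_add power_divide)
    qed
    define S' where "S' = (\<lambda>x. \<Sum>k. c' k * b (k + N) x)"
    have S': "bmult S' (3/2)" and sm': "summable (\<lambda>k. c' k * b (k + N) x)" for x
      unfolding S'_def using bmult_series[where b = "\<lambda>k. b (k + N)" and c = c', OF b c'] by auto
    have eq: "(\<lambda>x. \<Sum>k. c k * b k x) = (\<lambda>x. (\<Sum>k<N. c k * b k x) + (1/3)^N * S' x)"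
    proof
      fix x
      have "(\<Sum>k. c k * b k x) = (\<Sum>k. c (k + N) * b (k + N) x) + (\<Sum>k<N. c k * b k x)"
        by (rule suminf_split_initial_segment[OF bmult_series(2)[where b = b and c = c, OF b c]])
      also have "(\<lambda>k. c (k + N) * b (k + N) x) = (\<lambda>k. (1/3)^N * (c' k * b (k + N) x))"
        by (simp add: c'_def power_divide)
      also have "(\<Sum>k. (1/3)^N * (c' k * b (k + N) x)) = (1/3)^N * S' x"
        unfolding S'_def by (rule suminf_mult[OF sm'])
      finally show "(\<Sum>k. c k * b k x) = (\<Sum>k<N. c k * b k x) + (1/3)^N * S' x" by simp
    qed
    have "\<omega> (\<lambda>x. \<Sum>k. c k * b k x) = \<omega> (\<lambda>x. \<Sum>k<N. c k * b k x) + (1/3)^N * \<omega> S'"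
      unfolding eq
      by (subst character_add[OF \<omega> Mult_sum Mult_scale])
         (auto intro: Mult_scale bM bmult_Mult[OF S'] simp: character_scale[OF \<omega> bmult_Mult[OF S']])
    also have "\<omega> (\<lambda>x. \<Sum>k<N. c k * b k x) = (\<Sum>k<N. c k * \<omega> (b k))"
      by (subst character_sum[OF \<omega>]) (auto intro: Mult_scale bM simp: character_scale[OF \<omega> bM])
    finally have "\<omega> (\<lambda>x. \<Sum>k. c k * b k x) - (\<Sum>k<N. c k * \<omega> (b k)) = (1/3)^N * \<omega> S'" by simp
    then show ?thesis
      using character_bmult_le[OF \<omega> S'] by (simp add: norm_mult norm_power norm_divide)
  qed
  have "(\<lambda>N. (\<Sum>k<N. c k * \<omega> (b k)) - \<omega> (\<lambda>x. \<Sum>k. c k * b k x)) \<longlonglongrightarrow> 0"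
  proof (rule Lim_null_comparison)
    show "\<forall>\<^sub>F N in sequentially. norm ((\<Sum>k<N. c k * \<omega> (b k)) - \<omega> (\<lambda>x. \<Sum>k. c k * b k x)) \<le> (1/3)^N * (3/2)"
      using tail by (simp add: norm_minus_commute)
    show "(\<lambda>N. (1/3)^N * (3/2::real)) \<longlonglongrightarrow> 0"
      using tendsto_mult[OF LIMSEQ_realpow_zero[of "1/3"] tendsto_const[of "3/2::real"]] by simp
  qed
  then show ?thesis unfolding sums_def by (rule LIM_zero_cancel)
qed

end

section \<open>Area mean values\<close>

text \<open>
  The transfer to the plane gives access to the invariance of Lebesgue measure under orthogonal maps.
\<close>

lemma lborel_complex_real2: "(lborel :: complex measure) = distr lborel borel (\<lambda>v::real^2. Complex (v $ 1) (v $ 2))"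
proof (rule lborel_eqI)
  let ?L = "\<lambda>v::real^2. Complex (v $ 1) (v $ 2)"
  have Lm: "?L \<in> borel_measurable lborel"
  proof -
    have "continuous_on UNIV ?L" unfolding Complex_eq by (intro continuous_intros)
    then show ?thesis by (simp add: borel_measurable_continuous_onI)
  qed
  fix l u :: complex assume le: "\<And>b. b \<in> Basis \<Longrightarrow> l \<bullet> b \<le> u \<bullet> b"
  have "Re l \<le> Re u" "Im l \<le> Im u" using le[of 1] le[of \<i>] by (auto simp: Basis_complex_def)
  define a :: "real^2" where "a = vector [Re l, Im l]"
  define b :: "real^2" where "b = vector [Re u, Im u]"
  have pre: "?L -` box l u = box a b"
    by (auto simp: in_box_complex_iff mem_box_cart a_def b_def forall_2)
  have le': "a $ i \<le> b $ i" for i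
    using \<open>Re l \<le> Re u\<close> \<open>Im l \<le> Im u\<close> exhaust_2[of i] by (auto simp: a_def b_def)
  have "emeasure (distr lborel borel ?L) (box l u) = emeasure lborel (box a b)"
    using Lm by (subst emeasure_distr) (auto simp: pre)
  also have "\<dots> = emeasure lborel (cbox a b)"
    by (simp add: emeasure_lborel_cbox_eq emeasure_lborel_box_eq)
  also have "\<dots> = measure lborel (cbox a b)"
    by (rule emeasure_eq_ennreal_measure) (use emeasure_lborel_cbox_finite[of a b] in auto)
  also have "measure lborel (cbox a b) = (\<Prod>i\<in>UNIV. b $ i - a $ i)"
    by (rule content_cbox_cart) (auto simp: interval_eq_empty_cart le' not_less)
  also have "\<dots> = (Re u - Re l) * (Im u - Im l)"
    by (simp add: UNIV_2 a_def b_def)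
  also have "\<dots> = (\<Prod>b\<in>Basis. (u - l) \<bullet> b)"
    by (simp add: Basis_complex_def)
  finally show "emeasure (distr lborel borel ?L) (box l u) = (\<Prod>b\<in>Basis. (u - l) \<bullet> b)" .
qed simp

lemma lborel_rotate:
  fixes c :: complex
  assumes c: "cmod c = 1"
  shows "lborel = distr lborel borel ((*) c)"
proof (rule lborel_eqI)
  let ?L = "\<lambda>v::real^2. Complex (v $ 1) (v $ 2)"
  have Lm: "?L \<in> borel_measurable lborel"
  proof -
    have "continuous_on UNIV ?L" unfolding Complex_eq by (intro continuous_intros)
    then show ?thesis by (simp add: borel_measurable_continuous_onI)
  qed
  fix l u :: complex assume le: "\<And>b. b \<in> Basis \<Longrightarrow> l \<bullet> b \<le> u \<bullet> b"
  define B where "B = (*) c -` box l u"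
  have Bop: "open B" unfolding B_def by (intro open_vimage open_box continuous_intros)
  define M where "M z = ?L -` z" for z
  define T :: "real^2 \<Rightarrow> real^2" where "T v = vector [Re (cnj c * ?L v), Im (cnj c * ?L v)]" for v
  have LT: "?L (T v) = cnj c * ?L v" for v by (simp add: T_def complex_eq_iff)
  have cc: "cnj c * c = 1" using c by (metis complex_norm_square mult.commute of_real_1 one_power2)
  have normL: "norm v = cmod (?L v)" for v :: "real^2"
    by (simp add: norm_vec_def L2_set_def UNIV_2 cmod_def)
  have linT: "linear T"
    by (rule linearI) (auto simp: T_def vec_eq_iff forall_2 algebra_simps)
  have orthT: "orthogonal_transformation T"
    unfolding orthogonal_transformation using linT by (simp add: normL LT norm_mult c)
  have img: "?L -` B = T ` (?L -` box l u)"
  proof (intro equalityI subsetI)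
    fix v assume "v \<in> ?L -` B"
    then have cv: "c * ?L v \<in> box l u" by (simp add: B_def)
    define w :: "real^2" where "w = vector [Re (c * ?L v), Im (c * ?L v)]"
    have Lw: "?L w = c * ?L v" by (simp add: w_def complex_eq_iff)
    have "?L (T w) = ?L v" unfolding LT Lw using cc by (simp add: mult.assoc[symmetric])
    then have "v = T w" by (simp add: vec_eq_iff forall_2)
    moreover have "w \<in> ?L -` box l u" using cv Lw by simp
    ultimately show "v \<in> T ` (?L -` box l u)" by blast
  next
    fix v' assume "v' \<in> T ` (?L -` box l u)"
    then obtain v where v: "v' = T v" "?L v \<in> box l u" by auto
    have "c * ?L (T v) = ?L v" unfolding LT using cc by (simp add: mult.assoc[symmetric] mult.commute[of c])
    then have "?L (T v) \<in> B" unfolding B_def using v(2) by simp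
    then show "v' \<in> ?L -` B" using v(1) by simp
  qed
  define a :: "real^2" where "a = vector [Re l, Im l]"
  define b :: "real^2" where "b = vector [Re u, Im u]"
  have pre: "?L -` box l u = box a b"
    by (auto simp: in_box_complex_iff mem_box_cart a_def b_def forall_2)
  have lm: "box a b \<in> lmeasurable" by simp
  have "emeasure (distr lborel borel ((*) c)) (box l u) = emeasure lborel B"
    unfolding B_def by (subst emeasure_distr) auto
  also have "\<dots> = emeasure lborel (?L -` B)"
    by (subst lborel_complex_real2, subst emeasure_distr) (use Lm Bop in auto)
  also have "\<dots> = emeasure lebesgue (T ` box a b)"
    unfolding img pre using Lm Bop img pre measurable_sets[OF Lm, of B] by simp
  also have "\<dots> = emeasure lebesgue (box a b)"
    by (simp only: emeasure_eq_measure2[OF measurable_orthogonal_image[OF orthT lm]]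
      emeasure_eq_measure2[OF lm] measure_orthogonal_image[OF orthT lm])
  also have "\<dots> = emeasure lborel (box a b)" by simp
  also have "\<dots> = emeasure lborel (box l u)"
    by (subst lborel_complex_real2, subst emeasure_distr) (use Lm pre in auto)
  also have "\<dots> = (\<Prod>b\<in>Basis. (u - l) \<bullet> b)" by (rule emeasure_lborel_box[OF le])
  finally show "emeasure (distr lborel borel ((*) c)) (box l u) = (\<Prod>b\<in>Basis. (u - l) \<bullet> b)" .
qed simp

lemma circle_mean_value:
  assumes G: "G holomorphic_on ball 0 R" and x: "cmod x < R"
  shows "((\<lambda>t. G (x * exp (2 * of_real pi * \<i> * of_real t))) has_integral G 0) {0..1}"
proof -
  define h where "h u = G (x * u)" for u
  have sub: "(*) x ` cball 0 1 \<subseteq> ball 0 R"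
  proof safe
    fix u :: complex assume "u \<in> cball 0 1"
    then have "cmod x * cmod u \<le> cmod x * 1" by (intro mult_left_mono) auto
    then show "x * u \<in> ball 0 R" using x by (simp add: norm_mult)
  qed
  have "h holomorphic_on cball 0 1"
    unfolding h_def by (rule holomorphic_on_compose_gen[of "(*) x" _ G, unfolded o_def, OF _ G sub]) (intro holomorphic_intros)
  then have "((\<lambda>u. h u / (u - 0)) has_contour_integral (2 * of_real pi * \<i> * h 0)) (circlepath 0 1)"
    by (rule Cauchy_integral_circlepath_simple) simp
  then have "((\<lambda>t. h (circlepath 0 1 t) / circlepath 0 1 t * (2 * pi * \<i> * exp (2 * pi * \<i> * t))) has_integral (2 * of_real pi * \<i> * h 0)) {0..1}"
    unfolding has_contour_integral
    by (rule has_integral_eq[rotated]) (simp add: vector_derivative_circlepath)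
  then have "((\<lambda>t. (2 * of_real pi * \<i>) * h (exp (2 * of_real pi * \<i> * of_real t))) has_integral (2 * of_real pi * \<i> * h 0)) {0..1}"
    by (rule has_integral_eq[rotated]) (simp add: circlepath)
  then have "((\<lambda>t. h (exp (2 * of_real pi * \<i> * of_real t))) has_integral h 0) {0..1}"
    using has_integral_mult_right[of _ "2 * of_real pi * \<i> * h 0" "{0..1}" "1 / (2 * of_real pi * \<i>)"] by fastforce
  then show ?thesis by (simp add: h_def)
qed


lemma submean_circle:
  assumes g: "g holomorphic_on ball 0 R" and x: "cmod x < R"
  shows "ennreal ((cmod (g 0))\<^sup>2) \<le>
    (\<integral>\<^sup>+t. ennreal ((cmod (g (exp (2 * of_real pi * \<i> * of_real t) * x)))\<^sup>2) * indicator {0..1} t \<partial>lborel)"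
proof -
  define q where "q t = (cmod (g (exp (2 * of_real pi * \<i> * of_real t) * x)))\<^sup>2" for t :: real
  have G: "(\<lambda>z. (g z)\<^sup>2) holomorphic_on ball 0 R" using g by (rule holomorphic_on_power)
  have hi: "((\<lambda>t. (g (x * exp (2 * of_real pi * \<i> * of_real t)))\<^sup>2) has_integral (g 0)\<^sup>2) {0..1}"
    by (rule circle_mean_value[OF G x])
  have "continuous_on {0..1} (\<lambda>t. g (exp (2 * of_real pi * \<i> * of_real t) * x))"
    by (rule continuous_on_compose2[OF holomorphic_on_imp_continuous_on[OF g]])
       (auto intro!: continuous_intros simp: norm_mult x)
  then have qc: "continuous_on {0..1} q" unfolding q_def by (intro continuous_intros)
  then have qi: "q integrable_on {0..1}" by (rule integrable_continuous_interval)
  have "cmod ((g 0)\<^sup>2) \<le> integral {0..1} q"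
    unfolding integral_unique[OF hi, symmetric]
    by (rule integral_norm_bound_integral[OF has_integral_integrable[OF hi] qi])
       (simp add: q_def norm_power mult.commute)
  then have "ennreal ((cmod (g 0))\<^sup>2) \<le> ennreal (integral {0..1} q)"
    by (intro ennreal_leI) (simp add: norm_power)
  also have "\<dots> = (\<integral>\<^sup>+t. ennreal (q t) * indicator {0..1} t \<partial>lborel)"
    by (rule nn_integral_has_integral_lebesgue'[symmetric, OF _ integrable_integral[OF qi]]) (simp add: q_def)
  finally show ?thesis by (simp add: q_def)
qed

text \<open>
  The integral is invariant under rotations. Averaging it over all rotations and exchanging the
  integrals reduces the claim to the mean value inequality on circles.
\<close>

lemma bergman_centre:
  assumes g: "g holomorphic_on ball 0 R"
  shows "ennreal ((cmod (g 0))\<^sup>2) * emeasure lborel (ball (0::complex) R) \<le>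
    (\<integral>\<^sup>+x. ennreal ((cmod (g x))\<^sup>2) * indicator (ball 0 R) x \<partial>lborel)"
proof -
  define ex where "ex t = exp (2 * of_real pi * \<i> * of_real t)" for t :: real
  have ex1: "cmod (ex t) = 1" for t by (simp add: ex_def)
  define F where "F p = indicator (UNIV \<times> ball 0 R) p *\<^sub>R (cmod (g (ex (fst p) * snd p)))\<^sup>2" for p :: "real \<times> complex"
  have Fm: "F \<in> borel_measurable borel"
    unfolding F_def
  proof (rule borel_measurable_continuous_on_indicator)
    show "(UNIV \<times> ball 0 R :: (real \<times> complex) set) \<in> sets borel" by (intro borel_open open_Times) auto
    have "continuous_on (UNIV \<times> ball 0 R) (\<lambda>p::real \<times> complex. g (ex (fst p) * snd p))"
      by (rule continuous_on_compose2[OF holomorphic_on_imp_continuous_on[OF g]])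
         (auto intro!: continuous_intros simp: ex_def norm_mult)
    then show "continuous_on (UNIV \<times> ball 0 R) (\<lambda>p::real \<times> complex. (cmod (g (ex (fst p) * snd p)))\<^sup>2)"
      by (intro continuous_intros)
  qed
  define I where "I = (\<integral>\<^sup>+x. ennreal ((cmod (g x))\<^sup>2) * indicator (ball 0 R) x \<partial>lborel)"
  have F0: "ennreal (F (t, x)) = ennreal ((cmod (g (ex t * x)))\<^sup>2) * indicator (ball 0 R) x" for t x
    by (auto simp: F_def split: split_indicator)
  have rot: "(\<integral>\<^sup>+x. ennreal (F (t, x)) \<partial>lborel) = I" for t
  proof -
    have Fm0: "(\<lambda>x. ennreal (F (0, x))) \<in> borel_measurable borel"
      using Fm by (intro measurable_compose[OF _ measurable_ennreal] measurable_compose[OF _ Fm]) auto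
    have "I = (\<integral>\<^sup>+x. ennreal (F (0, x)) \<partial>lborel)" unfolding I_def F0 by (simp add: ex_def)
    also have "\<dots> = (\<integral>\<^sup>+x. ennreal (F (0, ex t * x)) \<partial>lborel)"
      by (subst lborel_rotate[OF ex1[of t]], subst nn_integral_distr) (use Fm0 in auto)
    also have "\<dots> = (\<integral>\<^sup>+x. ennreal (F (t, x)) \<partial>lborel)"
      unfolding F0 by (intro nn_integral_cong) (simp add: ex1 norm_mult ex_def[of 0] split: split_indicator)
    finally show ?thesis ..
  qed
  have psf: "pair_sigma_finite (lborel :: real measure) (lborel :: complex measure)"
    by (intro pair_sigma_finite.intro sigma_finite_lborel)
  have "ennreal ((cmod (g 0))\<^sup>2) * emeasure lborel (ball (0::complex) R) =
    (\<integral>\<^sup>+x. ennreal ((cmod (g 0))\<^sup>2) * indicator (ball (0::complex) R) x \<partial>lborel)"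
    by (subst nn_integral_cmult_indicator) auto
  also have "\<dots> \<le> (\<integral>\<^sup>+x. (\<integral>\<^sup>+t. ennreal (F (t, x)) * indicator {0..1} t \<partial>lborel) \<partial>lborel)"
  proof (rule nn_integral_mono)
    fix x :: complex
    show "ennreal ((cmod (g 0))\<^sup>2) * indicator (ball 0 R) x \<le> (\<integral>\<^sup>+t. ennreal (F (t, x)) * indicator {0..1} t \<partial>lborel)"
    proof (cases "x \<in> ball 0 R")
      case True
      then have "cmod x < R" by simp
      from submean_circle[OF g this] True show ?thesis unfolding F0 ex_def by simp
    qed simp
  qed
  also have "\<dots> = (\<integral>\<^sup>+t. (\<integral>\<^sup>+x. ennreal (F (t, x)) * indicator {0..1} t \<partial>lborel) \<partial>lborel)"
  proof (rule pair_sigma_finite.Fubini'[OF psf])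
    have "F \<in> borel_measurable (lborel \<Otimes>\<^sub>M lborel)" using Fm by (simp add: lborel_prod)
    then have "(\<lambda>p. ennreal (F p) * indicator {0..1} (fst p)) \<in> borel_measurable (lborel \<Otimes>\<^sub>M lborel)"
      by measurable
    then show "(\<lambda>(t, x). ennreal (F (t, x)) * indicator {0..1} t) \<in> borel_measurable (lborel \<Otimes>\<^sub>M lborel)"
      by (simp add: split_beta')
  qed
  also have "\<dots> = (\<integral>\<^sup>+t. I * indicator {0..1::real} t \<partial>lborel)"
  proof (rule nn_integral_cong)
    fix t :: real
    have "(\<lambda>x. ennreal (F (t, x))) \<in> borel_measurable lborel"
      using Fm by (intro measurable_compose[OF _ measurable_ennreal] measurable_compose[OF _ Fm]) auto
    then show "(\<integral>\<^sup>+x. ennreal (F (t, x)) * indicator {0..1} t \<partial>lborel) = I * indicator {0..1} t"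
      by (subst nn_integral_multc) (auto simp: rot)
  qed
  also have "\<dots> = I" by (subst nn_integral_cmult_indicator) auto
  finally show ?thesis unfolding I_def .
qed

lemma bergman_estimate:
  assumes g: "g holomorphic_on ball z R"
  shows "ennreal ((cmod (g z))\<^sup>2) * emeasure lborel (ball z R) \<le>
    (\<integral>\<^sup>+x. ennreal ((cmod (g x))\<^sup>2) * indicator (ball z R) x \<partial>lborel)"
proof -
  have ho: "(\<lambda>x. g (z + x)) holomorphic_on ball 0 R"
    by (rule holomorphic_on_compose_gen[of "(+) z" _ g, unfolded o_def, OF _ g])
       (auto intro!: holomorphic_intros simp: dist_norm)
  have m: "(\<lambda>x. ennreal ((cmod (g x))\<^sup>2) * indicator (ball z R) x) \<in> borel_measurable borel"
  proof -
    have "(\<lambda>x. indicator (ball z R) x *\<^sub>R (cmod (g x))\<^sup>2) \<in> borel_measurable borel"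
      by (rule borel_measurable_continuous_on_indicator)
         (auto intro!: continuous_intros holomorphic_on_imp_continuous_on[OF g])
    then have "(\<lambda>x. ennreal (indicator (ball z R) x *\<^sub>R (cmod (g x))\<^sup>2)) \<in> borel_measurable borel"
      by simp
    moreover have "ennreal (indicator (ball z R) x *\<^sub>R (cmod (g x))\<^sup>2) = ennreal ((cmod (g x))\<^sup>2) * indicator (ball z R) x" for x
      by (auto split: split_indicator)
    ultimately show ?thesis by (simp only:)
  qed
  have "emeasure lborel (ball z R) = emeasure lborel (ball (0::complex) R)"
    by (cases "R \<ge> 0") (simp_all add: emeasure_ball ball_empty)
  then have "ennreal ((cmod (g z))\<^sup>2) * emeasure lborel (ball z R) \<le>
    (\<integral>\<^sup>+x. ennreal ((cmod (g (z + x)))\<^sup>2) * indicator (ball 0 R) x \<partial>lborel)"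
    using bergman_centre[OF ho] by simp
  also have "\<dots> = (\<integral>\<^sup>+x. ennreal ((cmod (g (z + x)))\<^sup>2) * indicator (ball z R) (z + x) \<partial>lborel)"
    by (intro nn_integral_cong) (simp add: dist_norm split: split_indicator)
  also have "\<dots> = (\<integral>\<^sup>+x. ennreal ((cmod (g x))\<^sup>2) * indicator (ball z R) x \<partial>lborel)"
    by (subst (2) lborel_distr_plus[of z, symmetric], subst nn_integral_distr) (use m in auto)
  finally show ?thesis .
qed

section \<open>The Dirichlet space\<close>

text \<open>
  The Dirichlet integral of \<open>f\<close>, without the normalising factor, is \<open>energy (deriv f)\<close>.
\<close>

definition energy :: "(complex \<Rightarrow> complex) \<Rightarrow> ennreal" where
  "energy g = (\<integral>\<^sup>+z. ennreal ((cmod (g z))\<^sup>2) * indicator (ball 0 1) z \<partial>lborel)"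

lemma measurable_on_disc:
  assumes "continuous_on (ball 0 1) q" "\<And>z. 0 \<le> q z"
  shows "(\<lambda>z::complex. ennreal (q z) * indicator (ball 0 1) z) \<in> borel_measurable lborel"
proof -
  have "(\<lambda>z. indicator (ball 0 1) z *\<^sub>R q z) \<in> borel_measurable borel"
    by (rule borel_measurable_continuous_on_indicator[OF _ assms(1)]) auto
  then have "(\<lambda>z. ennreal (indicator (ball 0 1) z *\<^sub>R q z)) \<in> borel_measurable lborel"
    by simp
  moreover have "ennreal (indicator (ball 0 1) z *\<^sub>R q z) = ennreal (q z) * indicator (ball 0 1) z" for z
    by (auto split: split_indicator)
  ultimately show ?thesis by (simp only:)
qed

lemma measurable_energy:
  fixes g :: "complex \<Rightarrow> complex"
  assumes "continuous_on (ball 0 1) g"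
  shows "(\<lambda>z. ennreal ((cmod (g z))\<^sup>2) * indicator (ball 0 1) z) \<in> borel_measurable lborel"
  by (rule measurable_on_disc) (auto intro!: continuous_intros assms)

lemma energy_le_sum2:
  assumes g: "continuous_on (ball 0 1) g" and h: "continuous_on (ball 0 1) h"
    and le: "\<And>z. z \<in> ball 0 1 \<Longrightarrow> cmod (f z) \<le> cmod (g z) + cmod (h z)"
  shows "energy f \<le> 2 * energy g + 2 * energy h"
proof -
  have "energy f \<le> (\<integral>\<^sup>+z. 2 * (ennreal ((cmod (g z))\<^sup>2) * indicator (ball 0 1) z) + 2 * (ennreal ((cmod (h z))\<^sup>2) * indicator (ball 0 1) z) \<partial>lborel)"
    unfolding energy_def
  proof (rule nn_integral_mono)
    fix z :: complex
    show "ennreal ((cmod (f z))\<^sup>2) * indicator (ball 0 1) z \<le>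
      2 * (ennreal ((cmod (g z))\<^sup>2) * indicator (ball 0 1) z) + 2 * (ennreal ((cmod (h z))\<^sup>2) * indicator (ball 0 1) z)"
    proof (cases "z \<in> ball 0 1")
      case True
      have "(cmod (f z))\<^sup>2 \<le> (cmod (g z) + cmod (h z))\<^sup>2" by (rule power_mono[OF le[OF True]]) simp
      also have "\<dots> \<le> 2 * (cmod (g z))\<^sup>2 + 2 * (cmod (h z))\<^sup>2"
        using sum_squares_bound[of "cmod (g z)" "cmod (h z)"] by (simp add: power2_sum)
      finally have "ennreal ((cmod (f z))\<^sup>2) \<le> ennreal (2 * (cmod (g z))\<^sup>2 + 2 * (cmod (h z))\<^sup>2)"
        by (rule ennreal_leI)
      also have "\<dots> = 2 * ennreal ((cmod (g z))\<^sup>2) + 2 * ennreal ((cmod (h z))\<^sup>2)"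
        by (simp add: ennreal_plus ennreal_mult)
      finally show ?thesis using True by simp
    qed simp
  qed
  also have "\<dots> = 2 * energy g + 2 * energy h"
    unfolding energy_def
    using measurable_energy[OF g] measurable_energy[OF h]
    by (subst nn_integral_add) (auto simp: nn_integral_cmult)
  finally show ?thesis .
qed

lemma energy_cmult:
  assumes "continuous_on (ball 0 1) g"
  shows "energy (\<lambda>z. c * g z) = ennreal ((cmod c)\<^sup>2) * energy g"
proof -
  have "ennreal ((cmod (c * g z))\<^sup>2) * indicator (ball 0 1) z =
    ennreal ((cmod c)\<^sup>2) * (ennreal ((cmod (g z))\<^sup>2) * indicator (ball 0 1) z)" for z
    by (simp add: norm_mult power_mult_distrib ennreal_mult mult.assoc)
  then show ?thesis unfolding energy_def using measurable_energy[OF assms]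
    by (simp only: nn_integral_cmult)
qed

lemma deriv_cong_disc:
  assumes "\<And>z. z \<in> ball 0 1 \<Longrightarrow> f z = g z" "z \<in> ball (0::complex) 1"
  shows "deriv f z = deriv g z"
proof (rule deriv_cong_ev[OF _ refl])
  show "\<forall>\<^sub>F x in nhds z. f x = g x"
    using assms by (intro eventually_nhds_in_open[THEN eventually_mono, of "ball 0 1"]) auto
qed

lemma deriv_continuous: "f holomorphic_on ball 0 1 \<Longrightarrow> continuous_on (ball 0 1) (deriv f)"
  by (intro holomorphic_on_imp_continuous_on holomorphic_deriv) auto

lemma deriv_at: "f holomorphic_on ball 0 1 \<Longrightarrow> z \<in> ball 0 1 \<Longrightarrow> (f has_field_derivative deriv f z) (at z)"
  by (rule holomorphic_derivI) auto

text \<open>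
  The derivative of \<open>f\<close> may be irregular outside the open disc, hence the passage to an integrand that is
  cut off at the disc.
\<close>

lemma dirichlet_space_iff:
  "f \<in> dirichlet_space \<longleftrightarrow> f \<in> funs_on (ball 0 1) \<and> f holomorphic_on ball 0 1 \<and> energy (deriv f) < \<infinity>"
proof -
  have "(\<integral>\<^sup>+z. ennreal ((cmod (deriv f z))\<^sup>2) \<partial>uniform_measure lborel (ball 0 1)) < \<infinity> \<longleftrightarrow> energy (deriv f) < \<infinity>"
    if hol: "f holomorphic_on ball 0 1"
  proof -
    let ?q = "\<lambda>z. ennreal ((cmod (deriv f z))\<^sup>2) * indicator (ball 0 1) z"
    have m: "?q \<in> borel_measurable lborel" by (rule measurable_energy[OF deriv_continuous[OF hol]])
    have "(\<integral>\<^sup>+z. ennreal ((cmod (deriv f z))\<^sup>2) \<partial>uniform_measure lborel (ball 0 1)) =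
        (\<integral>\<^sup>+z. ?q z \<partial>uniform_measure lborel (ball 0 1))"
      by (intro nn_integral_cong_AE AE_uniform_measureI) auto
    also have "\<dots> = (\<integral>\<^sup>+z. ?q z * indicator (ball 0 1) z \<partial>lborel) / emeasure lborel (ball (0::complex) 1)"
      by (rule nn_integral_uniform_measure[OF m]) simp
    also have "(\<integral>\<^sup>+z. ?q z * indicator (ball 0 1) z \<partial>lborel) = energy (deriv f)"
      unfolding energy_def by (intro nn_integral_cong) (simp split: split_indicator)
    also have "emeasure lborel (ball (0::complex) 1) = ennreal pi"
      by (simp add: emeasure_ball unit_ball_vol_2)
    finally show ?thesis
      by (simp add: ennreal_divide_eq_top_iff less_top[symmetric])
  qed
  then show ?thesis unfolding dirichlet_space_def by blast
qed

definition disc_restrict :: "(complex \<Rightarrow> complex) \<Rightarrow> complex \<Rightarrow> complex" where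
  "disc_restrict f = (\<lambda>z. if z \<in> ball 0 1 then f z else 0)"

lemma disc_restrict_hol: "f holomorphic_on ball 0 1 \<Longrightarrow> disc_restrict f holomorphic_on ball 0 1"
  by (rule holomorphic_transform[of f]) (simp_all add: disc_restrict_def)

lemma deriv_disc_restrict: "z \<in> ball 0 1 \<Longrightarrow> deriv (disc_restrict f) z = deriv f z"
  by (rule deriv_cong_disc) (simp_all add: disc_restrict_def)

lemma energy_cong: "(\<And>z. z \<in> ball 0 1 \<Longrightarrow> f z = g z) \<Longrightarrow> energy f = energy g"
  unfolding energy_def by (intro nn_integral_cong) (auto split: split_indicator)

lemma disc_restrict_dirichlet_iff:
  assumes "f holomorphic_on ball 0 1"
  shows "disc_restrict f \<in> dirichlet_space \<longleftrightarrow> energy (deriv f) < \<infinity>"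
proof -
  have "energy (deriv (disc_restrict f)) = energy (deriv f)"
    by (rule energy_cong) (rule deriv_disc_restrict)
  moreover have "disc_restrict f \<in> funs_on (ball 0 1)" by (simp add: disc_restrict_def funs_on_def)
  ultimately show ?thesis by (simp only: dirichlet_space_iff disc_restrict_hol[OF assms] simp_thms)
qed

lemma dirichlet_one: "one \<in> dirichlet_space" if "one = disc_restrict (\<lambda>z. 1)"
proof -
  have "energy (deriv (\<lambda>z::complex. 1::complex)) < \<infinity>" by (simp add: energy_def)
  then show ?thesis unfolding that by (subst disc_restrict_dirichlet_iff) auto
qed

text \<open>
  The area mean value inequality on the largest disc around \<open>z\<close> inside the unit disc.
\<close>

lemma dirichlet_deriv_bound:
  assumes f: "f \<in> dirichlet_space"
  obtains C where "0 \<le> C" "\<And>z. z \<in> ball 0 1 \<Longrightarrow> cmod (deriv f z) * (1 - cmod z) \<le> C"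
proof -
  have hol: "f holomorphic_on ball 0 1" and fin: "energy (deriv f) < \<infinity>"
    using f by (auto simp: dirichlet_space_iff)
  obtain I where I: "0 \<le> I" "energy (deriv f) = ennreal I"
    using fin by (cases "energy (deriv f)") auto
  have "cmod (deriv f z) * (1 - cmod z) \<le> sqrt (I / pi)" if z: "z \<in> ball 0 1" for z
  proof -
    define R where "R = 1 - cmod z"
    have R: "0 < R" using z by (simp add: R_def)
    have sub: "ball z R \<subseteq> ball 0 1"
    proof
      fix x assume "x \<in> ball z R"
      then show "x \<in> ball 0 1" using norm_triangle_ineq[of z "x - z"] by (simp add: R_def dist_norm norm_minus_commute)
    qed
    have "deriv f holomorphic_on ball z R"
      by (rule holomorphic_on_subset[OF holomorphic_deriv[OF hol] sub]) simp
    then have "ennreal ((cmod (deriv f z))\<^sup>2) * emeasure lborel (ball z R) \<le>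
      (\<integral>\<^sup>+x. ennreal ((cmod (deriv f x))\<^sup>2) * indicator (ball z R) x \<partial>lborel)"
      by (rule bergman_estimate)
    also have "\<dots> \<le> energy (deriv f)"
      unfolding energy_def using sub by (intro nn_integral_mono) (auto split: split_indicator)
    finally have "ennreal ((cmod (deriv f z))\<^sup>2 * (pi * R\<^sup>2)) \<le> ennreal I"
      using R by (simp add: I emeasure_ball unit_ball_vol_2 ennreal_mult')
    then have "(cmod (deriv f z))\<^sup>2 * (pi * R\<^sup>2) \<le> I" using I(1) by (simp add: ennreal_le_iff)
    then have "(cmod (deriv f z) * R)\<^sup>2 \<le> I / pi"
      by (simp add: power_mult_distrib pos_le_divide_eq mult_ac)
    then show ?thesis unfolding R_def using real_le_rsqrt by blast
  qed
  then show thesis using that[of "sqrt (I / pi)"] I(1) by simp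
qed

text \<open>
  Integrate the bound on the derivative along the radius, after weakening it to a power of \<open>1 - cmod z\<close>.
\<close>

lemma dirichlet_growth:
  assumes f: "f \<in> dirichlet_space" and \<sigma>: "0 < \<sigma>"
  obtains C where "0 \<le> C" "\<And>z. z \<in> ball 0 1 \<Longrightarrow> cmod (f z) \<le> C * (1 - cmod z) powr (- \<sigma>)"
proof -
  have hol: "f holomorphic_on ball 0 1" using f by (auto simp: dirichlet_space_iff)
  obtain C where C: "0 \<le> C" "\<And>z. z \<in> ball 0 1 \<Longrightarrow> cmod (deriv f z) * (1 - cmod z) \<le> C"
    by (rule dirichlet_deriv_bound[OF f]) blast
  have "cmod (f z) \<le> (cmod (f 0) + C / \<sigma>) * (1 - cmod z) powr (- \<sigma>)" if z: "z \<in> ball 0 1" for z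
  proof -
    define r where "r = cmod z"
    have r: "0 \<le> r" "r < 1" using z by (auto simp: r_def)
    have tr: "0 < 1 - t * r" "1 - t * r \<le> 1" if "0 \<le> t" "t \<le> 1" for t
      using that r mult_left_le_one_le[of r t] by auto
    have inb: "of_real t * z \<in> ball 0 1" if "0 \<le> t" "t \<le> 1" for t
      using tr[OF that] that by (simp add: norm_mult r_def)
    have "norm (f (of_real 1 * z) - f (of_real 0 * z)) \<le> C / \<sigma> * (1 - 1 * r) powr (- \<sigma>) - C / \<sigma> * (1 - 0 * r) powr (- \<sigma>)"
    proof (rule differentiable_bound_general[where f = "\<lambda>t. f (of_real t * z)" and f' = "\<lambda>t. z * deriv f (of_real t * z)"
        and \<phi>' = "\<lambda>t. C * r * (1 - t * r) powr (- \<sigma> - 1)"])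
      show "continuous_on {0..1} (\<lambda>t. f (of_real t * z))"
        by (rule continuous_on_compose2[OF holomorphic_on_imp_continuous_on[OF hol]])
           (auto intro!: continuous_intros inb simp del: mem_ball)
      show "continuous_on {0..1} (\<lambda>t. C / \<sigma> * (1 - t * r) powr - \<sigma>)"
        by (intro continuous_intros) (use tr in fastforce)+
      fix t :: real assume t: "0 < t" "t < 1"
      then have t': "0 \<le> t" "t \<le> 1" by auto
      have "((\<lambda>w. f (w * z)) has_field_derivative deriv f (of_real t * z) * z) (at (of_real t))"
        by (rule DERIV_chain2[where f = f and g = "\<lambda>w. w * z", OF deriv_at[OF hol inb[OF t']]])
           (auto intro!: derivative_eq_intros)
      then show "((\<lambda>t. f (of_real t * z)) has_vector_derivative z * deriv f (of_real t * z)) (at t)"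
        using has_vector_derivative_real_field[of "\<lambda>w. f (w * z)"] by (simp add: mult.commute)
      show "((\<lambda>t. C / \<sigma> * (1 - t * r) powr - \<sigma>) has_vector_derivative C * r * (1 - t * r) powr (- \<sigma> - 1)) (at t)"
        unfolding has_real_derivative_iff_has_vector_derivative[symmetric]
        using tr[OF t'] \<sigma> by (auto intro!: derivative_eq_intros simp: powr_diff field_simps)
      have "cmod (deriv f (of_real t * z)) * (1 - t * r) \<le> C"
        using C(2)[OF inb[OF t']] t' by (simp add: norm_mult r_def)
      then have "cmod (deriv f (of_real t * z)) \<le> C * (1 - t * r) powr (-1)"
        using tr[OF t'] by (simp add: powr_minus field_simps)
      also have "\<dots> \<le> C * (1 - t * r) powr (- \<sigma> - 1)"
        using tr[OF t'] \<sigma> C(1) by (intro mult_left_mono powr_mono') auto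
      finally have "r * cmod (deriv f (of_real t * z)) \<le> r * (C * (1 - t * r) powr (- \<sigma> - 1))"
        using r(1) by (rule mult_left_mono)
      then show "norm (z * deriv f (of_real t * z)) \<le> C * r * (1 - t * r) powr (- \<sigma> - 1)"
        by (simp add: norm_mult r_def[symmetric] mult.left_commute mult.assoc)
    qed auto
    then have "cmod (f z) \<le> cmod (f 0) + C / \<sigma> * (1 - r) powr (- \<sigma>)"
      using norm_triangle_sub[of "f z" "f 0"] C(1) \<sigma> by (simp add: divide_nonneg_pos) (smt (verit) divide_nonneg_pos)
    moreover have "1 \<le> (1 - r) powr (- \<sigma>)"
      using r \<sigma> by (simp add: powr_minus one_le_inverse_iff powr_le1)
    then have "cmod (f 0) * 1 \<le> cmod (f 0) * (1 - r) powr (- \<sigma>)" by (intro mult_left_mono) auto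
    ultimately show ?thesis by (simp add: r_def distrib_right)
  qed
  then show thesis using that[of "cmod (f 0) + C / \<sigma>"] C(1) \<sigma> by simp
qed

text \<open>
  Singularities at the boundary are integrated layer by layer, with a crude bound for the measure of each
  layer in place of polar coordinates.
\<close>

lemma layer_integral:
  fixes D :: "complex set" and G :: "complex \<Rightarrow> real" and a m :: "nat \<Rightarrow> real"
  assumes S: "\<And>j. S j \<in> sets lborel" "\<And>j. emeasure lborel (S j) \<le> ennreal (m j)"
    and a: "\<And>j. 0 \<le> a j" and m: "\<And>j. 0 \<le> m j"
    and cover: "\<And>z. z \<in> D \<Longrightarrow> \<exists>j. z \<in> S j \<and> G z \<le> a j"
    and s: "summable (\<lambda>j. a j * m j)"
  shows "(\<integral>\<^sup>+z. ennreal (G z) * indicator D z \<partial>lborel) \<le> ennreal (\<Sum>j. a j * m j)"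
proof -
  have "(\<integral>\<^sup>+z. ennreal (G z) * indicator D z \<partial>lborel) \<le> (\<integral>\<^sup>+z. (\<Sum>j. ennreal (a j) * indicator (S j) z) \<partial>lborel)"
  proof (rule nn_integral_mono)
    fix z :: complex
    show "ennreal (G z) * indicator D z \<le> (\<Sum>j. ennreal (a j) * indicator (S j) z)"
    proof (cases "z \<in> D")
      case True
      then obtain j where j: "z \<in> S j" "G z \<le> a j" using cover by blast
      have "ennreal (G z) * indicator D z \<le> (\<Sum>i\<in>{j}. ennreal (a i) * indicator (S i) z)"
        using True j by (simp add: ennreal_leI)
      also have "\<dots> \<le> (\<Sum>j. ennreal (a j) * indicator (S j) z)"
        by (rule sum_le_suminf) auto
      finally show ?thesis .
    qed simp
  qed
  also have "\<dots> = (\<Sum>j. \<integral>\<^sup>+z. ennreal (a j) * indicator (S j) z \<partial>lborel)"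
    using S(1) by (intro nn_integral_suminf) auto
  also have "\<dots> = (\<Sum>j. ennreal (a j) * emeasure lborel (S j))"
    using S(1) by (simp add: nn_integral_cmult_indicator)
  also have "\<dots> \<le> (\<Sum>j. ennreal (a j * m j))"
    using S(2) a m by (intro suminf_le) (auto simp: ennreal_mult intro!: mult_left_mono)
  also have "\<dots> = ennreal (\<Sum>j. a j * m j)"
    by (rule suminf_ennreal2) (use a m s in auto)
  finally show ?thesis .
qed

lemma dyadic_exists:
  fixes x :: real
  assumes "0 < x" "x \<le> 1"
  obtains j :: nat where "(1/2)^Suc j < x" "x \<le> (1/2)^j"
proof -
  define P where "P j \<longleftrightarrow> (1/2)^j < x" for j :: nat
  obtain n where "P n" unfolding P_def using real_arch_pow_inv[of x "1/2"] assms by auto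
  define k where "k = (LEAST j. P j)"
  have k: "P k" unfolding k_def by (rule LeastI[of P, OF \<open>P n\<close>])
  have "k \<noteq> 0" using k assms by (cases k) (auto simp: P_def)
  then obtain j where j: "k = Suc j" using not0_implies_Suc by blast
  have "\<not> P j" using not_less_Least[of j P] j k_def by auto
  then show thesis using that[of j] k j by (simp add: P_def)
qed

lemma boundary_layer_integral:
  assumes a: "\<And>j. 0 \<le> a j" and s: "summable (\<lambda>j. a j * (1/4)^j)" and \<zeta>: "cmod \<zeta> = 1"
    and G: "\<And>z j. z \<in> ball 0 1 \<Longrightarrow> (1/2)^j < cmod (z - \<zeta>) \<Longrightarrow> cmod (z - \<zeta>) \<le> 2 * (1/2)^j \<Longrightarrow> G z \<le> a j"
  shows "(\<integral>\<^sup>+z. ennreal (G z) * indicator (ball 0 1) z \<partial>lborel) \<le> ennreal (4 * pi * (\<Sum>j. a j * (1/4)^j))"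
proof -
  have "(\<integral>\<^sup>+z. ennreal (G z) * indicator (ball 0 1) z \<partial>lborel) \<le> ennreal (\<Sum>j. a j * (4 * pi * (1/4)^j))"
  proof (rule layer_integral[where S = "\<lambda>j. cball \<zeta> (2 * (1/2)^j)"])
    show "emeasure lborel (cball \<zeta> (2 * (1/2)^j)) \<le> ennreal (4 * pi * (1/4)^j)" for j :: nat
    proof -
      have "(2 * (1/2::real)^j)\<^sup>2 = 4 * (1/4)^j"
        unfolding power2_eq_square by (simp add: mult_ac flip: power_mult_distrib)
      moreover have "emeasure lborel (cball \<zeta> (2 * (1/2)^j)) = ennreal (pi * (2 * (1/2)^j)\<^sup>2)"
        by (subst emeasure_cball) (simp_all add: unit_ball_vol_2)
      ultimately have "emeasure lborel (cball \<zeta> (2 * (1/2)^j)) = ennreal (pi * (4 * (1/4)^j))"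
        by (simp only:)
      then show ?thesis by (simp add: mult_ac)
    qed
    show "summable (\<lambda>j. a j * (4 * pi * (1/4)^j))"
      using summable_mult[OF s, of "4 * pi"] by (simp add: mult_ac)
    fix z :: complex assume z: "z \<in> ball 0 1"
    have "0 < cmod (z - \<zeta>) / 2" using z \<zeta> by auto
    moreover have "cmod (z - \<zeta>) / 2 \<le> 1" using norm_triangle_ineq4[of z \<zeta>] z \<zeta> by simp
    ultimately obtain j where j: "(1/2)^Suc j < cmod (z - \<zeta>) / 2" "cmod (z - \<zeta>) / 2 \<le> (1/2)^j"
      by (rule dyadic_exists)
    then have "G z \<le> a j" by (intro G[OF z]) auto
    moreover have "z \<in> cball \<zeta> (2 * (1/2)^j)" using j by (simp add: dist_norm norm_minus_commute)
    ultimately show "\<exists>j. z \<in> cball \<zeta> (2 * (1/2)^j) \<and> G z \<le> a j" by blast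
  qed (use a in auto)
  also have "(\<Sum>j. a j * (4 * pi * (1/4)^j)) = 4 * pi * (\<Sum>j. a j * (1/4)^j)"
    using suminf_mult[OF s, of "4 * pi"] by (simp add: mult_ac)
  finally show ?thesis .
qed

section \<open>Integrals with boundary singularities and the iterated logarithm\<close>

lemma disc_layer_measure:
  assumes "0 \<le> \<delta>" "\<delta> \<le> 1"
  shows "emeasure lborel (ball (0::complex) 1 - ball 0 (1 - \<delta>)) \<le> ennreal (2 * pi * \<delta>)"
proof -
  have "emeasure lborel (ball (0::complex) 1 - ball 0 (1 - \<delta>)) =
      emeasure lborel (ball (0::complex) 1) - emeasure lborel (ball (0::complex) (1 - \<delta>))"
    by (rule emeasure_Diff) (use assms in \<open>auto simp: emeasure_ball\<close>)
  also have "\<dots> = ennreal (pi - pi * (1 - \<delta>)\<^sup>2)"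
    using assms by (simp add: emeasure_ball unit_ball_vol_2 ennreal_minus)
  also have "\<dots> \<le> ennreal (2 * pi * \<delta>)"
    by (rule ennreal_leI) (simp add: power2_eq_square algebra_simps)
  finally show ?thesis .
qed

lemma radial_integral_finite:
  "(\<integral>\<^sup>+z. ennreal ((1 - cmod z) powr (-1/2)) * indicator (ball (0::complex) 1) z \<partial>lborel) < \<infinity>"
proof -
  \<comment> \<open>The layer of thickness 1/2^j has area of the order 1/2^j, so its contribution is of the order q^j.\<close>
  define q :: real where "q = (1/2) powr (1/2)"
  have q: "0 < q" "q < 1" "q * q = 1/2" by (auto simp: q_def powr_half_sqrt real_sqrt_lt_1_iff)
  have "(\<integral>\<^sup>+z. ennreal ((1 - cmod z) powr (-1/2)) * indicator (ball (0::complex) 1) z \<partial>lborel)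
     \<le> ennreal (\<Sum>j. ((1/2)^Suc j) powr (-1/2) * (2 * pi * (1/2)^j))"
  proof (rule layer_integral[where S = "\<lambda>j. ball 0 1 - ball 0 (1 - (1/2)^j)"])
    show "emeasure lborel (ball (0::complex) 1 - ball 0 (1 - (1/2)^j)) \<le> ennreal (2 * pi * (1/2)^j)" for j :: nat
      by (rule disc_layer_measure) (auto simp: power_le_one)
    have eq: "((1/2)^Suc j) powr (-1/2) * (2 * pi * (1/2)^j) = (2 * pi / q) * q ^ j" for j
    proof -
      have "((1/2::real)^Suc j) powr (1/2) = q ^ Suc j"
        unfolding q_def by (simp add: powr_powr powr_realpow[symmetric] powr_power del: power_Suc)
      then have 1: "((1/2::real)^Suc j) powr (-1/2) = inverse (q ^ Suc j)"
        using powr_minus[of "(1/2::real)^Suc j" "1/2"] by (simp del: power_Suc)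
      have 2: "(1/2::real)^j = q^j * q^j" unfolding power_mult_distrib[symmetric] q(3) ..
      show ?thesis unfolding 1 2 using q(1) by (simp add: field_simps)
    qed
    show "summable (\<lambda>j. ((1/2)^Suc j) powr (-1/2) * (2 * pi * (1/2)^j))"
      unfolding eq using q by (intro summable_mult summable_geometric) auto
    fix z :: complex assume z: "z \<in> ball 0 1"
    then have "0 < 1 - cmod z" "1 - cmod z \<le> 1" by auto
    then obtain j where j: "(1/2)^Suc j < 1 - cmod z" "1 - cmod z \<le> (1/2)^j" by (rule dyadic_exists)
    have "(1 - cmod z) powr (-1/2) \<le> ((1/2)^Suc j) powr (-1/2)"
      by (rule powr_mono2') (use j in auto)
    moreover have "z \<in> ball 0 1 - ball 0 (1 - (1/2)^j)" using z j by auto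
    ultimately show "\<exists>j. z \<in> ball 0 1 - ball 0 (1 - (1/2)^j) \<and> (1 - cmod z) powr (-1/2) \<le> ((1/2)^Suc j) powr (-1/2)" by blast
  qed auto
  then show ?thesis using ennreal_less_top le_less_trans by fastforce
qed

lemma boundary_power_integral:
  assumes \<eta>: "0 < \<eta>" "\<eta> \<le> 1"
  obtains K :: real where "0 \<le> K" "\<And>\<zeta>. cmod \<zeta> = 1 \<Longrightarrow>
    (\<integral>\<^sup>+z. ennreal (cmod (z - \<zeta>) powr (\<eta> - 2)) * indicator (ball (0::complex) 1) z \<partial>lborel) \<le> ennreal K"
proof -
  define a where "a j = ((1/2)^j) powr (\<eta> - 2)" for j :: nat
  define q where "q = (1/2::real) powr \<eta>"
  have q: "0 < q" "q < 1" using \<eta> by (auto simp: q_def powr_def ln_div)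
  have eq: "a j * (1/4)^j = q ^ j" for j
  proof -
    have 4: "(1/4::real)^j = ((1/2)^j) powr 2" by (simp add: powr_numeral power2_eq_square flip: power_mult_distrib)
    have "a j * (1/4)^j = ((1/2)^j) powr \<eta>" unfolding a_def 4 powr_add[symmetric] by (simp only: diff_add_cancel)
    also have "\<dots> = q ^ j" unfolding q_def by (simp add: powr_realpow[symmetric] powr_powr mult.commute)
    finally show ?thesis .
  qed
  have "(\<integral>\<^sup>+z. ennreal (cmod (z - \<zeta>) powr (\<eta> - 2)) * indicator (ball (0::complex) 1) z \<partial>lborel)
      \<le> ennreal (4 * pi * (\<Sum>j. a j * (1/4)^j))" if "cmod \<zeta> = 1" for \<zeta>
  proof (rule boundary_layer_integral[OF _ _ that])
    show "summable (\<lambda>j. a j * (1/4)^j)" unfolding eq using q by (intro summable_geometric) auto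
    fix z :: complex and j :: nat assume "(1/2)^j < cmod (z - \<zeta>)"
    then show "cmod (z - \<zeta>) powr (\<eta> - 2) \<le> a j"
      unfolding a_def using \<eta> by (intro powr_mono2') auto
  qed (simp add: a_def)
  moreover have "0 \<le> 4 * pi * (\<Sum>j. a j * (1/4)^j)"
    unfolding eq using q by (intro mult_nonneg_nonneg suminf_nonneg summable_geometric) auto
  ultimately show thesis using that by blast
qed

text \<open>
  This function is unbounded along the radius to \<open>\<zeta>\<close>. Its energy is finite, since the square of its
  derivative is of the order \<open>1 / (t * ln t)\<^sup>2\<close> at distance \<open>t\<close> from \<open>\<zeta>\<close>.
\<close>

definition loglog :: "complex \<Rightarrow> complex \<Rightarrow> complex" where
  "loglog \<zeta> z = Ln (2 - Ln (1 - cnj \<zeta> * z))"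

lemma circle_dist:
  assumes "cmod \<zeta> = 1"
  shows "cmod (1 - cnj \<zeta> * z) = cmod (z - \<zeta>)"
proof -
  have "cnj \<zeta> * \<zeta> = 1" using assms by (metis complex_norm_square mult.commute of_real_1 one_power2)
  then have "1 - cnj \<zeta> * z = cnj \<zeta> * (\<zeta> - z)" by (simp add: algebra_simps)
  then show ?thesis using assms by (simp add: norm_mult norm_minus_commute)
qed

lemma Re_one_minus_pos:
  assumes "cmod \<zeta> = 1" "z \<in> ball 0 1"
  shows "0 < Re (1 - cnj \<zeta> * z)"
proof -
  have "Re (cnj \<zeta> * z) \<le> cmod (cnj \<zeta> * z)" by (rule complex_Re_le_cmod)
  also have "\<dots> < 1" using assms by (simp add: norm_mult)
  finally show ?thesis by simp
qed

lemma loglog_inner: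
  assumes "cmod \<zeta> = 1" "z \<in> ball 0 1"
  shows "Re (2 - Ln (1 - cnj \<zeta> * z)) = 2 - ln (cmod (z - \<zeta>))" "1 \<le> 2 - ln (cmod (z - \<zeta>))"
proof -
  have ne: "1 - cnj \<zeta> * z \<noteq> 0"
    using Re_one_minus_pos[OF assms] by (metis less_irrefl zero_complex.sel(1))
  then show "Re (2 - Ln (1 - cnj \<zeta> * z)) = 2 - ln (cmod (z - \<zeta>))"
    by (simp add: Re_Ln circle_dist[OF assms(1)])
  have pos: "0 < cmod (z - \<zeta>)" using ne circle_dist[OF assms(1), of z] by (metis zero_less_norm_iff)
  have "cmod (z - \<zeta>) \<le> 2" using norm_triangle_ineq4[of z \<zeta>] assms by simp
  then have "ln (cmod (z - \<zeta>)) \<le> cmod (z - \<zeta>) - 1" using ln_le_minus_one[OF pos] by simp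
  then show "1 \<le> 2 - ln (cmod (z - \<zeta>))" using \<open>cmod (z - \<zeta>) \<le> 2\<close> by linarith
qed

lemma loglog_deriv:
  assumes \<zeta>: "cmod \<zeta> = 1" and z: "z \<in> ball 0 1"
  obtains d where "(loglog \<zeta> has_field_derivative d) (at z)"
    "cmod d = 1 / (cmod (z - \<zeta>) * cmod (2 - Ln (1 - cnj \<zeta> * z)))"
proof -
  define w where "w = 1 - cnj \<zeta> * z"
  have w: "0 < Re w" unfolding w_def by (rule Re_one_minus_pos[OF assms])
  have v: "1 \<le> Re (2 - Ln w)" using loglog_inner[OF assms] by (simp add: w_def)
  have nn: "w \<notin> \<real>\<^sub>\<le>\<^sub>0" "2 - Ln w \<notin> \<real>\<^sub>\<le>\<^sub>0" using w v by (auto simp: complex_nonpos_Reals_iff)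
  have "((\<lambda>z. Ln (2 - Ln (1 - cnj \<zeta> * z))) has_field_derivative (cnj \<zeta> / w / (2 - Ln w))) (at z)"
    using nn w v unfolding w_def by (auto intro!: derivative_eq_intros simp: field_simps)
  then have "(loglog \<zeta> has_field_derivative (cnj \<zeta> / w / (2 - Ln w))) (at z)"
    unfolding loglog_def[abs_def] .
  moreover have "cmod (cnj \<zeta> / w / (2 - Ln w)) = 1 / (cmod (z - \<zeta>) * cmod (2 - Ln w))"
    using \<zeta> circle_dist[OF \<zeta>, of z] by (simp add: norm_divide norm_mult w_def)
  ultimately show thesis using that by (simp add: w_def)
qed

lemma loglog_hol: "cmod \<zeta> = 1 \<Longrightarrow> loglog \<zeta> holomorphic_on ball 0 1"
  unfolding holomorphic_on_open[OF open_ball] by (metis loglog_deriv)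

lemma loglog_deriv_bound:
  assumes "cmod \<zeta> = 1" "z \<in> ball 0 1"
  shows "cmod (deriv (loglog \<zeta>) z) \<le> 1 / (cmod (z - \<zeta>) * (2 - ln (cmod (z - \<zeta>))))"
proof -
  obtain d where d: "(loglog \<zeta> has_field_derivative d) (at z)"
    "cmod d = 1 / (cmod (z - \<zeta>) * cmod (2 - Ln (1 - cnj \<zeta> * z)))"
    by (rule loglog_deriv[OF assms])
  have "2 - ln (cmod (z - \<zeta>)) \<le> cmod (2 - Ln (1 - cnj \<zeta> * z))"
    using loglog_inner(1)[OF assms] complex_Re_le_cmod[of "2 - Ln (1 - cnj \<zeta> * z)"] by simp
  then have "cmod d \<le> 1 / (cmod (z - \<zeta>) * (2 - ln (cmod (z - \<zeta>))))"
    unfolding d(2) using loglog_inner(2)[OF assms] assms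
    by (intro divide_left_mono mult_left_mono mult_pos_pos) auto
  then show ?thesis using DERIV_imp_deriv[OF d(1)] by simp
qed

lemma loglog_energy:
  obtains K :: real where "0 \<le> K" "\<And>\<zeta>. cmod \<zeta> = 1 \<Longrightarrow> energy (deriv (loglog \<zeta>)) \<le> ennreal K"
proof -
  define a :: "nat \<Rightarrow> real" where "a j = 4^j / ((ln 2)\<^sup>2 * (real (Suc j))\<^sup>2)" for j
  have eq: "a j * (1/4)^j = (1 / (ln 2)\<^sup>2) * (1 / (real (Suc j))\<^sup>2)" for j
    by (simp add: a_def power_one_over)
  have s: "summable (\<lambda>j. a j * (1/4)^j)"
    unfolding eq by (intro summable_mult) (use inverse_squares_sums sums_summable in \<open>auto simp: add.commute\<close>)
  have "energy (deriv (loglog \<zeta>)) \<le> ennreal (4 * pi * (\<Sum>j. a j * (1/4)^j))" if \<zeta>: "cmod \<zeta> = 1" for \<zeta>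
    unfolding energy_def
  proof (rule boundary_layer_integral[OF _ s \<zeta>])
    fix z :: complex and j :: nat
    assume z: "z \<in> ball 0 1" and lo: "(1/2)^j < cmod (z - \<zeta>)" and hi: "cmod (z - \<zeta>) \<le> 2 * (1/2)^j"
    have pos: "0 < cmod (z - \<zeta>)" using lo by (smt (verit) zero_less_power half_gt_zero_iff)
    have "ln (cmod (z - \<zeta>)) \<le> ln (2 * (1/2)^j)" using hi pos by (subst ln_le_cancel_iff) auto
    also have "\<dots> = ln 2 - real j * ln 2" by (simp add: ln_mult ln_realpow ln_div)
    finally have "ln 2 * real (Suc j) \<le> 2 - ln (cmod (z - \<zeta>))"
      using ln2_le_25_over_36 by (simp add: algebra_simps)
    then have "(1/2)^j * (ln 2 * real (Suc j)) \<le> cmod (z - \<zeta>) * (2 - ln (cmod (z - \<zeta>)))"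
      using lo by (intro mult_mono) auto
    then have "1 / (cmod (z - \<zeta>) * (2 - ln (cmod (z - \<zeta>)))) \<le> 1 / ((1/2)^j * (ln 2 * real (Suc j)))"
      using loglog_inner(2)[OF \<zeta> z] pos by (intro divide_left_mono mult_pos_pos) auto
    with loglog_deriv_bound[OF \<zeta> z] have "cmod (deriv (loglog \<zeta>) z) \<le> 1 / ((1/2)^j * (ln 2 * real (Suc j)))"
      by linarith
    then have "(cmod (deriv (loglog \<zeta>) z))\<^sup>2 \<le> (1 / ((1/2)^j * (ln 2 * real (Suc j))))\<^sup>2"
      by (rule power_mono) simp
    also have "\<dots> = a j"
    proof -
      have "((1/2::real)^j)\<^sup>2 = 1 / 4^j" by (simp add: power2_eq_square power_one_over flip: power_mult_distrib)
      then show ?thesis by (simp add: a_def power_mult_distrib power_divide)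
    qed
    finally show "(cmod (deriv (loglog \<zeta>) z))\<^sup>2 \<le> a j" .
  qed (simp add: a_def)
  moreover have "0 \<le> 4 * pi * (\<Sum>j. a j * (1/4)^j)"
    by (intro mult_nonneg_nonneg suminf_nonneg s) (auto simp: a_def)
  ultimately show thesis using that by blast
qed

section \<open>Series of functions of bounded energy\<close>

lemma Cauchy_Schwarz_weighted:
  fixes x w :: "nat \<Rightarrow> real"
  assumes "\<And>k. 0 \<le> w k"
  shows "(\<Sum>k<N. w k * x k)\<^sup>2 \<le> (\<Sum>k<N. w k) * (\<Sum>k<N. w k * (x k)\<^sup>2)"
proof -
  have "(\<Sum>k<N. sqrt (w k) * (sqrt (w k) * x k))\<^sup>2 \<le> (\<Sum>k<N. (sqrt (w k))\<^sup>2) * (\<Sum>k<N. (sqrt (w k) * x k)\<^sup>2)"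
    by (rule Cauchy_Schwarz_ineq_sum)
  then show ?thesis using assms by (simp add: power_mult_distrib mult.assoc[symmetric])
qed

lemma holomorphic_series:
  assumes G: "\<And>k. G k holomorphic_on ball (0::complex) 1"
    and bd: "\<And>r. r < 1 \<Longrightarrow> \<exists>M. \<forall>k. \<forall>z. cmod z \<le> r \<longrightarrow> cmod (G k z) \<le> M"
    and c: "\<And>k::nat. cmod (c k) \<le> (1/3)^k"
  shows "(\<lambda>z. \<Sum>k. c k * G k z) holomorphic_on ball 0 1"
    and "\<And>z. z \<in> ball 0 1 \<Longrightarrow> (\<lambda>k. c k * G k z) sums (\<Sum>k. c k * G k z)"
    and "\<And>z. z \<in> ball 0 1 \<Longrightarrow> (\<lambda>k. c k * deriv (G k) z) sums deriv (\<lambda>z. \<Sum>k. c k * G k z) z"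
proof -
  have "\<exists>g g'. \<forall>x\<in>ball 0 1. ((\<lambda>k. c k * G k x) sums g x) \<and> ((\<lambda>k. c k * deriv (G k) x) sums g' x) \<and> (g has_field_derivative g' x) (at x)"
  proof (rule series_and_derivative_comparison_local[OF open_ball])
    fix n x assume "x \<in> ball (0::complex) 1"
    then show "((\<lambda>x. c n * G n x) has_field_derivative c n * deriv (G n) x) (at x)"
      by (intro DERIV_cmult deriv_at G)
  next
    fix x :: complex assume x: "x \<in> ball 0 1"
    define r where "r = (1 + cmod x) / 2"
    have r: "r < 1" "cmod x < r" using x by (auto simp: r_def)
    obtain M where M: "\<And>k z. cmod z \<le> r \<Longrightarrow> cmod (G k z) \<le> M" using bd[OF r(1)] by blast
    have "cmod (c n * G n y) \<le> (1/3)^n * M" if "y \<in> ball x (r - cmod x)" for n y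
    proof -
      have "cmod y \<le> r" using that norm_triangle_ineq[of x "y - x"] by (simp add: dist_norm norm_minus_commute)
      then show ?thesis using M[of y n] by (auto simp: norm_mult intro!: mult_mono c)
    qed
    then show "\<exists>d h. 0 < d \<and> summable h \<and> (\<forall>\<^sub>F n in sequentially. \<forall>y\<in>ball x d \<inter> ball 0 1. norm (c n * G n y) \<le> h n)"
      using r by (intro exI[of _ "r - cmod x"] exI[of _ "\<lambda>n. (1/3)^n * M"])
        (auto intro!: summable_mult2 summable_geometric always_eventually)
  qed
  then obtain g g' where g: "\<And>x. x \<in> ball 0 1 \<Longrightarrow> (\<lambda>k. c k * G k x) sums g x"
    "\<And>x. x \<in> ball 0 1 \<Longrightarrow> (\<lambda>k. c k * deriv (G k) x) sums g' x"
    "\<And>x. x \<in> ball 0 1 \<Longrightarrow> (g has_field_derivative g' x) (at x)" by blast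
  have eq: "(\<Sum>k. c k * G k x) = g x" if "x \<in> ball 0 1" for x using g(1)[OF that] by (simp add: sums_iff)
  show "\<And>z. z \<in> ball 0 1 \<Longrightarrow> (\<lambda>k. c k * G k z) sums (\<Sum>k. c k * G k z)" using g(1) eq by simp
  have "g holomorphic_on ball 0 1" using g(3) holomorphic_on_open[OF open_ball] by blast
  then show "(\<lambda>z. \<Sum>k. c k * G k z) holomorphic_on ball 0 1"
    by (rule holomorphic_transform) (simp add: eq)
  show "(\<lambda>k. c k * deriv (G k) z) sums deriv (\<lambda>z. \<Sum>k. c k * G k z) z" if z: "z \<in> ball 0 1" for z
  proof -
    have "deriv (\<lambda>z. \<Sum>k. c k * G k z) z = deriv g z" by (rule deriv_cong_disc[OF eq z])
    also have "\<dots> = g' z" by (rule DERIV_imp_deriv[OF g(3)[OF z]])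
    finally show ?thesis using g(2)[OF z] by simp
  qed
qed

text \<open>
  The Cauchy-Schwarz inequality bounds the energy of the partial sums, and Fatou's lemma that of the limit.
\<close>

lemma energy_series:
  assumes G: "\<And>k. G k holomorphic_on ball (0::complex) 1"
    and bd: "\<And>r. r < 1 \<Longrightarrow> \<exists>M. \<forall>k. \<forall>z. cmod z \<le> r \<longrightarrow> cmod (G k z) \<le> M"
    and c: "\<And>k::nat. cmod (c k) \<le> (1/3)^k"
    and en: "\<And>k. energy (deriv (G k)) \<le> ennreal M" and M: "0 \<le> M"
  shows "energy (deriv (\<lambda>z. \<Sum>k. c k * G k z)) < \<infinity>"
proof -
  define w :: "nat \<Rightarrow> real" where "w k = (1/3)^k" for k
  have w0: "0 \<le> w k" for k by (simp add: w_def)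
  have ws: "(\<Sum>k<N. w k) \<le> 3/2" for N
  proof -
    have "(\<Sum>k<N. w k) \<le> (\<Sum>k. w k)"
      unfolding w_def by (intro sum_le_suminf summable_geometric) auto
    then show ?thesis unfolding w_def by (simp add: suminf_geometric)
  qed
  define T where "T N z = (\<Sum>k<N. c k * deriv (G k) z)" for N z
  define E where "E k z = ennreal ((cmod (deriv (G k) z))\<^sup>2) * indicator (ball 0 1) z" for k z
  have Em: "E k \<in> borel_measurable lborel" for k
    unfolding E_def by (rule measurable_energy[OF deriv_continuous[OF G]])
  have ET: "energy (T N) \<le> ennreal (9/4 * M)" for N
  proof -
    have "energy (T N) \<le> (\<integral>\<^sup>+z. ennreal (3/2) * (\<Sum>k<N. ennreal (w k) * E k z) \<partial>lborel)"
      unfolding energy_def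
    proof (rule nn_integral_mono)
      fix z :: complex
      show "ennreal ((cmod (T N z))\<^sup>2) * indicator (ball 0 1) z \<le> ennreal (3/2) * (\<Sum>k<N. ennreal (w k) * E k z)"
      proof (cases "z \<in> ball 0 1")
        case True
        define x where "x k = cmod (deriv (G k) z)" for k
        have "cmod (T N z) \<le> (\<Sum>k<N. w k * x k)"
          unfolding T_def x_def w_def by (rule order_trans[OF norm_sum])
            (auto simp: norm_mult intro!: sum_mono mult_right_mono c)
        then have "(cmod (T N z))\<^sup>2 \<le> (\<Sum>k<N. w k * x k)\<^sup>2" by (rule power_mono) simp
        also have "\<dots> \<le> (\<Sum>k<N. w k) * (\<Sum>k<N. w k * (x k)\<^sup>2)" by (rule Cauchy_Schwarz_weighted[OF w0])
        also have "\<dots> \<le> 3/2 * (\<Sum>k<N. w k * (x k)\<^sup>2)"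
          by (intro mult_right_mono ws sum_nonneg mult_nonneg_nonneg w0) auto
        finally have "ennreal ((cmod (T N z))\<^sup>2) \<le> ennreal (3/2 * (\<Sum>k<N. w k * (x k)\<^sup>2))"
          by (rule ennreal_leI)
        also have "\<dots> = ennreal (3/2) * (\<Sum>k<N. ennreal (w k) * ennreal ((x k)\<^sup>2))"
          by (subst ennreal_mult) (auto simp: w0 sum_nonneg ennreal_mult[symmetric] intro!: sum_nonneg)
        finally show ?thesis using True by (simp add: E_def x_def)
      qed simp
    qed
    also have "\<dots> = ennreal (3/2) * (\<Sum>k<N. ennreal (w k) * energy (deriv (G k)))"
      using Em unfolding energy_def E_def[symmetric]
      by (simp add: nn_integral_cmult nn_integral_sum)
    also have "\<dots> \<le> ennreal (3/2) * (\<Sum>k<N. ennreal (w k) * ennreal M)"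
      by (intro mult_left_mono sum_mono en) auto
    also have "(\<Sum>k<N. ennreal (w k) * ennreal M) = ennreal ((\<Sum>k<N. w k) * M)"
      using w0 M by (simp add: ennreal_mult[symmetric] sum_distrib_right sum_ennreal)
    also have "ennreal (3/2) * ennreal ((\<Sum>k<N. w k) * M) = ennreal (3/2 * ((\<Sum>k<N. w k) * M))"
      using w0 M by (intro ennreal_mult[symmetric] mult_nonneg_nonneg sum_nonneg) auto
    also have "\<dots> \<le> ennreal (9/4 * M)"
      using mult_right_mono[OF ws M, of N] by (intro ennreal_leI) (simp add: mult_ac)
    finally show ?thesis .
  qed
  define S where "S = deriv (\<lambda>z. \<Sum>k. c k * G k z)"
  define F where "F N z = ennreal ((cmod (T N z))\<^sup>2) * indicator (ball 0 1) z" for N z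
  have Fm: "F N \<in> borel_measurable lborel" for N
    unfolding F_def T_def
    by (rule measurable_energy) (intro continuous_intros deriv_continuous G)
  have lim: "(\<lambda>N. F N z) \<longlonglongrightarrow> ennreal ((cmod (S z))\<^sup>2) * indicator (ball 0 1) z" for z
  proof (cases "z \<in> ball 0 1")
    case True
    have "(\<lambda>N. T N z) \<longlonglongrightarrow> S z"
      using holomorphic_series(3)[where G = G and c = c, OF G bd c True] unfolding sums_def T_def S_def .
    then have "(\<lambda>N. ennreal ((cmod (T N z))\<^sup>2)) \<longlonglongrightarrow> ennreal ((cmod (S z))\<^sup>2)"
      by (intro tendsto_ennrealI tendsto_intros)
    then show ?thesis using True by (simp add: F_def)
  qed (simp add: F_def)
  have "energy S = (\<integral>\<^sup>+z. liminf (\<lambda>N. F N z) \<partial>lborel)"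
    unfolding energy_def by (intro nn_integral_cong lim_imp_Liminf[symmetric] lim) simp
  also have "\<dots> \<le> liminf (\<lambda>N. \<integral>\<^sup>+z. F N z \<partial>lborel)"
    by (rule nn_integral_liminf[OF Fm])
  also have "\<dots> \<le> liminf (\<lambda>N. ennreal (9/4 * M))"
    by (rule Liminf_mono) (use ET in \<open>simp add: energy_def F_def\<close>)
  also have "\<dots> = ennreal (9/4 * M)" by (simp add: Liminf_const)
  finally show ?thesis unfolding S_def using ennreal_less_top le_less_trans by fastforce
qed

section \<open>The gliding hump\<close>

text \<open>
  This is the uniform boundedness principle in terms of scalars: \<open>a j e\<close> is the value of the functional
  \<open>j\<close> at the vector \<open>e\<close>, and the second assumption says that the functionals are pointwise bounded on the sums
  of rapidly convergent series of vectors from \<open>E\<close>. If the claim fails, choose functionals \<open>j k\<close> whose bounds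
  exceed \<open>4^k\<close> and vectors \<open>e k\<close> where they are nearly attained. Adding \<open>e k / 3^k\<close> with a suitable sign,
  the value of \<open>j k\<close> at the partial sum is at least that at \<open>e k / 3^k\<close>, and the remaining terms cannot
  compensate for it.
\<close>

lemma gliding_hump:
  fixes a :: "'j \<Rightarrow> 'e \<Rightarrow> complex"
  assumes bd: "\<And>j. j \<in> J \<Longrightarrow> \<exists>M. \<forall>e\<in>E. cmod (a j e) \<le> M"
    and ser: "\<And>x (c :: nat \<Rightarrow> complex). (\<And>k. x k \<in> E) \<Longrightarrow> (\<And>k. cmod (c k) \<le> (1/3)^k) \<Longrightarrow>
      \<exists>M. \<forall>j\<in>J. cmod (\<Sum>k. c k * a j (x k)) \<le> M"
  shows "\<exists>M. \<forall>j\<in>J. \<forall>e\<in>E. cmod (a j e) \<le> M"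
proof (rule ccontr)
  assume "\<not> ?thesis"
  then have unb: "\<exists>j\<in>J. \<exists>e\<in>E. M < cmod (a j e)" for M by (meson not_le)
  have "\<exists>j e S. j \<in> J \<and> e \<in> E \<and> 4^k < S \<and> (\<forall>e'\<in>E. cmod (a j e') \<le> S) \<and> 3/4 * S \<le> cmod (a j e)" for k :: nat
  proof -
    obtain j e0 where j: "j \<in> J" "e0 \<in> E" "4^k < cmod (a j e0)" using unb by blast
    define S where "S = (SUP e\<in>E. cmod (a j e))"
    have bdd: "bdd_above ((\<lambda>e. cmod (a j e)) ` E)"
      using bd[OF j(1)] by (auto simp: bdd_above_def)
    have S: "cmod (a j e) \<le> S" if "e \<in> E" for e
      unfolding S_def by (rule cSUP_upper[OF that bdd])
    have S4: "4^k < S" using S[OF j(2)] j(3) by linarith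
    have "(0::real) < 4^k" by simp
    then have "3/4 * S < S" using S4 by linarith
    then obtain e where "e \<in> E" "3/4 * S < cmod (a j e)"
      unfolding S_def using less_cSUP_iff[OF _ bdd] j(2) by blast
    then show ?thesis using j(1) S S4 less_imp_le by blast
  qed
  then obtain j e S where j: "\<And>k::nat. j k \<in> J" and e: "\<And>k. e k \<in> E" and S4: "\<And>k. 4^k < S k"
    and S: "\<And>k e'. e' \<in> E \<Longrightarrow> cmod (a (j k) e') \<le> S k" and near: "\<And>k. 3/4 * S k \<le> cmod (a (j k) (e k))"
    by metis
  have "\<exists>s. \<forall>k. cmod (s k) = 1 \<and>
    (1/3)^k * cmod (a (j k) (e k)) \<le> cmod ((\<Sum>i<k. s i * (1/3)^i * a (j k) (e i)) + s k * (1/3)^k * a (j k) (e k))"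
  proof (rule dependent_wellorder_choice)
    fix f g :: "nat \<Rightarrow> complex" and k r assume "\<And>y. y < k \<Longrightarrow> f y = g y"
    then show "(cmod r = 1 \<and> (1/3)^k * cmod (a (j k) (e k)) \<le> cmod ((\<Sum>i<k. f i * (1/3)^i * a (j k) (e i)) + r * (1/3)^k * a (j k) (e k))) =
      (cmod r = 1 \<and> (1/3)^k * cmod (a (j k) (e k)) \<le> cmod ((\<Sum>i<k. g i * (1/3)^i * a (j k) (e i)) + r * (1/3)^k * a (j k) (e k)))"
      by simp
  next
    fix k and f :: "nat \<Rightarrow> complex"
    define P where "P = (\<Sum>i<k. f i * (1/3)^i * a (j k) (e i))"
    define y where "y = (1/3)^k * a (j k) (e k)"
    have "2 * y = (P + y) - (P - y)" by simp
    then have "2 * cmod y \<le> cmod (P + y) + cmod (P - y)"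
      by (metis norm_triangle_ineq4 norm_mult norm_numeral)
    \<comment> \<open>One of the two signs does not decrease the modulus below that of y.\<close>
    then have "cmod y \<le> cmod (P + 1 * y) \<or> cmod y \<le> cmod (P + (-1) * y)" by auto
    then obtain r :: complex where "cmod r = 1" "cmod y \<le> cmod (P + r * y)"
      by (metis norm_minus_cancel norm_one)
    then show "\<exists>r. cmod r = 1 \<and> (1/3)^k * cmod (a (j k) (e k)) \<le> cmod ((\<Sum>i<k. f i * (1/3)^i * a (j k) (e i)) + r * (1/3)^k * a (j k) (e k))"
      unfolding P_def[symmetric] by (intro exI[of _ r]) (simp add: y_def norm_mult norm_power norm_divide mult.assoc)
  qed
  then obtain s where s1: "\<And>k. cmod (s k) = 1" and s: "\<And>k. (1/3)^k * cmod (a (j k) (e k)) \<le>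
      cmod ((\<Sum>i<k. s i * (1/3)^i * a (j k) (e i)) + s k * (1/3)^k * a (j k) (e k))" by blast
  define c where "c k = s k * (1/3)^k" for k
  have c: "cmod (c k) = (1/3)^k" for k by (simp add: c_def norm_mult norm_power norm_divide s1)
  obtain M where M: "\<And>k. cmod (\<Sum>i. c i * a (j k) (e i)) \<le> M"
    using ser[of e c] e c j by force
  have low: "(1/4) * (4/3)^k \<le> M" for k
  proof -
    define x where "x i = c i * a (j k) (e i)" for i
    have xb: "cmod (x i) \<le> (1/3)^i * S k" for i
      unfolding x_def norm_mult c by (intro mult_left_mono S e) simp
    have geo: "summable (\<lambda>i. (1/3)^i * S k)" by (intro summable_mult2 summable_geometric) simp
    have xs: "summable x" by (rule summable_comparison_test'[OF geo]) (use xb in auto)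
    have tail: "cmod (\<Sum>i. x (i + Suc k)) \<le> (1/3)^k * (1/2) * S k"
    proof -
      have sh: "summable (\<lambda>i. (1/3)^(i + Suc k) * S k)" using summable_ignore_initial_segment[OF geo] .
      have "cmod (\<Sum>i. x (i + Suc k)) \<le> (\<Sum>i. (1/3)^(i + Suc k) * S k)"
        by (rule norm_suminf_le[OF xb sh])
      also have "(\<lambda>i. (1/3)^(i + Suc k) * S k) = (\<lambda>i. (1/3)^i * ((1/3)^Suc k * S k))"
        by (simp add: power_add mult_ac)
      also have "(\<Sum>i. (1/3)^i * ((1/3)^Suc k * S k)) = (\<Sum>i. (1/3::real)^i) * ((1/3)^Suc k * S k)"
        by (rule suminf_mult2[symmetric]) (simp add: summable_geometric)
      also have "\<dots> = (1/3)^k * (1/2) * S k" by (simp add: suminf_geometric)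
      finally show ?thesis .
    qed
    have "(\<Sum>i. x i) = (\<Sum>i. x (i + Suc k)) + (\<Sum>i<Suc k. x i)"
      by (rule suminf_split_initial_segment[OF xs])
    then have "(\<Sum>i<Suc k. x i) = (\<Sum>i. x i) - (\<Sum>i. x (i + Suc k))" by simp
    then have "cmod (\<Sum>i<Suc k. x i) \<le> M + (1/3)^k * (1/2) * S k"
      using norm_triangle_ineq4[of "\<Sum>i. x i" "\<Sum>i. x (i + Suc k)"] M[of k] tail by (simp add: x_def)
    moreover have "(1/3)^k * (3/4 * S k) \<le> cmod (\<Sum>i<Suc k. x i)"
    proof -
      have "(1/3)^k * (3/4 * S k) \<le> (1/3)^k * cmod (a (j k) (e k))" by (intro mult_left_mono near) simp
      also have "\<dots> \<le> cmod (\<Sum>i<Suc k. x i)" using s[of k] by (simp add: x_def c_def)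
      finally show ?thesis .
    qed
    ultimately have "(1/4) * ((1/3)^k * S k) \<le> M" by (simp add: algebra_simps)
    moreover have "(4/3::real)^k = (1/3)^k * 4^k" by (simp add: power_divide)
    moreover have "(1/3)^k * 4^k \<le> (1/3)^k * S k" using S4[of k] by (intro mult_left_mono) auto
    ultimately show ?thesis by linarith
  qed
  obtain k where "4 * M < (4/3::real)^k" using real_arch_pow[of "4/3" "4 * M"] by auto
  with low[of k] show False by linarith
qed

section \<open>Derivatives of bounded Dirichlet multipliers\<close>

lemma norm_Ln_le:
  assumes "w \<noteq> 0"
  shows "cmod (Ln w) \<le> \<bar>ln (cmod w)\<bar> + pi"
proof -
  have "cmod (Ln w) \<le> \<bar>Re (Ln w)\<bar> + \<bar>Im (Ln w)\<bar>" by (rule cmod_le)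
  also have "\<bar>Im (Ln w)\<bar> \<le> pi" using mpi_less_Im_Ln[OF assms] Im_Ln_le_pi[OF assms] by linarith
  finally show ?thesis using assms by (simp add: Re_Ln)
qed

lemma circle_dist_ge: "cmod \<zeta> = 1 \<Longrightarrow> 1 - cmod z \<le> cmod (z - \<zeta>)"
  using norm_triangle_ineq2[of \<zeta> z] by (simp add: norm_minus_commute)

lemma loglog_bound:
  assumes \<zeta>: "cmod \<zeta> = 1" and z: "z \<in> ball 0 1"
  shows "cmod (loglog \<zeta> z) \<le> 3 - ln (1 - cmod z) + 2 * pi"
proof -
  define w where "w = 1 - cnj \<zeta> * z"
  define v where "v = 2 - Ln w"
  have w: "0 < Re w" unfolding w_def by (rule Re_one_minus_pos[OF assms])
  then have w0: "w \<noteq> 0" by auto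
  have v1: "1 \<le> Re v" using loglog_inner[OF assms] by (simp add: v_def w_def)
  then have v2: "1 \<le> cmod v" using complex_Re_le_cmod[of v] by linarith
  have cw: "cmod w = cmod (z - \<zeta>)" using circle_dist[OF \<zeta>] by (simp add: w_def)
  have lo: "ln (1 - cmod z) \<le> ln (cmod w)"
    using circle_dist_ge[OF \<zeta>, of z] z unfolding cw by (subst ln_le_cancel_iff) auto
  have "ln (cmod w) \<le> 1" using loglog_inner(2)[OF assms] unfolding cw by linarith
  moreover have "ln (1 - cmod z) \<le> 0" using z by simp
  ultimately have "\<bar>ln (cmod w)\<bar> \<le> 1 - ln (1 - cmod z)" using lo by linarith
  then have "cmod v \<le> 3 - ln (1 - cmod z) + pi"
    using norm_Ln_le[OF w0] norm_triangle_ineq4[of 2 "Ln w"] by (simp add: v_def)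
  moreover have "cmod (Ln v) \<le> \<bar>ln (cmod v)\<bar> + pi" using v2 by (intro norm_Ln_le) auto
  moreover have "\<bar>ln (cmod v)\<bar> \<le> cmod v"
  proof -
    have "ln (cmod v) \<le> cmod v - 1" by (rule ln_le_minus_one) (use v2 in linarith)
    then show ?thesis using ln_ge_zero[OF v2] by linarith
  qed
  ultimately show ?thesis by (simp add: loglog_def v_def w_def)
qed

lemma loglog_deriv_le:
  assumes \<zeta>: "cmod \<zeta> = 1" and z: "z \<in> ball 0 1"
  shows "cmod (deriv (loglog \<zeta>) z) * (1 - cmod z) \<le> 1"
proof -
  have d: "0 < 1 - cmod z" "1 - cmod z \<le> cmod (z - \<zeta>)" using z circle_dist_ge[OF \<zeta>] by auto
  have "cmod (deriv (loglog \<zeta>) z) \<le> 1 / (cmod (z - \<zeta>) * (2 - ln (cmod (z - \<zeta>))))"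
    by (rule loglog_deriv_bound[OF assms])
  also have "\<dots> \<le> 1 / ((1 - cmod z) * 1)"
    using d loglog_inner(2)[OF assms] by (intro divide_left_mono mult_mono mult_pos_pos) auto
  finally show ?thesis using d by (simp add: field_simps)
qed

abbreviation "D_mult \<equiv> Mult (ball 0 1) dirichlet_space"

lemma D_mult_mem: "h \<in> D_mult \<Longrightarrow> h \<in> dirichlet_space"
proof -
  assume h: "h \<in> D_mult"
  have "(\<lambda>z. h z * disc_restrict (\<lambda>z. 1) z) \<in> dirichlet_space"
    using h dirichlet_one[OF refl] by (simp add: Mult_def)
  moreover have "(\<lambda>z. h z * disc_restrict (\<lambda>z. 1) z) = h"
    using h by (auto simp: Mult_def funs_on_def disc_restrict_def fun_eq_iff)
  ultimately show ?thesis by simp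
qed

lemma dirichlet_hol: "f \<in> dirichlet_space \<Longrightarrow> f holomorphic_on ball 0 1"
  by (simp add: dirichlet_space_iff)

lemma D_mult_hol: "h \<in> D_mult \<Longrightarrow> h holomorphic_on ball 0 1"
  by (rule dirichlet_hol[OF D_mult_mem])

lemma deriv_mult_disc:
  assumes "f holomorphic_on ball 0 1" "g holomorphic_on ball 0 1" "z \<in> ball 0 1"
  shows "deriv (\<lambda>z. f z * g z) z = deriv f z * g z + f z * deriv g z"
  by (rule DERIV_imp_deriv) (use DERIV_mult[OF deriv_at[OF assms(1,3)] deriv_at[OF assms(2,3)]] in \<open>simp add: mult.commute add.commute\<close>)

lemma loglog_locally_bounded:
  assumes "r < 1"
  shows "\<exists>M. \<forall>\<zeta> z. cmod \<zeta> = 1 \<longrightarrow> cmod z \<le> r \<longrightarrow> cmod (loglog \<zeta> z) \<le> M"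
proof -
  have "cmod (loglog \<zeta> z) \<le> 3 - ln (1 - r) + 2 * pi" if "cmod \<zeta> = 1" "cmod z \<le> r" for \<zeta> z
  proof -
    have "ln (1 - r) \<le> ln (1 - cmod z)" using that assms by (subst ln_le_cancel_iff) auto
    moreover have "cmod (loglog \<zeta> z) \<le> 3 - ln (1 - cmod z) + 2 * pi"
      by (rule loglog_bound) (use that assms in auto)
    ultimately show ?thesis by linarith
  qed
  then show ?thesis by blast
qed

lemma cmod_one_minus: "z \<in> ball 0 1 \<Longrightarrow> cmod (1 - complex_of_real (cmod z)) = 1 - cmod z"
proof -
  assume "z \<in> ball 0 1"
  moreover have "1 - complex_of_real (cmod z) = of_real (1 - cmod z)" by simp
  ultimately show ?thesis by (simp only: norm_of_real) simp
qed

text \<open>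
  For one \<open>\<zeta>\<close> this is \<open>dirichlet_deriv_bound\<close> for the product of \<open>h\<close> and \<open>loglog \<zeta>\<close>. It is uniform in \<open>\<zeta>\<close> because
  sums of these functions with summable coefficients are in the Dirichlet space as well.
\<close>

lemma multiplier_loglog_bound:
  assumes h: "h \<in> D_mult"
  shows "\<exists>M. \<forall>z\<in>ball 0 1. \<forall>\<zeta>\<in>sphere 0 1.
    cmod (of_real (1 - cmod z) * deriv (\<lambda>w. h w * loglog \<zeta> w) z) \<le> M"
proof (rule gliding_hump)
  note hol = D_mult_hol[OF h]
  fix z :: complex assume z: "z \<in> ball 0 1"
  have "cmod (of_real (1 - cmod z) * deriv (\<lambda>w. h w * loglog \<zeta> w) z) \<le>
    1 * (cmod (deriv h z) * (3 - ln (1 - cmod z) + 2 * pi)) + cmod (h z) * 1"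
    if \<zeta>: "\<zeta> \<in> sphere 0 1" for \<zeta>
  proof -
    have \<zeta>1: "cmod \<zeta> = 1" using \<zeta> by simp
    have z1: "0 \<le> 1 - cmod z" "1 - cmod z \<le> 1" using z by auto
    have "of_real (1 - cmod z) * deriv (\<lambda>w. h w * loglog \<zeta> w) z =
      of_real (1 - cmod z) * (deriv h z * loglog \<zeta> z) + h z * (of_real (1 - cmod z) * deriv (loglog \<zeta>) z)"
      unfolding deriv_mult_disc[OF hol loglog_hol[OF \<zeta>1] z] by (simp add: algebra_simps)
    also have "cmod \<dots> \<le> (1 - cmod z) * (cmod (deriv h z) * cmod (loglog \<zeta> z)) + cmod (h z) * ((1 - cmod z) * cmod (deriv (loglog \<zeta>) z))"
      by (rule order_trans[OF norm_triangle_ineq]) (simp add: norm_mult cmod_one_minus[OF z])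
    also have "\<dots> \<le> 1 * (cmod (deriv h z) * (3 - ln (1 - cmod z) + 2 * pi)) + cmod (h z) * 1"
      using z1 loglog_bound[OF \<zeta>1 z] loglog_deriv_le[OF \<zeta>1 z]
      by (intro add_mono mult_mono mult_left_mono) (auto simp: mult.commute)
    finally show ?thesis .
  qed
  then show "\<exists>M. \<forall>\<zeta>\<in>sphere 0 1. cmod (of_real (1 - cmod z) * deriv (\<lambda>w. h w * loglog \<zeta> w) z) \<le> M" by blast
next
  note hol = D_mult_hol[OF h]
  fix x :: "nat \<Rightarrow> complex" and c :: "nat \<Rightarrow> complex"
  assume x: "\<And>k. x k \<in> sphere 0 1" and c: "\<And>k. cmod (c k) \<le> (1/3)^k"
  have x1: "cmod (x k) = 1" for k using x[of k] by simp
  define G where "G k = loglog (x k)" for k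
  have G: "G k holomorphic_on ball 0 1" for k unfolding G_def by (rule loglog_hol[OF x1])
  have bdG: "\<exists>M. \<forall>k. \<forall>z. cmod z \<le> r \<longrightarrow> cmod (G k z) \<le> M" if "r < 1" for r
    using loglog_locally_bounded[OF that] x1 unfolding G_def by blast
  have hs1: "(\<lambda>z. \<Sum>k. c k * G k z) holomorphic_on ball 0 1"
    by (rule holomorphic_series(1)[OF G bdG c])
  have hs2: "(\<lambda>k. c k * G k z) sums (\<Sum>k. c k * G k z)" if "z \<in> ball 0 1" for z
    by (rule holomorphic_series(2)[OF G bdG c that])
  have hs3: "(\<lambda>k. c k * deriv (G k) z) sums deriv (\<lambda>z. \<Sum>k. c k * G k z) z" if "z \<in> ball 0 1" for z
    by (rule holomorphic_series(3)[OF G bdG c that])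
  obtain K where K: "0 \<le> K" "\<And>\<zeta>. cmod \<zeta> = 1 \<Longrightarrow> energy (deriv (loglog \<zeta>)) \<le> ennreal K"
    using loglog_energy by blast
  have en: "energy (deriv (\<lambda>z. \<Sum>k. c k * G k z)) < \<infinity>"
    by (rule energy_series[where M = K, OF G bdG c _ K(1)]) (simp_all add: G_def K(2) x1)
  define f where "f = (\<lambda>z. \<Sum>k. c k * G k z)"
  have "disc_restrict f \<in> dirichlet_space"
    unfolding f_def using en by (subst disc_restrict_dirichlet_iff[OF hs1])
  then have "(\<lambda>z. h z * disc_restrict f z) \<in> dirichlet_space" using h by (simp add: Mult_def)
  then obtain C where C: "\<And>z. z \<in> ball 0 1 \<Longrightarrow> cmod (deriv (\<lambda>z. h z * disc_restrict f z) z) * (1 - cmod z) \<le> C"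
    using dirichlet_deriv_bound by blast
  have "cmod (\<Sum>k. c k * (of_real (1 - cmod z) * deriv (\<lambda>w. h w * loglog (x k) w) z)) \<le> C" if z: "z \<in> ball 0 1" for z
  proof -
    have fh: "f holomorphic_on ball 0 1" unfolding f_def by (rule hs1)
    have "deriv (\<lambda>z. h z * disc_restrict f z) z = deriv (\<lambda>z. h z * f z) z"
      by (rule deriv_cong_disc[OF _ z]) (simp add: disc_restrict_def)
    also have "\<dots> = deriv h z * f z + h z * deriv f z" by (rule deriv_mult_disc[OF hol fh z])
    finally have d: "deriv (\<lambda>z. h z * disc_restrict f z) z = deriv h z * f z + h z * deriv f z" .
    have "(\<lambda>k. of_real (1 - cmod z) * (deriv h z * (c k * G k z) + h z * (c k * deriv (G k) z)))
        sums (of_real (1 - cmod z) * (deriv h z * f z + h z * deriv f z))"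
      unfolding f_def by (intro sums_mult sums_add hs2[OF z] hs3[OF z])
    then have "(\<lambda>k. c k * (of_real (1 - cmod z) * deriv (\<lambda>w. h w * loglog (x k) w) z))
        sums (of_real (1 - cmod z) * (deriv h z * f z + h z * deriv f z))"
      by (simp add: deriv_mult_disc[OF hol G[unfolded G_def] z] G_def algebra_simps)
    then have "(\<Sum>k. c k * (of_real (1 - cmod z) * deriv (\<lambda>w. h w * loglog (x k) w) z)) =
       of_real (1 - cmod z) * deriv (\<lambda>z. h z * disc_restrict f z) z"
      unfolding d by (simp add: sums_iff)
    then show ?thesis using C[OF z] by (simp add: norm_mult mult.commute cmod_one_minus[OF z])
  qed
  then show "\<exists>M. \<forall>z\<in>ball 0 1. cmod (\<Sum>k. c k * (of_real (1 - cmod z) * deriv (\<lambda>w. h w * loglog (x k) w) z)) \<le> M"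
    by blast
qed

text \<open>
  The value of \<open>loglog \<zeta>\<close> at \<open>r * \<zeta>\<close>.
\<close>

definition loglog_radial :: "real \<Rightarrow> real" where "loglog_radial r = ln (2 - ln (1 - r))"

text \<open>
  Multiply \<open>h\<close> by the iterated logarithm with singularity at the endpoint of the radius through \<open>z\<close>. The product
  rule isolates \<open>deriv h z\<close> with a factor that tends to infinity at the boundary.
\<close>

lemma bounded_multiplier_deriv:
  assumes h: "h \<in> D_mult" and B: "\<And>z. z \<in> ball 0 1 \<Longrightarrow> cmod (h z) \<le> B"
  shows "\<exists>M. \<forall>z\<in>ball 0 1. cmod (deriv h z) * (1 - cmod z) * loglog_radial (cmod z) \<le> M"
proof -
  note hol = D_mult_hol[OF h]
  obtain M where M: "\<And>z \<zeta>. z \<in> ball 0 1 \<Longrightarrow> \<zeta> \<in> sphere 0 1 \<Longrightarrow>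
    cmod (of_real (1 - cmod z) * deriv (\<lambda>w. h w * loglog \<zeta> w) z) \<le> M"
    using multiplier_loglog_bound[OF h] by blast
  have "cmod (deriv h z) * (1 - cmod z) * loglog_radial (cmod z) \<le> M + B" if z: "z \<in> ball 0 1" for z
  proof -
    \<comment> \<open>At the origin every boundary point will do.\<close>
    define \<zeta> where "\<zeta> = (if z = 0 then 1 else sgn z)"
    have \<zeta>: "cmod \<zeta> = 1" by (simp add: \<zeta>_def norm_sgn)
    have cz: "cnj \<zeta> * z = of_real (cmod z)"
    proof (cases "z = 0")
      case False
      have "cnj z * z = of_real ((cmod z)\<^sup>2)" by (metis complex_norm_square mult.commute)
      then show ?thesis using False by (simp add: \<zeta>_def sgn_eq power2_eq_square)
    qed simp
    have z1: "0 < 1 - cmod z" using z by simp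
    have ll1: "ln (1 - cmod z) \<le> 0" using z by simp
    have "Ln (1 - cnj \<zeta> * z) = of_real (ln (1 - cmod z))"
      unfolding cz using Ln_of_real[OF z1] by simp
    then have "loglog \<zeta> z = Ln (of_real (2 - ln (1 - cmod z)))" by (simp add: loglog_def)
    also have "\<dots> = of_real (loglog_radial (cmod z))" unfolding loglog_radial_def using ll1 by (intro Ln_of_real) linarith
    finally have L: "loglog \<zeta> z = of_real (loglog_radial (cmod z))" .
    have lpos: "0 \<le> loglog_radial (cmod z)" unfolding loglog_radial_def using ll1 by (intro ln_ge_zero) linarith
    have "cmod (deriv h z) * (1 - cmod z) * loglog_radial (cmod z) = cmod (of_real (1 - cmod z) * (deriv h z * loglog \<zeta> z))"
      unfolding L using z1 lpos by (simp add: norm_mult cmod_one_minus[OF z])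
    also have "of_real (1 - cmod z) * (deriv h z * loglog \<zeta> z) =
       of_real (1 - cmod z) * deriv (\<lambda>w. h w * loglog \<zeta> w) z - h z * (of_real (1 - cmod z) * deriv (loglog \<zeta>) z)"
      unfolding deriv_mult_disc[OF hol loglog_hol[OF \<zeta>] z] by (simp add: algebra_simps)
    also have "cmod \<dots> \<le> M + cmod (h z) * (cmod (deriv (loglog \<zeta>) z) * (1 - cmod z))"
      by (rule order_trans[OF norm_triangle_ineq4]) (use M[OF z, of \<zeta>] \<zeta> in \<open>simp add: norm_mult mult_ac cmod_one_minus[OF z]\<close>)
    also have "cmod (h z) * (cmod (deriv (loglog \<zeta>) z) * (1 - cmod z)) \<le> B * 1"
      using B[OF z] loglog_deriv_le[OF \<zeta> z] z1 by (intro mult_mono) (auto intro: order_trans[OF norm_ge_zero])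
    finally show ?thesis by simp
  qed
  then show ?thesis by blast
qed

section \<open>A family of test multipliers\<close>

text \<open>
  The derivative may have a singularity at one boundary point that is slightly weaker than that of a
  logarithm. The small gain \<open>\<eta>\<close> absorbs the growth of Dirichlet functions, so these functions are multipliers
  with uniform bounds.
\<close>

definition test_fun :: "real \<Rightarrow> (complex \<Rightarrow> complex) \<Rightarrow> bool" where
  "test_fun \<eta> \<phi> \<longleftrightarrow> \<phi> holomorphic_on ball 0 1 \<and> (\<forall>z\<in>ball 0 1. cmod (\<phi> z) \<le> 1) \<and>
     (\<exists>\<zeta>. cmod \<zeta> = 1 \<and> (\<forall>z\<in>ball 0 1. cmod (deriv \<phi> z) \<le> cmod (z - \<zeta>) powr (\<eta> - 1)))"

text \<open>
  Here \<open>A\<close> and \<open>B\<close> stand for the reciprocal distances to a boundary point and to the circle. Powers of either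
  on the right-hand side are integrable over the disc.
\<close>

lemma young_split:
  fixes A B \<eta> :: real
  assumes A: "0 < A" and B: "1 \<le> B" and \<eta>: "0 < \<eta>" "\<eta> \<le> 1"
  shows "A powr (2 - 2 * \<eta>) * B powr (\<eta> / 4) \<le> A powr (2 - \<eta>) + B powr (1/2)"
proof (cases "B powr (\<eta> / 4) \<le> A powr \<eta>")
  case True
  then have "A powr (2 - 2 * \<eta>) * B powr (\<eta> / 4) \<le> A powr (2 - 2 * \<eta>) * A powr \<eta>"
    by (intro mult_left_mono) auto
  also have "\<dots> = A powr (2 - \<eta>)" by (simp flip: powr_add)
  finally show ?thesis using powr_ge_zero[of B "1/2"] by linarith
next
  case False
  have "A = (A powr \<eta>) powr (1/\<eta>)" using A \<eta> by (simp add: powr_powr)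
  also have "\<dots> \<le> (B powr (\<eta> / 4)) powr (1/\<eta>)" using False \<eta> by (intro powr_mono2) auto
  also have "\<dots> = B powr (1/4)" using \<eta> by (simp add: powr_powr)
  finally have "A powr (2 - 2 * \<eta>) \<le> (B powr (1/4)) powr (2 - 2 * \<eta>)"
    using A \<eta> by (intro powr_mono2) auto
  also have "\<dots> = B powr (1/2 - \<eta>/2)" by (simp add: powr_powr algebra_simps diff_divide_distrib)
  finally have "A powr (2 - 2 * \<eta>) * B powr (\<eta> / 4) \<le> B powr (1/2 - \<eta>/2) * B powr (\<eta> / 4)"
    by (intro mult_right_mono) auto
  also have "\<dots> = B powr (1/2 - \<eta>/4)" by (simp flip: powr_add)
  also have "\<dots> \<le> B powr (1/2)" using B \<eta> by (intro powr_mono) auto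
  finally show ?thesis using powr_ge_zero[of A "2 - \<eta>"] by linarith
qed

text \<open>
  In the derivative of the product the term \<open>\<phi> * deriv f\<close> is harmless. The square of the other term is bounded with
  \<open>dirichlet_growth\<close> and \<open>young_split\<close>.
\<close>

lemma test_fun_energy:
  assumes f: "f \<in> dirichlet_space" and \<eta>: "0 < \<eta>" "\<eta> \<le> 1"
  shows "\<exists>M\<ge>0. \<forall>\<phi>. test_fun \<eta> \<phi> \<longrightarrow> energy (deriv (\<lambda>z. \<phi> z * f z)) \<le> ennreal M"
proof -
  have fh: "f holomorphic_on ball 0 1" and fe: "energy (deriv f) < \<infinity>" using f by (auto simp: dirichlet_space_iff)
  obtain I where I: "0 \<le> I" "energy (deriv f) = ennreal I" using fe by (cases "energy (deriv f)") auto
  obtain C where C: "0 \<le> C" "\<And>z. z \<in> ball 0 1 \<Longrightarrow> cmod (f z) \<le> C * (1 - cmod z) powr (- (\<eta> / 8))"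
    using dirichlet_growth[OF f, of "\<eta> / 8"] \<eta> by auto
  obtain K where K: "0 \<le> K" "\<And>\<zeta>. cmod \<zeta> = 1 \<Longrightarrow>
    (\<integral>\<^sup>+z. ennreal (cmod (z - \<zeta>) powr (\<eta> - 2)) * indicator (ball (0::complex) 1) z \<partial>lborel) \<le> ennreal K"
    using boundary_power_integral[OF \<eta>] by blast
  obtain R where R: "0 \<le> R" "(\<integral>\<^sup>+z. ennreal ((1 - cmod z) powr (-1/2)) * indicator (ball (0::complex) 1) z \<partial>lborel) = ennreal R"
    using radial_integral_finite by (cases "\<integral>\<^sup>+z. ennreal ((1 - cmod z) powr (-1/2)) * indicator (ball (0::complex) 1) z \<partial>lborel") auto
  have "energy (deriv (\<lambda>z. \<phi> z * f z)) \<le> ennreal (2 * (C\<^sup>2 * (K + R)) + 2 * I)" if \<phi>: "test_fun \<eta> \<phi>" for \<phi>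
  proof -
    have ph: "\<phi> holomorphic_on ball 0 1" and p1: "\<And>z. z \<in> ball 0 1 \<Longrightarrow> cmod (\<phi> z) \<le> 1"
      using \<phi> by (auto simp: test_fun_def)
    obtain \<zeta> where \<zeta>: "cmod \<zeta> = 1" and pd: "\<And>z. z \<in> ball 0 1 \<Longrightarrow> cmod (deriv \<phi> z) \<le> cmod (z - \<zeta>) powr (\<eta> - 1)"
      using \<phi> by (auto simp: test_fun_def)
    have pos: "0 < cmod (z - \<zeta>)" if "z \<in> ball 0 1" for z using that \<zeta> by auto
    define g where "g z = deriv \<phi> z * f z" for z
    have gc: "continuous_on (ball 0 1) g" unfolding g_def
      by (intro continuous_intros deriv_continuous ph holomorphic_on_imp_continuous_on fh)
    have ms: "(\<lambda>z. ennreal (cmod (z - \<zeta>) powr (\<eta> - 2)) * indicator (ball (0::complex) 1) z) \<in> borel_measurable lborel"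
      by (rule measurable_on_disc) (use pos in \<open>auto intro!: continuous_intros simp del: mem_ball\<close>)
    have mr: "(\<lambda>z. ennreal ((1 - cmod z) powr (-1/2)) * indicator (ball (0::complex) 1) z) \<in> borel_measurable lborel"
      by (rule measurable_on_disc) (auto intro!: continuous_intros)
    have gb: "(cmod (g z))\<^sup>2 \<le> C\<^sup>2 * (cmod (z - \<zeta>) powr (\<eta> - 2) + (1 - cmod z) powr (-1/2))" if z: "z \<in> ball 0 1" for z
    proof -
      define A where "A = 1 / cmod (z - \<zeta>)"
      define B where "B = 1 / (1 - cmod z)"
      have A: "0 < A" using pos[OF z] by (simp add: A_def)
      have z1: "0 < 1 - cmod z" "1 - cmod z \<le> 1" using z by auto
      have B: "1 \<le> B" using z1 by (simp add: B_def)
      have pw: "cmod (z - \<zeta>) powr t = A powr (- t)" "(1 - cmod z) powr t = B powr (- t)" for t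
        using pos[OF z] z1 by (simp_all add: A_def B_def powr_minus powr_divide inverse_eq_divide)
      have "cmod (g z) \<le> A powr (1 - \<eta>) * (C * B powr (\<eta> / 8))"
        unfolding g_def norm_mult using pd[OF z] C(2)[OF z] by (intro mult_mono) (auto simp: pw)
      then have "(cmod (g z))\<^sup>2 \<le> (A powr (1 - \<eta>) * (C * B powr (\<eta> / 8)))\<^sup>2" by (rule power_mono) simp
      also have "\<dots> = C\<^sup>2 * (A powr (2 - 2 * \<eta>) * B powr (\<eta> / 4))"
        by (simp add: power2_eq_square mult_ac powr_add[symmetric])
      also have "\<dots> \<le> C\<^sup>2 * (A powr (2 - \<eta>) + B powr (1/2))"
        by (intro mult_left_mono young_split A B \<eta>) auto
      finally show ?thesis by (simp add: pw)
    qed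
    have "energy g \<le> (\<integral>\<^sup>+z. ennreal (C\<^sup>2) * (ennreal (cmod (z - \<zeta>) powr (\<eta> - 2)) * indicator (ball 0 1) z +
        ennreal ((1 - cmod z) powr (-1/2)) * indicator (ball 0 1) z) \<partial>lborel)"
      unfolding energy_def
    proof (rule nn_integral_mono)
      fix z :: complex
      show "ennreal ((cmod (g z))\<^sup>2) * indicator (ball 0 1) z \<le> ennreal (C\<^sup>2) * (ennreal (cmod (z - \<zeta>) powr (\<eta> - 2)) * indicator (ball 0 1) z +
        ennreal ((1 - cmod z) powr (-1/2)) * indicator (ball 0 1) z)"
      proof (cases "z \<in> ball 0 1")
        case True
        have "ennreal ((cmod (g z))\<^sup>2) \<le> ennreal (C\<^sup>2 * (cmod (z - \<zeta>) powr (\<eta> - 2) + (1 - cmod z) powr (-1/2)))"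
          by (rule ennreal_leI[OF gb[OF True]])
        also have "\<dots> = ennreal (C\<^sup>2) * (ennreal (cmod (z - \<zeta>) powr (\<eta> - 2)) + ennreal ((1 - cmod z) powr (-1/2)))"
          by (subst ennreal_mult) (auto simp: ennreal_plus)
        finally show ?thesis using True by simp
      qed simp
    qed
    also have "\<dots> = ennreal (C\<^sup>2) * ((\<integral>\<^sup>+z. ennreal (cmod (z - \<zeta>) powr (\<eta> - 2)) * indicator (ball 0 1) z \<partial>lborel) +
        (\<integral>\<^sup>+z. ennreal ((1 - cmod z) powr (-1/2)) * indicator (ball 0 1) z \<partial>lborel))"
      using ms mr by (subst nn_integral_cmult) (auto simp: nn_integral_add)
    also have "\<dots> \<le> ennreal (C\<^sup>2) * (ennreal K + ennreal R)"
      unfolding R(2) by (intro mult_left_mono add_mono K(2)[OF \<zeta>]) auto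
    also have "\<dots> = ennreal (C\<^sup>2 * (K + R))" using K(1) R(1) by (simp add: ennreal_mult ennreal_plus)
    finally have ge: "energy g \<le> ennreal (C\<^sup>2 * (K + R))" .
    have "energy (deriv (\<lambda>z. \<phi> z * f z)) \<le> 2 * energy g + 2 * energy (deriv f)"
    proof (rule energy_le_sum2[OF gc deriv_continuous[OF fh]])
      fix z :: complex assume z: "z \<in> ball 0 1"
      have "cmod (\<phi> z * deriv f z) \<le> 1 * cmod (deriv f z)"
        unfolding norm_mult by (intro mult_right_mono p1[OF z]) auto
      then show "cmod (deriv (\<lambda>z. \<phi> z * f z) z) \<le> cmod (g z) + cmod (deriv f z)"
        unfolding deriv_mult_disc[OF ph fh z] g_def using norm_triangle_ineq[of "deriv \<phi> z * f z" "\<phi> z * deriv f z"] by linarith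
    qed
    also have "\<dots> \<le> 2 * ennreal (C\<^sup>2 * (K + R)) + 2 * ennreal I"
      unfolding I(2) by (intro add_mono mult_left_mono ge) auto
    also have "\<dots> = ennreal (2 * (C\<^sup>2 * (K + R)) + 2 * I)"
      using K(1) R(1) I(1) by (simp add: ennreal_plus ennreal_mult)
    finally show ?thesis .
  qed
  moreover have "0 \<le> 2 * (C\<^sup>2 * (K + R)) + 2 * I" using K(1) R(1) I(1) by simp
  ultimately show ?thesis by blast
qed

lemma test_fun_series_multiplier:
  assumes x: "\<And>k. test_fun \<eta> (x k)" and c: "\<And>k::nat. cmod (c k) \<le> (1/3)^k" and \<eta>: "0 < \<eta>" "\<eta> \<le> 1"
  shows "disc_restrict (\<lambda>z. \<Sum>k. c k * x k z) \<in> D_mult"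
    and "\<And>z. z \<in> ball 0 1 \<Longrightarrow> (\<lambda>k. c k * x k z) sums (\<Sum>k. c k * x k z)"
proof -
  have xh: "x k holomorphic_on ball 0 1" and x1: "\<And>z. z \<in> ball 0 1 \<Longrightarrow> cmod (x k z) \<le> 1" for k
    using x[of k] by (auto simp: test_fun_def)
  have bdx: "\<exists>M. \<forall>k. \<forall>z. cmod z \<le> r \<longrightarrow> cmod (x k z) \<le> M" if "r < 1" for r
    using x1 that by (intro exI[of _ 1]) auto
  show sm: "(\<lambda>k. c k * x k z) sums (\<Sum>k. c k * x k z)" if "z \<in> ball 0 1" for z
    by (rule holomorphic_series(2)[OF xh bdx c that])
  show "disc_restrict (\<lambda>z. \<Sum>k. c k * x k z) \<in> D_mult"
    unfolding Mult_def
  proof (intro CollectI conjI ballI)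
    show "disc_restrict (\<lambda>z. \<Sum>k. c k * x k z) \<in> funs_on (ball 0 1)" by (simp add: disc_restrict_def funs_on_def)
    fix f assume f: "f \<in> dirichlet_space"
    have fh: "f holomorphic_on ball 0 1" by (rule dirichlet_hol[OF f])
    define G where "G k z = x k z * f z" for k z
    have G: "G k holomorphic_on ball 0 1" for k unfolding G_def by (intro holomorphic_intros xh fh)
    have bdG: "\<exists>M. \<forall>k. \<forall>z. cmod z \<le> r \<longrightarrow> cmod (G k z) \<le> M" if r: "r < 1" for r
    proof -
      have "compact (f ` cball 0 r)"
        using r by (intro compact_continuous_image continuous_on_subset[OF holomorphic_on_imp_continuous_on[OF fh]]) auto
      then obtain M where M: "\<And>z. cmod z \<le> r \<Longrightarrow> cmod (f z) \<le> M"
        using compact_imp_bounded bounded_iff by (metis (no_types, lifting) imageI mem_cball_0)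
      have "cmod (G k z) \<le> M" if z: "cmod z \<le> r" for k z
      proof -
        have "cmod (x k z) * cmod (f z) \<le> 1 * cmod (f z)" using x1[of z k] z r by (intro mult_right_mono) auto
        then show ?thesis using M[OF z] by (simp add: G_def norm_mult)
      qed
      then show ?thesis by blast
    qed
    obtain M where M: "0 \<le> M" "\<And>\<phi>. test_fun \<eta> \<phi> \<Longrightarrow> energy (deriv (\<lambda>z. \<phi> z * f z)) \<le> ennreal M"
      using test_fun_energy[OF f \<eta>] by blast
    have "energy (deriv (\<lambda>z. \<Sum>k. c k * G k z)) < \<infinity>"
      by (rule energy_series[where M = M, OF G bdG c _ M(1)]) (simp_all add: G_def[abs_def] M(2) x)
    moreover have hs1: "(\<lambda>z. \<Sum>k. c k * G k z) holomorphic_on ball 0 1"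
      by (rule holomorphic_series(1)[OF G bdG c])
    ultimately have "disc_restrict (\<lambda>z. \<Sum>k. c k * G k z) \<in> dirichlet_space"
      by (subst disc_restrict_dirichlet_iff[OF hs1])
    moreover have "(\<lambda>z. disc_restrict (\<lambda>z. \<Sum>k. c k * x k z) z * f z) = disc_restrict (\<lambda>z. \<Sum>k. c k * G k z)"
    proof
      fix z show "disc_restrict (\<lambda>z. \<Sum>k. c k * x k z) z * f z = disc_restrict (\<lambda>z. \<Sum>k. c k * G k z) z"
        using suminf_mult2[OF sums_summable[OF sm], of z "f z"] by (auto simp: disc_restrict_def G_def mult.assoc)
    qed
    ultimately show "(\<lambda>z. disc_restrict (\<lambda>z. \<Sum>k. c k * x k z) z * f z) \<in> dirichlet_space" by simp
  qed
qed

lemma test_fun_multiplier: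
  assumes "test_fun \<eta> \<phi>" "0 < \<eta>" "\<eta> \<le> 1"
  shows "disc_restrict \<phi> \<in> D_mult"
proof -
  have "disc_restrict (\<lambda>z. \<Sum>k. (if k = 0 then 1 else 0) * \<phi> z) \<in> D_mult"
    by (rule test_fun_series_multiplier(1)[OF _ _ assms(2,3)]) (auto simp: assms(1))
  moreover have "(\<Sum>k::nat. (if k = 0 then 1 else 0) * \<phi> z) = \<phi> z" for z
    by (subst suminf_finite[of "{0}"]) auto
  ultimately show ?thesis by simp
qed

section \<open>Packing and separating functions\<close>

text \<open>
  For a function \<open>g\<close> with \<open>t = \<bar>g z\<bar>\<close> and \<open>x = \<bar>deriv g z\<bar>\<close> the assumption bounds the derivatives of all powers. The
  best choice of the exponent is about \<open>1 / (1 - t)\<close>.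
\<close>

lemma power_derivative_bound:
  fixes t x \<kappa> :: real
  assumes t: "0 \<le> t" "t < 1" and x: "0 \<le> x"
    and bd: "\<And>m::nat. real (Suc m) * t ^ m * x \<le> \<kappa>"
  shows "x \<le> 4 * \<kappa> * (1 - t)"
proof -
  define q where "q = 1 / (2 * (1 - t))"
  have q: "0 < q" using t by (simp add: q_def)
  \<comment> \<open>By Bernoulli's inequality t^m is still at least 1/2.\<close>
  define m where "m = nat \<lfloor>q\<rfloor>"
  have m: "real m \<le> q" "q < real (Suc m)" using q unfolding m_def by (auto simp: of_nat_nat) linarith+
  have "real m * (1 - t) \<le> q * (1 - t)" using m(1) t by (intro mult_right_mono) auto
  also have "\<dots> = 1/2" using t by (simp add: q_def)
  finally have "1/2 \<le> 1 + real m * (t - 1)" by (simp add: algebra_simps)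
  also have "\<dots> \<le> (1 + (t - 1)) ^ m" by (rule Bernoulli_inequality) (use t in simp)
  finally have tm: "1/2 \<le> t ^ m" by simp
  have "q * (1/2) * x \<le> real (Suc m) * t ^ m * x"
    using m q tm x by (intro mult_right_mono mult_mono) auto
  also have "\<dots> \<le> \<kappa>" by (rule bd)
  finally have "q * x \<le> 2 * \<kappa>" by simp
  then have "(q * x) * (2 * (1 - t)) \<le> (2 * \<kappa>) * (2 * (1 - t))" using t by (intro mult_right_mono) auto
  also have "(q * x) * (2 * (1 - t)) = x" using t by (simp add: q_def)
  finally show ?thesis by (simp add: algebra_simps)
qed

lemma loglog_radial_large:
  fixes L :: real
  obtains s0 where "0 \<le> s0" "s0 < 1" "\<And>r. s0 \<le> r \<Longrightarrow> r < 1 \<Longrightarrow> L \<le> loglog_radial r"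
proof
  show "0 \<le> 1 - exp (- exp L)" by simp
  show "1 - exp (- exp L) < 1" by simp
  fix r assume r: "1 - exp (- exp L) \<le> r" "r < 1"
  then have "ln (1 - r) \<le> ln (exp (- exp L))" by (subst ln_le_cancel_iff) auto
  then have le: "exp L \<le> 2 - ln (1 - r)" by simp
  then have "ln (exp L) \<le> ln (2 - ln (1 - r))"
    by (intro ln_mono) (use exp_gt_zero[of L] in linarith)+
  then show "L \<le> loglog_radial r" by (simp add: loglog_radial_def)
qed

text \<open>
  Points in the same cell of a cubical grid with mesh \<open>s / (2 * CARD('d))\<close> are closer than \<open>s\<close>, so different
  points lie in different cells.
\<close>

lemma packing:
  fixes p :: "nat \<Rightarrow> complex ^ 'd"
  assumes s: "0 < s" "s \<le> 1" and p1: "\<And>k. k < N \<Longrightarrow> norm (p k) \<le> 1"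
    and sep: "\<And>k l. k < N \<Longrightarrow> l < N \<Longrightarrow> k \<noteq> l \<Longrightarrow> s \<le> norm (p k - p l)"
  shows "real N \<le> (10 * real CARD('d) / s) ^ (2 * CARD('d))"
proof -
  define d where "d = CARD('d)"
  have d: "1 \<le> real d" unfolding d_def using zero_less_card_finite[where 'a = 'd] by (metis One_nat_def Suc_leI of_nat_1 of_nat_mono)
  define t where "t = s / (2 * real d)"
  have t: "0 < t" "t \<le> 1" using s d by (auto simp: t_def divide_le_eq)
  define K where "K = \<lceil>1 / t\<rceil>"
  define c where "c x = \<lfloor>x / t\<rfloor>" for x :: real
  have cr: "c x \<in> {-K..K}" if "\<bar>x\<bar> \<le> 1" for x
  proof -
    have "x / t \<le> 1 / t" "- (1 / t) \<le> x / t" using that t by (auto simp: divide_right_mono field_simps)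
    then show ?thesis unfolding c_def K_def by (auto intro: floor_mono simp: le_floor_iff floor_le_iff) linarith+
  qed
  have cc: "\<bar>x - y\<bar> < t" if "c x = c y" for x y
  proof -
    have "\<bar>x / t - y / t\<bar> < 1" using that unfolding c_def by linarith
    then have "\<bar>x - y\<bar> / t < 1" using t by (simp add: diff_divide_distrib[symmetric])
    then show ?thesis using t by simp
  qed
  define f where "f k = (\<lambda>i. (c (Re (p k $ i)), c (Im (p k $ i))))" for k
  define B where "B = (PiE UNIV (\<lambda>_::'d. {-K..K} \<times> {-K..K}))"
  have finB: "finite B" unfolding B_def by (intro finite_PiE) auto
  have fB: "f ` {..<N} \<subseteq> B"
  proof
    fix g assume "g \<in> f ` {..<N}"
    then obtain k where k: "k < N" "g = f k" by auto
    have "\<bar>Re (p k $ i)\<bar> \<le> 1" "\<bar>Im (p k $ i)\<bar> \<le> 1" for i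
      using p1[OF k(1)] abs_Re_le_cmod[of "p k $ i"] abs_Im_le_cmod[of "p k $ i"] Finite_Cartesian_Product.norm_nth_le[of "p k" i] by linarith+
    then show "g \<in> B" unfolding k(2) f_def B_def using cr by (auto simp: PiE_iff)
  qed
  have inj: "inj_on f {..<N}"
  proof (rule inj_onI, rule ccontr)
    fix k l assume kl: "k \<in> {..<N}" "l \<in> {..<N}" "f k = f l" "k \<noteq> l"
    have "cmod ((p k - p l) $ i) \<le> 2 * t" for i
    proof -
      have "c (Re (p k $ i)) = c (Re (p l $ i))" "c (Im (p k $ i)) = c (Im (p l $ i))"
        using fun_cong[OF kl(3), of i] by (auto simp: f_def)
      then have "\<bar>Re (p k $ i) - Re (p l $ i)\<bar> < t" "\<bar>Im (p k $ i) - Im (p l $ i)\<bar> < t" using cc by auto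
      then show ?thesis using cmod_le[of "(p k - p l) $ i"] by simp
    qed
    moreover have "\<exists>i. cmod ((p k - p l) $ i) < 2 * t"
    proof -
      fix i :: 'd
      have "c (Re (p k $ i)) = c (Re (p l $ i))" "c (Im (p k $ i)) = c (Im (p l $ i))"
        using fun_cong[OF kl(3), of i] by (auto simp: f_def)
      then have "\<bar>Re (p k $ i) - Re (p l $ i)\<bar> < t" "\<bar>Im (p k $ i) - Im (p l $ i)\<bar> < t" using cc by auto
      then have "cmod ((p k - p l) $ i) < 2 * t" using cmod_le[of "(p k - p l) $ i"] by simp
      then show ?thesis by blast
    qed
    ultimately have "(\<Sum>i\<in>UNIV. cmod ((p k - p l) $ i)) < (\<Sum>i\<in>(UNIV :: 'd set). 2 * t)"
      by (intro sum_strict_mono_ex1) auto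
    also have "\<dots> = s" using d by (simp add: t_def d_def)
    finally have "norm (p k - p l) < s"
      using L2_set_le_sum[of UNIV "\<lambda>i. cmod ((p k - p l) $ i)"] by (simp add: norm_vec_def)
    then show False using sep[of k l] kl by simp
  qed
  have K0: "0 \<le> K" unfolding K_def using ceiling_mono[of 0 "1 / t"] t by simp
  have "N = card (f ` {..<N})" using card_image[OF inj] by simp
  also have "\<dots> \<le> card B" by (rule card_mono[OF finB fB])
  also have "card B = (nat (2 * K + 1) * nat (2 * K + 1)) ^ d"
    unfolding B_def using K0 by (simp add: card_PiE card_cartesian_product d_def)
  finally have "real N \<le> real ((nat (2 * K + 1) * nat (2 * K + 1)) ^ d)" by (rule of_nat_mono)
  also have "\<dots> = (real (nat (2 * K + 1))) ^ (2 * d)"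
    by (simp add: power_mult power2_eq_square)
  also have "\<dots> \<le> (5 / t) ^ (2 * d)"
  proof (rule power_mono)
    have "real_of_int K \<le> 1 / t + 1" unfolding K_def by linarith
    moreover have "1 \<le> 1 / t" using t by simp
    ultimately have "2 * real_of_int K + 1 \<le> 5 / t" by (simp add: add_divide_distrib)
    then show "real (nat (2 * K + 1)) \<le> 5 / t" using K0 by simp
  qed simp
  also have "5 / t = 10 * real d / s" by (simp add: t_def)
  finally show ?thesis by (simp add: d_def)
qed

text \<open>
  A logarithm whose singularity lies outside the disc, at distance \<open>\<epsilon>\<close> from \<open>\<zeta>\<close>. The factor makes it a test function.
\<close>

definition log_test :: "real \<Rightarrow> real \<Rightarrow> complex \<Rightarrow> complex \<Rightarrow> complex" where
  "log_test \<eta> \<epsilon> \<zeta> z = of_real (\<epsilon> powr \<eta> / (6 - ln \<epsilon>)) * Ln (1 + of_real \<epsilon> - cnj \<zeta> * z)"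

lemma log_test_arg:
  assumes \<zeta>: "cmod \<zeta> = 1" and z: "z \<in> ball 0 1" and \<epsilon>: "0 < \<epsilon>"
  shows "0 < Re (1 + of_real \<epsilon> - cnj \<zeta> * z)" "\<epsilon> \<le> cmod (1 + of_real \<epsilon> - cnj \<zeta> * z)"
    "cmod (z - \<zeta>) \<le> cmod (1 + of_real \<epsilon> - cnj \<zeta> * z)"
proof -
  define u where "u = 1 - cnj \<zeta> * z"
  have u: "0 < Re u" unfolding u_def by (rule Re_one_minus_pos[OF \<zeta> z])
  have eq: "1 + of_real \<epsilon> - cnj \<zeta> * z = u + of_real \<epsilon>" by (simp add: u_def)
  show "0 < Re (1 + of_real \<epsilon> - cnj \<zeta> * z)" unfolding eq using u \<epsilon> by simp
  have "\<epsilon> \<le> Re (u + of_real \<epsilon>)" using u by simp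
  also have "\<dots> \<le> cmod (u + of_real \<epsilon>)" by (rule complex_Re_le_cmod)
  finally show "\<epsilon> \<le> cmod (1 + of_real \<epsilon> - cnj \<zeta> * z)" unfolding eq .
  have "(cmod u)\<^sup>2 \<le> (cmod (u + of_real \<epsilon>))\<^sup>2"
    unfolding cmod_power2 using u \<epsilon> by (simp add: power2_sum)
  then have "cmod u \<le> cmod (u + of_real \<epsilon>)" by (rule power2_le_imp_le) simp
  then show "cmod (z - \<zeta>) \<le> cmod (1 + of_real \<epsilon> - cnj \<zeta> * z)"
    unfolding eq by (simp add: u_def circle_dist[OF \<zeta>])
qed

lemma log_test_test_fun:
  assumes \<zeta>: "cmod \<zeta> = 1" and \<epsilon>: "0 < \<epsilon>" "\<epsilon> \<le> 1" and \<eta>: "0 < \<eta>" "\<eta> \<le> 1"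
  shows "test_fun \<eta> (log_test \<eta> \<epsilon> \<zeta>)"
proof -
  define \<kappa> where "\<kappa> = \<epsilon> powr \<eta> / (6 - ln \<epsilon>)"
  have le: "6 \<le> 6 - ln \<epsilon>" using \<epsilon> by simp
  have p6: "0 < 6 - ln \<epsilon>" using le by linarith
  have k0: "0 < \<kappa>" unfolding \<kappa>_def by (intro divide_pos_pos p6) (use \<epsilon> in simp)
  have e1: "\<epsilon> powr \<eta> \<le> 1" using \<epsilon> \<eta> by (simp add: powr_le1)
  have der: "(log_test \<eta> \<epsilon> \<zeta> has_field_derivative of_real \<kappa> * (- cnj \<zeta> / (1 + of_real \<epsilon> - cnj \<zeta> * z))) (at z)"
    if z: "z \<in> ball 0 1" for z
  proof -
    have nn: "1 + of_real \<epsilon> - cnj \<zeta> * z \<notin> \<real>\<^sub>\<le>\<^sub>0"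
      using log_test_arg(1)[OF \<zeta> z \<epsilon>(1)] by (auto simp: complex_nonpos_Reals_iff)
    then have nz: "1 + of_real \<epsilon> - cnj \<zeta> * z \<noteq> 0" by auto
    show ?thesis unfolding log_test_def[abs_def] \<kappa>_def[symmetric]
      using nn nz by (auto intro!: derivative_eq_intros simp: divide_inverse mult_ac)
  qed
  show ?thesis unfolding test_fun_def
  proof (intro conjI ballI exI[of _ \<zeta>] \<zeta>)
    show "log_test \<eta> \<epsilon> \<zeta> holomorphic_on ball 0 1"
      unfolding holomorphic_on_open[OF open_ball] using der by blast
    fix z :: complex assume z: "z \<in> ball 0 1"
    define w where "w = 1 + of_real \<epsilon> - cnj \<zeta> * z"
    note w = log_test_arg[OF \<zeta> z \<epsilon>(1), folded w_def]
    have w0: "w \<noteq> 0" using w(1) by auto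
    show "cmod (log_test \<eta> \<epsilon> \<zeta> z) \<le> 1"
    proof -
      have "cmod w \<le> 3"
      proof -
        have "cmod (1 + of_real \<epsilon>) \<le> 1 + \<epsilon>" using \<epsilon> norm_triangle_ineq[of 1 "complex_of_real \<epsilon>"] by simp
        moreover have "cmod (cnj \<zeta> * z) \<le> 1" using \<zeta> z by (simp add: norm_mult)
        ultimately show ?thesis unfolding w_def using norm_triangle_ineq4[of "1 + of_real \<epsilon>" "cnj \<zeta> * z"] \<epsilon> by linarith
      qed
      moreover have wp: "0 < cmod w" using w0 by simp
      ultimately have "ln (cmod w) \<le> 2" using ln_le_minus_one[OF wp] by linarith
      moreover have "ln \<epsilon> \<le> ln (cmod w)" using w(2) \<epsilon> wp by (subst ln_le_cancel_iff) auto
      moreover have "ln \<epsilon> \<le> 0" using \<epsilon> by simp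
      ultimately have "\<bar>ln (cmod w)\<bar> \<le> 2 - ln \<epsilon>" by linarith
      then have "cmod (Ln w) \<le> 6 - ln \<epsilon>" using norm_Ln_le[OF w0] pi_less_4 by linarith
      then have "\<kappa> * cmod (Ln w) \<le> \<kappa> * (6 - ln \<epsilon>)" using k0 by (intro mult_left_mono) auto
      also have "\<dots> = \<epsilon> powr \<eta>" using p6 by (simp add: \<kappa>_def)
      finally show ?thesis using e1 k0 by (simp add: log_test_def \<kappa>_def[symmetric] w_def[symmetric] norm_mult)
    qed
    show "cmod (deriv (log_test \<eta> \<epsilon> \<zeta>) z) \<le> cmod (z - \<zeta>) powr (\<eta> - 1)"
    proof -
      have pos: "0 < cmod (z - \<zeta>)" using z \<zeta> by auto
      have wp: "0 < cmod w" using w0 by simp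
      have k1: "\<kappa> \<le> \<epsilon> powr \<eta>" unfolding \<kappa>_def
        using divide_left_mono[of 1 "6 - ln \<epsilon>" "\<epsilon> powr \<eta>"] le p6 by simp
      have "cmod (deriv (log_test \<eta> \<epsilon> \<zeta>) z) = \<kappa> / cmod w"
        unfolding DERIV_imp_deriv[OF der[OF z]] using \<zeta> k0 by (simp add: norm_mult norm_divide w_def)
      also have "\<dots> \<le> \<epsilon> powr \<eta> / cmod w" using k1 wp by (simp add: divide_right_mono)
      also have "\<dots> \<le> cmod w powr \<eta> / cmod w" using w(2) \<epsilon> \<eta> wp by (intro divide_right_mono powr_mono2) auto
      also have "\<dots> = cmod w powr (\<eta> - 1)" using wp by (simp add: powr_diff)
      also have "\<dots> \<le> cmod (z - \<zeta>) powr (\<eta> - 1)" using w(3) pos \<eta> by (intro powr_mono2') auto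
      finally show ?thesis .
    qed
  qed
qed

text \<open>
  The argument of the logarithm is \<open>2 * \<epsilon>\<close> at the first point and at least \<open>sqrt \<epsilon>\<close> in modulus at the second.
\<close>

lemma log_test_separates:
  assumes \<zeta>: "cmod \<zeta> = 1" "cmod \<zeta>' = 1" and \<epsilon>: "0 < \<epsilon>" "\<epsilon> < 1" "4 \<le> - ln \<epsilon>"
    and sep: "2 * sqrt \<epsilon> \<le> cmod (\<zeta>' - \<zeta>)"
  shows "\<epsilon> powr \<eta> / (6 - ln \<epsilon>) \<le>
    cmod (log_test \<eta> \<epsilon> \<zeta> (of_real (1 - \<epsilon>) * \<zeta>) - log_test \<eta> \<epsilon> \<zeta> (of_real (1 - \<epsilon>) * \<zeta>'))"
proof -
  define \<kappa> where "\<kappa> = \<epsilon> powr \<eta> / (6 - ln \<epsilon>)"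
  have k0: "0 < \<kappa>" unfolding \<kappa>_def using \<epsilon> by (intro divide_pos_pos) auto
  define w where "w = 1 + of_real \<epsilon> - cnj \<zeta> * (of_real (1 - \<epsilon>) * \<zeta>)"
  define w' where "w' = 1 + of_real \<epsilon> - cnj \<zeta> * (of_real (1 - \<epsilon>) * \<zeta>')"
  have cc: "cnj \<zeta> * \<zeta> = 1" using \<zeta> by (metis complex_norm_square mult.commute of_real_1 one_power2)
  have e1: "cnj \<zeta> * (of_real (1 - \<epsilon>) * \<zeta>) = of_real (1 - \<epsilon>)"
    by (simp only: mult.left_commute[of "cnj \<zeta>"] cc mult_1_right)
  have w: "w = of_real (2 * \<epsilon>)" unfolding w_def e1 by simp
  have inb: "of_real (1 - \<epsilon>) * \<zeta>' \<in> ball 0 1" using \<zeta> \<epsilon> by (simp add: norm_mult del: of_real_diff)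
  note a = log_test_arg[OF \<zeta>(1) inb \<epsilon>(1), folded w'_def]
  have w'0: "w' \<noteq> 0" using a(1) by auto
  have "sqrt \<epsilon> \<le> cmod w'"
  proof -
    have e2: "of_real (1 - \<epsilon>) * \<zeta>' - \<zeta> = (\<zeta>' - \<zeta>) - of_real \<epsilon> * \<zeta>'" by (simp add: algebra_simps)
    have "cmod (\<zeta>' - \<zeta>) - cmod (of_real \<epsilon> * \<zeta>') \<le> cmod (of_real (1 - \<epsilon>) * \<zeta>' - \<zeta>)"
      unfolding e2 by (rule norm_triangle_ineq2)
    moreover have "cmod (of_real \<epsilon> * \<zeta>') = \<epsilon>" using \<zeta> \<epsilon> by (simp add: norm_mult)
    moreover have "\<epsilon> \<le> sqrt \<epsilon>" using \<epsilon> by (intro real_le_rsqrt) (simp add: power2_eq_square mult_left_le)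
    ultimately show ?thesis using a(3) sep by linarith
  qed
  then have "ln (sqrt \<epsilon>) \<le> ln (cmod w')" using \<epsilon> w'0 by (subst ln_le_cancel_iff) auto
  then have "ln \<epsilon> / 2 \<le> Re (Ln w')" using \<epsilon> w'0 by (simp add: ln_sqrt Re_Ln)
  moreover have "Re (Ln w) = ln 2 + ln \<epsilon>" unfolding w using \<epsilon> by (subst Re_Ln) (auto simp: norm_mult ln_mult)
  moreover have "ln 2 \<le> (1::real)" using ln2_le_25_over_36 by linarith
  ultimately have "1 \<le> Re (Ln w') - Re (Ln w)" using \<epsilon>(3) by linarith
  also have "\<dots> \<le> cmod (Ln w - Ln w')" using complex_Re_le_cmod[of "Ln w' - Ln w"] by (simp add: norm_minus_commute)
  finally have "\<kappa> * 1 \<le> \<kappa> * cmod (Ln w - Ln w')" using k0 by (intro mult_left_mono) auto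
  also have "\<dots> = cmod (of_real \<kappa> * (Ln w - Ln w'))" using k0 by (simp add: norm_mult)
  finally show ?thesis
    by (simp only: log_test_def \<kappa>_def[symmetric] w_def[symmetric] w'_def[symmetric] right_diff_distrib mult_1_right)
qed

section \<open>The map into the ball induced by an isomorphism\<close>

lemma dirichlet_add: "f \<in> dirichlet_space \<Longrightarrow> g \<in> dirichlet_space \<Longrightarrow> (\<lambda>z. f z + g z) \<in> dirichlet_space"
proof -
  assume f: "f \<in> dirichlet_space" and g: "g \<in> dirichlet_space"
  note fh = dirichlet_hol[OF f] and gh = dirichlet_hol[OF g]
  have "energy (deriv (\<lambda>z. f z + g z)) \<le> 2 * energy (deriv f) + 2 * energy (deriv g)"
  proof (rule energy_le_sum2[OF deriv_continuous[OF fh] deriv_continuous[OF gh]])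
    fix z :: complex assume z: "z \<in> ball 0 1"
    have "deriv (\<lambda>z. f z + g z) z = deriv f z + deriv g z"
      by (rule DERIV_imp_deriv[OF DERIV_add[OF deriv_at[OF fh z] deriv_at[OF gh z]]])
    then show "cmod (deriv (\<lambda>z. f z + g z) z) \<le> cmod (deriv f z) + cmod (deriv g z)"
      using norm_triangle_ineq by simp
  qed
  also have "\<dots> < \<infinity>" using f g by (simp add: dirichlet_space_iff ennreal_mult_less_top)
  finally show ?thesis using f g by (auto simp: dirichlet_space_iff funs_on_def intro: holomorphic_on_add)
qed

lemma dirichlet_scale: "f \<in> dirichlet_space \<Longrightarrow> (\<lambda>z. c * f z) \<in> dirichlet_space"
proof -
  assume f: "f \<in> dirichlet_space"
  note fh = dirichlet_hol[OF f]
  have "energy (deriv (\<lambda>z. c * f z)) = energy (\<lambda>z. c * deriv f z)"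
    by (rule energy_cong) (rule DERIV_imp_deriv[OF DERIV_cmult[OF deriv_at[OF fh]]])
  also have "\<dots> = ennreal ((cmod c)\<^sup>2) * energy (deriv f)" by (rule energy_cmult[OF deriv_continuous[OF fh]])
  also have "\<dots> < \<infinity>" using f by (simp add: dirichlet_space_iff ennreal_mult_less_top)
  finally show ?thesis using f by (auto simp: dirichlet_space_iff funs_on_def intro: holomorphic_on_mult)
qed

lemma D_mult_add: "f \<in> D_mult \<Longrightarrow> g \<in> D_mult \<Longrightarrow> (\<lambda>z. f z + g z) \<in> D_mult"
  by (auto simp: Mult_def funs_on_def distrib_right intro: dirichlet_add)

lemma D_mult_scale: "f \<in> D_mult \<Longrightarrow> (\<lambda>z. c * f z) \<in> D_mult"
  by (auto simp: Mult_def funs_on_def mult.assoc intro: dirichlet_scale)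

lemma D_mult_mult: "f \<in> D_mult \<Longrightarrow> g \<in> D_mult \<Longrightarrow> (\<lambda>z. f z * g z) \<in> D_mult"
  by (auto simp: Mult_def funs_on_def mult.assoc)

lemma D_mult_one: "one_on (ball 0 1) \<in> D_mult"
proof -
  have "(\<lambda>z. one_on (ball 0 1) z * f z) = f" if "f \<in> dirichlet_space" for f
    using that by (auto simp: dirichlet_space_iff funs_on_def one_on_def)
  then show ?thesis by (auto simp: Mult_def funs_on_def one_on_def)
qed

locale dirichlet_iso = drury_arveson_rkhs V H ip
  for V :: "(complex ^ 'd) set" and H ip +
  fixes \<Phi> :: "(complex \<Rightarrow> complex) \<Rightarrow> (complex ^ 'd \<Rightarrow> complex)"
  assumes bij: "bij_betw \<Phi> D_mult (Mult V H)"
    and iso_add: "f \<in> D_mult \<Longrightarrow> g \<in> D_mult \<Longrightarrow> \<Phi> (\<lambda>x. f x + g x) = (\<lambda>y. \<Phi> f y + \<Phi> g y)"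
    and iso_scale: "f \<in> D_mult \<Longrightarrow> \<Phi> (\<lambda>x. c * f x) = (\<lambda>y. c * \<Phi> f y)"
    and iso_mult: "f \<in> D_mult \<Longrightarrow> g \<in> D_mult \<Longrightarrow> \<Phi> (\<lambda>x. f x * g x) = (\<lambda>y. \<Phi> f y * \<Phi> g y)"
begin

definition T :: "(complex ^ 'd \<Rightarrow> complex) \<Rightarrow> complex \<Rightarrow> complex" where
  "T = inv_into D_mult \<Phi>"

lemma T_mem: "\<psi> \<in> Mult V H \<Longrightarrow> T \<psi> \<in> D_mult"
  unfolding T_def using bij by (metis bij_betw_imp_surj_on inv_into_into)

lemma iso_T: "\<psi> \<in> Mult V H \<Longrightarrow> \<Phi> (T \<psi>) = \<psi>"
  unfolding T_def using bij by (metis bij_betw_inv_into_right)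

lemma T_iso: "f \<in> D_mult \<Longrightarrow> T (\<Phi> f) = f"
  unfolding T_def using bij by (metis bij_betw_inv_into_left)

lemma iso_mem: "f \<in> D_mult \<Longrightarrow> \<Phi> f \<in> Mult V H"
  using bij bij_betwE by blast

lemma T_eqI: "f \<in> D_mult \<Longrightarrow> \<Phi> f = \<psi> \<Longrightarrow> T \<psi> = f"
  using T_iso by blast

text \<open>
  A bijection that respects products maps the unit to the unit.
\<close>

lemma T_one: "T (one_on V) = one_on (ball 0 1)"
proof -
  define e where "e = T (one_on V)"
  have e: "e \<in> D_mult" "\<Phi> e = one_on V" unfolding e_def by (rule T_mem[OF Mult_one], rule iso_T[OF Mult_one])
  have "\<Phi> (\<lambda>x. e x * one_on (ball 0 1) x) = (\<lambda>y. \<Phi> e y * \<Phi> (one_on (ball 0 1)) y)"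
    by (rule iso_mult[OF e(1) D_mult_one])
  moreover have "(\<lambda>x. e x * one_on (ball 0 1) x) = e"
    using e(1) by (auto simp: Mult_def funs_on_def one_on_def fun_eq_iff)
  moreover have "(\<lambda>y. \<Phi> e y * \<Phi> (one_on (ball 0 1)) y) = \<Phi> (one_on (ball 0 1))"
    unfolding e(2) using Mult_outside[OF iso_mem[OF D_mult_one]] by (auto simp: one_on_def[of V] fun_eq_iff)
  ultimately have "\<Phi> (one_on (ball 0 1)) = one_on V" using e(2) by simp
  then show ?thesis by (rule T_eqI[OF D_mult_one])
qed

definition ev :: "complex \<Rightarrow> (complex ^ 'd \<Rightarrow> complex) \<Rightarrow> complex" where
  "ev z \<psi> = T \<psi> z"

lemma ev_character: "z \<in> ball 0 1 \<Longrightarrow> character_on V (Mult V H) (ev z)"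
  unfolding character_on_def ev_def
proof (intro conjI ballI allI)
  assume z: "z \<in> ball 0 1"
  show "T (one_on V) z = 1" unfolding T_one using z by (simp add: one_on_def)
  fix f g assume f: "f \<in> Mult V H" and g: "g \<in> Mult V H"
  have "T (\<lambda>x. f x + g x) = (\<lambda>z. T f z + T g z)"
    by (rule T_eqI[OF D_mult_add[OF T_mem[OF f] T_mem[OF g]]])
       (simp add: iso_add T_mem f g iso_T)
  then show "T (\<lambda>x. f x + g x) z = T f z + T g z" by simp
  have "T (\<lambda>x. f x * g x) = (\<lambda>z. T f z * T g z)"
    by (rule T_eqI[OF D_mult_mult[OF T_mem[OF f] T_mem[OF g]]])
       (simp add: iso_mult T_mem f g iso_T)
  then show "T (\<lambda>x. f x * g x) z = T f z * T g z" by simp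
next
  fix c f assume f: "f \<in> Mult V H"
  have "T (\<lambda>x. c * f x) = (\<lambda>z. c * T f z)"
    by (rule T_eqI[OF D_mult_scale[OF T_mem[OF f]]]) (simp add: iso_scale T_mem f iso_T)
  then show "T (\<lambda>x. c * f x) z = c * T f z" by simp
qed

definition F :: "complex \<Rightarrow> complex ^ 'd" where
  "F z = pt (ev z)"

lemma T_bound: "bmult b M \<Longrightarrow> 0 \<le> M \<Longrightarrow> z \<in> ball 0 1 \<Longrightarrow> cmod (T b z) \<le> M"
  using character_bmult_le[OF ev_character] unfolding ev_def by blast

lemma T_lin: "z \<in> ball 0 1 \<Longrightarrow> T (lin \<alpha>) z = cinner_vec (F z) \<alpha>"
  using character_lin[OF ev_character] unfolding ev_def F_def by blast

lemma T_linpow: "z \<in> ball 0 1 \<Longrightarrow> norm \<alpha> \<le> 1 \<Longrightarrow> T (linpow \<alpha> n) z = (T (lin \<alpha>) z) ^ n"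
  using character_linpow[OF ev_character, of z \<alpha> n] T_lin[of z \<alpha>] unfolding ev_def F_def by simp

lemma F_cont: "continuous_on (ball 0 1) F"
proof -
  have "F z = (\<chi> i. T (id.coord i) z)" for z by (simp add: F_def pt_def ev_def)
  moreover have "continuous_on (ball 0 1) (T (id.coord i))" for i
    by (rule holomorphic_on_imp_continuous_on[OF D_mult_hol[OF T_mem[OF id.coord_Mult]]])
  ultimately show ?thesis
    by (simp add: F_def[abs_def] pt_def[abs_def] ev_def continuous_on_vec_lambda)
qed

text \<open>
  If \<open>F z\<close> had norm one, the function \<open>T (lin (F z))\<close> would attain its maximum modulus at \<open>z\<close>, hence be constant.
  Then \<open>lin (F z)\<close> would be constant one on \<open>V\<close>, which lies in the open ball.
\<close>

lemma norm_F_lt1: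
  assumes z: "z \<in> ball 0 1"
  shows "norm (F z) < 1"
proof (rule ccontr)
  assume "\<not> norm (F z) < 1"
  then have F1: "norm (F z) = 1" using norm_pt_le1[OF ev_character[OF z]] by (simp add: F_def)
  define \<alpha> where "\<alpha> = F z"
  define h where "h = T (lin \<alpha>)"
  have hM: "h \<in> D_mult" unfolding h_def by (rule T_mem[OF lin_Mult])
  have hz: "h z = 1" unfolding h_def T_lin[OF z] \<alpha>_def cinner_vec_norm F1 by simp
  have h1: "cmod (h w) \<le> cmod (h z)" if "w \<in> ball 0 1" for w
    using T_bound[OF lin_bmult, of \<alpha> w] that hz F1 by (simp add: h_def \<alpha>_def)
  have "h constant_on ball 0 1"
    by (rule maximum_modulus_principle[OF D_mult_hol[OF hM], of "ball 0 1" z]) (use h1 z in auto)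
  then have "h w = 1" if "w \<in> ball 0 1" for w using hz z that unfolding constant_on_def by metis
  then have "h = one_on (ball 0 1)" using hM by (auto simp: Mult_def funs_on_def one_on_def)
  then have "lin \<alpha> = one_on V"
    using iso_T[OF lin_Mult, of \<alpha>] iso_T[OF Mult_one] T_one by (simp add: h_def)
  moreover have "V \<noteq> {}"
  proof
    assume "V = {}"
    then have "one_on V = (\<lambda>x. 0)" by (simp add: one_on_def)
    then show False using character_one[OF ev_character[OF z]] character_zero[OF ev_character[OF z]] by simp
  qed
  then obtain v where v: "v \<in> V" by blast
  ultimately have "cinner_vec v \<alpha> = 1" by (metis lin_def one_on_def)
  moreover have "cmod (cinner_vec v \<alpha>) < 1"
    by (rule cinner_vec_lt1[OF V_norm[OF v]]) (simp add: \<alpha>_def F1)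
  ultimately show False by simp
qed

text \<open>
  Each \<open>T (linpow \<alpha> n)\<close> is a bounded multiplier, so \<open>bounded_multiplier_deriv\<close> applies to it; the point is the
  uniformity in \<open>\<alpha>\<close> and \<open>n\<close>.
\<close>

lemma linpow_deriv_bound:
  "\<exists>M. \<forall>z\<in>ball 0 1. \<forall>p\<in>{p. norm (fst p) \<le> 1}.
    cmod (of_real ((1 - cmod z) * loglog_radial (cmod z)) * deriv (T (linpow (fst p) (snd p))) z) \<le> M"
proof (rule gliding_hump)
  fix z :: complex assume z: "z \<in> ball 0 1"
  have "cmod (deriv (T (linpow \<alpha> n)) z) \<le> 2 / (1 - cmod z)" if \<alpha>: "norm \<alpha> \<le> 1" for \<alpha> n
  proof -
    \<comment> \<open>The Cauchy estimate on a disc of half the admissible radius.\<close>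
    define r where "r = (1 - cmod z) / 2"
    have r: "0 < r" "cmod z + r < 1" using z by (auto simp: r_def field_simps)
    have inb: "x \<in> ball 0 1" if "dist z x \<le> r" for x
      using that r norm_triangle_ineq[of z "x - z"] by (simp add: dist_norm norm_minus_commute)
    have hol: "T (linpow \<alpha> n) holomorphic_on ball 0 1" by (rule D_mult_hol[OF T_mem[OF bmult_Mult[OF linpow_bmult[OF \<alpha>]]]])
    have "norm ((deriv ^^ 1) (T (linpow \<alpha> n)) z) \<le> fact 1 * 1 / r ^ 1"
    proof (rule Cauchy_inequality)
      show "T (linpow \<alpha> n) holomorphic_on ball z r" by (rule holomorphic_on_subset[OF hol]) (use inb in auto)
      show "continuous_on (cball z r) (T (linpow \<alpha> n))"
        by (rule continuous_on_subset[OF holomorphic_on_imp_continuous_on[OF hol]]) (use inb in auto)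
      show "norm (T (linpow \<alpha> n) x) \<le> 1" if "norm (z - x) = r" for x
        by (rule T_bound[OF linpow_bmult[OF \<alpha>]]) (use inb that in \<open>auto simp: dist_norm\<close>)
    qed (rule r)
    then show ?thesis by (simp add: r_def)
  qed
  then show "\<exists>M. \<forall>p\<in>{p. norm (fst p) \<le> 1}. cmod (of_real ((1 - cmod z) * loglog_radial (cmod z)) * deriv (T (linpow (fst p) (snd p))) z) \<le> M"
    unfolding norm_mult by (intro exI[of _ "cmod (of_real ((1 - cmod z) * loglog_radial (cmod z))) * (2 / (1 - cmod z))"] ballI mult_left_mono) auto
next
  fix x :: "nat \<Rightarrow> (complex ^ 'd) \<times> nat" and c :: "nat \<Rightarrow> complex"
  assume x: "\<And>k. x k \<in> {p. norm (fst p) \<le> 1}" and c: "\<And>k. cmod (c k) \<le> (1/3)^k"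
  define b where "b k = linpow (fst (x k)) (snd (x k))" for k
  have b: "bmult (b k) 1" for k unfolding b_def by (rule linpow_bmult) (use x in simp)
  define S where "S = (\<lambda>v. \<Sum>k. c k * b k v)"
  have S: "bmult S (3/2)" unfolding S_def by (rule bmult_series(1)[OF b c])
  have TS: "T S \<in> D_mult" by (rule T_mem[OF bmult_Mult[OF S]])
  obtain M where M: "\<And>z. z \<in> ball 0 1 \<Longrightarrow> cmod (deriv (T S) z) * (1 - cmod z) * loglog_radial (cmod z) \<le> M"
  proof -
    have "cmod (T S z) \<le> 3/2" if "z \<in> ball 0 1" for z by (rule T_bound[OF S _ that]) simp
    then show ?thesis using bounded_multiplier_deriv[OF TS, of "3/2"] that by blast
  qed
  have sums: "(\<lambda>k. c k * T (b k) z) sums T S z" if "z \<in> ball 0 1" for z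
    using character_series[OF ev_character[OF that] b c] unfolding ev_def S_def .
  have Th: "T (b k) holomorphic_on ball 0 1" for k by (rule D_mult_hol[OF T_mem[OF bmult_Mult[OF b]]])
  have Tb: "\<exists>M. \<forall>k. \<forall>z. cmod z \<le> r \<longrightarrow> cmod (T (b k) z) \<le> M" if "r < 1" for r
    using T_bound[OF b] that by (intro exI[of _ 1]) auto
  have "cmod (\<Sum>k. c k * (of_real ((1 - cmod z) * loglog_radial (cmod z)) * deriv (T (linpow (fst (x k)) (snd (x k)))) z)) \<le> M"
    if z: "z \<in> ball 0 1" for z
  proof -
    have "(\<lambda>k. c k * deriv (T (b k)) z) sums deriv (\<lambda>z. \<Sum>k. c k * T (b k) z) z"
      by (rule holomorphic_series(3)[OF Th Tb c z])
    also have "deriv (\<lambda>z. \<Sum>k. c k * T (b k) z) z = deriv (T S) z"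
      by (rule deriv_cong_disc[OF _ z]) (use sums in \<open>simp add: sums_iff\<close>)
    finally have "(\<lambda>k. of_real ((1 - cmod z) * loglog_radial (cmod z)) * (c k * deriv (T (b k)) z)) sums (of_real ((1 - cmod z) * loglog_radial (cmod z)) * deriv (T S) z)"
      by (rule sums_mult)
    then have eq: "(\<Sum>k. c k * (of_real ((1 - cmod z) * loglog_radial (cmod z)) * deriv (T (linpow (fst (x k)) (snd (x k)))) z)) =
        of_real ((1 - cmod z) * loglog_radial (cmod z)) * deriv (T S) z"
      by (simp add: sums_iff b_def mult.left_commute)
    have "0 \<le> (1 - cmod z) * loglog_radial (cmod z)"
      unfolding loglog_radial_def using z by (intro mult_nonneg_nonneg ln_ge_zero) (auto intro: order_trans[of _ 0])
    then show ?thesis unfolding eq norm_mult norm_of_real using M[OF z] by (simp add: mult_ac)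
  qed
  then show "\<exists>M. \<forall>z\<in>ball 0 1. cmod (\<Sum>k. c k * (of_real ((1 - cmod z) * loglog_radial (cmod z)) * deriv (T (linpow (fst (x k)) (snd (x k)))) z)) \<le> M"
    by blast
qed

end

context dirichlet_iso
begin

lemma lin_deriv_bound:
  "\<exists>M\<ge>0. \<forall>z\<in>ball 0 1. \<forall>\<alpha>. norm \<alpha> \<le> 1 \<longrightarrow>
    cmod (deriv (T (lin \<alpha>)) z) * (1 - cmod z) * loglog_radial (cmod z) \<le> M * (1 - cmod (T (lin \<alpha>) z))"
proof -
  obtain M where M: "\<And>z \<alpha> n. z \<in> ball 0 1 \<Longrightarrow> norm \<alpha> \<le> 1 \<Longrightarrow>
    cmod (of_real ((1 - cmod z) * loglog_radial (cmod z)) * deriv (T (linpow \<alpha> n)) z) \<le> M"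
    using linpow_deriv_bound by fastforce
  have "cmod (deriv (T (lin \<alpha>)) z) * (1 - cmod z) * loglog_radial (cmod z) \<le> 4 * max M 0 * (1 - cmod (T (lin \<alpha>) z))"
    if z: "z \<in> ball 0 1" and \<alpha>: "norm \<alpha> \<le> 1" for z \<alpha>
  proof (rule power_derivative_bound)
    define g where "g = T (lin \<alpha>)"
    have gh: "g holomorphic_on ball 0 1" unfolding g_def by (rule D_mult_hol[OF T_mem[OF lin_Mult]])
    have wt: "0 \<le> (1 - cmod z) * loglog_radial (cmod z)"
      unfolding loglog_radial_def using z by (intro mult_nonneg_nonneg ln_ge_zero) (auto intro: order_trans[of _ 0])
    show "0 \<le> cmod (T (lin \<alpha>) z)" by simp
    have "cmod (T (lin \<alpha>) z) \<le> norm (F z) * norm \<alpha>" unfolding T_lin[OF z] by (rule cinner_vec_le)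
    also have "\<dots> \<le> norm (F z) * 1" using \<alpha> by (intro mult_left_mono) auto
    finally show "cmod (T (lin \<alpha>) z) < 1" using norm_F_lt1[OF z] by simp
    show "0 \<le> cmod (deriv (T (lin \<alpha>)) z) * (1 - cmod z) * loglog_radial (cmod z)"
      using mult_nonneg_nonneg[OF norm_ge_zero wt] by (simp only: mult.assoc)
    fix m :: nat
    have "deriv (T (linpow \<alpha> (Suc m))) z = deriv (\<lambda>w. g w ^ Suc m) z"
      by (rule deriv_cong_disc[OF _ z]) (simp only: T_linpow[OF _ \<alpha>] g_def)
    also have "\<dots> = of_nat (Suc m) * (deriv g z * g z ^ m)"
      using DERIV_imp_deriv[OF DERIV_power[OF deriv_at[OF gh z], of "Suc m"]] by simp
    finally have d: "deriv (T (linpow \<alpha> (Suc m))) z = of_nat (Suc m) * (deriv g z * g z ^ m)" .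
    have "real (Suc m) * cmod (g z) ^ m * (cmod (deriv g z) * (1 - cmod z) * loglog_radial (cmod z)) =
      cmod (of_real ((1 - cmod z) * loglog_radial (cmod z)) * deriv (T (linpow \<alpha> (Suc m))) z)"
      unfolding d norm_mult norm_of_real norm_of_nat norm_power abs_of_nonneg[OF wt] by (simp only: mult_ac)
    also have "\<dots> \<le> max M 0" using M[OF z \<alpha>] by (meson max.coboundedI1)
    finally show "real (Suc m) * cmod (T (lin \<alpha>) z) ^ m * (cmod (deriv (T (lin \<alpha>)) z) * (1 - cmod z) * loglog_radial (cmod z)) \<le> max M 0"
      unfolding g_def .
  qed
  then show ?thesis by (intro exI[of _ "4 * max M 0"]) auto
qed

text \<open>
  Let \<open>\<alpha>\<close> be the direction of \<open>F z\<close> and \<open>g = T (lin \<alpha>)\<close>, so that \<open>g z = norm (F z)\<close>. Outside a disc of radius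
  \<open>s0\<close>, \<open>lin_deriv_bound\<close> gives \<open>\<bar>g'\<bar> (1 - t) \<le> \<eta> (1 - \<bar>g\<bar>)\<close> at radius \<open>t\<close>. Consequently
  \<open>(1 - Re g) (1 - t) powr (-\<eta>)\<close> increases along the radius through \<open>z\<close>. Inside the disc of radius \<open>s0\<close> compactness
  is enough.
\<close>

lemma boundary_distance_bound:
  assumes \<eta>: "0 < \<eta>"
  shows "\<exists>c>0. \<forall>z\<in>ball 0 1. c * (1 - cmod z) powr \<eta> \<le> 1 - norm (F z)"
proof -
  obtain M where M0: "0 \<le> M" and M: "\<And>z \<alpha>. z \<in> ball 0 1 \<Longrightarrow> norm \<alpha> \<le> 1 \<Longrightarrow>
    cmod (deriv (T (lin \<alpha>)) z) * (1 - cmod z) * loglog_radial (cmod z) \<le> M * (1 - cmod (T (lin \<alpha>) z))"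
    using lin_deriv_bound by blast
  obtain s0 where s0: "0 \<le> s0" "s0 < 1" and loglog_radial: "\<And>r. s0 \<le> r \<Longrightarrow> r < 1 \<Longrightarrow> max (M / \<eta>) 1 \<le> loglog_radial r"
    by (rule loglog_radial_large[of "max (M / \<eta>) 1"]) blast
  have sub: "cball 0 s0 \<subseteq> ball (0::complex) 1" using s0 by auto
  have "continuous_on (cball 0 s0) (\<lambda>z. norm (F z))"
    by (intro continuous_intros continuous_on_subset[OF F_cont sub])
  then obtain x0 where x0: "x0 \<in> cball 0 s0" "\<And>z. z \<in> cball 0 s0 \<Longrightarrow> norm (F z) \<le> norm (F x0)"
    using continuous_attains_sup[OF compact_cball, of 0 s0 "\<lambda>z. norm (F z)"] s0(1) by auto
  define c where "c = 1 - norm (F x0)"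
  have c0: "0 < c" using norm_F_lt1[of x0] x0(1) sub by (auto simp: c_def)
  have c1: "c \<le> 1" by (simp add: c_def)
  have inner: "c \<le> 1 - norm (F z)" if "cmod z \<le> s0" for z using x0(2)[of z] that by (simp add: c_def)
  have "c * (1 - cmod z) powr \<eta> \<le> 1 - norm (F z)" if z: "z \<in> ball 0 1" for z
  proof -
    define r where "r = cmod z"
    have r: "0 \<le> r" "r < 1" using z by (auto simp: r_def)
    have p1: "(1 - r) powr \<eta> \<le> 1" using r \<eta> by (intro powr_le1) auto
    then have cp: "c * (1 - r) powr \<eta> \<le> c" using c0 by (simp add: mult_left_le)
    consider "r \<le> s0" | "F z = 0" | "s0 < r" "F z \<noteq> 0" by linarith
    then show ?thesis
    proof cases
      case 1
      then show ?thesis using inner[of z] cp by (simp add: r_def)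
    next
      case 2
      then show ?thesis using cp c1 by (simp add: r_def)
    next
      case 3
      define \<zeta> where "\<zeta> = sgn z"
      have z0: "z \<noteq> 0" using 3 s0 by (auto simp: r_def)
      have \<zeta>: "cmod \<zeta> = 1" using z0 by (simp add: \<zeta>_def norm_sgn)
      have zr: "z = of_real r * \<zeta>" using z0 by (simp add: \<zeta>_def r_def sgn_eq)
      define \<alpha> where "\<alpha> = (1 / norm (F z)) *\<^sub>R F z"
      have \<alpha>: "norm \<alpha> \<le> 1" using 3 by (simp add: \<alpha>_def)
      define g where "g = T (lin \<alpha>)"
      have gh: "g holomorphic_on ball 0 1" unfolding g_def by (rule D_mult_hol[OF T_mem[OF lin_Mult]])
      have gz: "g z = of_real (norm (F z))"
      proof -
        have "g z = of_real (1 / norm (F z)) * cinner_vec (F z) (F z)"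
          unfolding g_def T_lin[OF z] \<alpha>_def cinner_vec_def sum_distrib_left vector_scaleR_component
          by (intro sum.cong refl) (simp add: scaleR_conv_of_real mult.left_commute)
        then show ?thesis using 3 by (simp add: cinner_vec_norm power2_eq_square)
      qed
      define y where "y t = 1 - Re (g (of_real t * \<zeta>))" for t :: real
      define P where "P t = y t * (1 - t) powr (- \<eta>)" for t
      have inb: "of_real t * \<zeta> \<in> ball 0 1" "cmod (of_real t * \<zeta>) = t" if "s0 \<le> t" "t \<le> r" for t
        using that s0 r \<zeta> by (auto simp: norm_mult)
      have "P s0 \<le> P r"
      proof (rule DERIV_nonneg_imp_nondecreasing[of s0 r P])
        show "s0 \<le> r" using 3 by simp
        fix t assume t: "s0 \<le> t" "t \<le> r"
        note tb = inb[OF t]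
        have t1: "0 < 1 - t" using t r by simp
        define g' where "g' = deriv g (of_real t * \<zeta>)"
        have "((\<lambda>w. g (w * \<zeta>)) has_field_derivative g' * \<zeta>) (at (of_real t))"
          unfolding g'_def
          by (rule DERIV_chain2[where f = g and g = "\<lambda>w. w * \<zeta>", OF deriv_at[OF gh tb(1)]])
             (auto intro!: derivative_eq_intros)
        then have "((\<lambda>t. g (of_real t * \<zeta>)) has_vector_derivative g' * \<zeta>) (at t)"
          by (rule has_vector_derivative_real_field)
        then have "((\<lambda>t. Re (g (of_real t * \<zeta>))) has_vector_derivative Re (g' * \<zeta>)) (at t)"
          by (rule bounded_linear.has_vector_derivative[OF bounded_linear_Re])
        then have dRe: "((\<lambda>t. Re (g (of_real t * \<zeta>))) has_real_derivative Re (g' * \<zeta>)) (at t)"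
          unfolding has_real_derivative_iff_has_vector_derivative .
        have dy: "(y has_real_derivative - Re (g' * \<zeta>)) (at t)"
          unfolding y_def[abs_def] using DERIV_diff[OF DERIV_const[of 1] dRe] by simp
        have dp: "((\<lambda>t. (1 - t) powr (- \<eta>)) has_real_derivative \<eta> * (1 - t) powr (- \<eta> - 1)) (at t)"
          using t1 by (auto intro!: derivative_eq_intros simp: powr_diff field_simps)
        have dP: "(P has_real_derivative - Re (g' * \<zeta>) * (1 - t) powr (- \<eta>) + \<eta> * (1 - t) powr (- \<eta> - 1) * y t) (at t)"
          unfolding P_def[abs_def] by (rule DERIV_mult'[OF dy dp, THEN DERIV_cong]) (simp add: algebra_simps)
        have lt: "max (M / \<eta>) 1 \<le> loglog_radial t" using loglog_radial[of t] t r by simp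
        have y0: "1 - cmod (g (of_real t * \<zeta>)) \<le> y t" using complex_Re_le_cmod[of "g (of_real t * \<zeta>)"] by (simp add: y_def)
        have "cmod (g (of_real t * \<zeta>)) \<le> norm (F (of_real t * \<zeta>)) * norm \<alpha>"
          unfolding g_def T_lin[OF tb(1)] by (rule cinner_vec_le)
        also have "\<dots> \<le> 1 * 1" using norm_F_lt1[OF tb(1)] \<alpha> by (intro mult_mono) auto
        finally have yp: "0 \<le> y t" using y0 by simp
        have "cmod g' * (1 - t) * loglog_radial t \<le> M * (1 - cmod (g (of_real t * \<zeta>)))"
          using M[OF tb(1) \<alpha>] unfolding tb(2) g'_def g_def .
        also have "\<dots> \<le> M * y t" by (rule mult_left_mono[OF y0 M0])
        also have "\<dots> = (M / \<eta>) * (\<eta> * y t)" using \<eta> by simp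
        also have "\<dots> \<le> loglog_radial t * (\<eta> * y t)" using lt yp \<eta> by (intro mult_right_mono) auto
        finally have "(cmod g' * (1 - t)) * loglog_radial t \<le> (\<eta> * y t) * loglog_radial t" by (simp add: mult.commute)
        then have gb: "cmod g' * (1 - t) \<le> \<eta> * y t"
          by (rule mult_right_le_imp_le) (use lt in linarith)
        have "Re (g' * \<zeta>) * (1 - t) \<le> cmod g' * (1 - t)"
          using complex_Re_le_cmod[of "g' * \<zeta>"] \<zeta> t1 by (intro mult_right_mono) (auto simp: norm_mult)
        with gb have "Re (g' * \<zeta>) * (1 - t) \<le> \<eta> * y t" by linarith
        then have "(Re (g' * \<zeta>) * (1 - t)) * (1 - t) powr (- \<eta> - 1) \<le> (\<eta> * y t) * (1 - t) powr (- \<eta> - 1)"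
          by (rule mult_right_mono) simp
        then have "0 \<le> - Re (g' * \<zeta>) * ((1 - t) * (1 - t) powr (- \<eta> - 1)) + \<eta> * (1 - t) powr (- \<eta> - 1) * y t"
          by (simp only: mult_minus_left mult_ac)
        also have "(1 - t) * (1 - t) powr (- \<eta> - 1) = (1 - t) powr (- \<eta>)"
          using t1 by (simp add: powr_diff)
        finally have "0 \<le> - Re (g' * \<zeta>) * (1 - t) powr (- \<eta>) + \<eta> * (1 - t) powr (- \<eta> - 1) * y t" .
        with dP show "\<exists>D. (P has_real_derivative D) (at t) \<and> 0 \<le> D" by blast
      qed
      moreover have "c \<le> P s0"
      proof -
        have s0r: "s0 \<le> r" using 3 by simp
        note sb = inb[OF order_refl s0r]
        have "cmod (g (of_real s0 * \<zeta>)) \<le> norm (F (of_real s0 * \<zeta>)) * norm \<alpha>"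
          unfolding g_def T_lin[OF sb(1)] by (rule cinner_vec_le)
        also have "\<dots> \<le> norm (F (of_real s0 * \<zeta>)) * 1" using \<alpha> by (intro mult_left_mono) auto
        finally have "c \<le> y s0"
          using inner[of "of_real s0 * \<zeta>"] sb(2) complex_Re_le_cmod[of "g (of_real s0 * \<zeta>)"] by (simp add: y_def)
        moreover have "1 \<le> (1 - s0) powr (- \<eta>)"
          using s0 \<eta> powr_mono'[of 0 "\<eta>" "1 - s0"] by (simp add: powr_minus one_le_inverse_iff powr_le1)
        ultimately have "c * 1 \<le> y s0 * (1 - s0) powr (- \<eta>)" using c0 by (intro mult_mono) auto
        then show ?thesis by (simp add: P_def)
      qed
      moreover have "P r = (1 - norm (F z)) * (1 - r) powr (- \<eta>)"
        unfolding P_def y_def zr[symmetric] gz by simp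
      ultimately have "c \<le> (1 - norm (F z)) * (1 - r) powr (- \<eta>)" by linarith
      then have "c * (1 - r) powr \<eta> \<le> (1 - norm (F z)) * (1 - r) powr (- \<eta>) * (1 - r) powr \<eta>"
        by (rule mult_right_mono) simp
      also have "\<dots> = 1 - norm (F z)" using r by (simp add: mult.assoc powr_add[symmetric])
      finally show ?thesis by (simp add: r_def)
    qed
  qed
  with c0 show ?thesis by blast
qed

text \<open>
  An upper bound for the distance of the kernel functions at \<open>F z\<close> and \<open>F w\<close>, see \<open>nrm_kp_diff_le\<close>.
\<close>

definition gap :: "complex \<Rightarrow> complex \<Rightarrow> real" where
  "gap z w = sqrt (2 * norm (F z - F w)) / min (1 - norm (F z)) (1 - norm (F w))"

lemma gap_min_pos: "z \<in> ball 0 1 \<Longrightarrow> w \<in> ball 0 1 \<Longrightarrow> 0 < min (1 - norm (F z)) (1 - norm (F w))"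
  using norm_F_lt1 by simp

lemma multiplier_gap:
  assumes h: "h \<in> D_mult" and z: "z \<in> ball 0 1" and w: "w \<in> ball 0 1"
  shows "cmod (h z - h w) \<le> nrm (\<Phi> h) * gap z w"
proof -
  have "cmod (ev z (\<Phi> h) - ev w (\<Phi> h)) \<le>
    nrm (\<Phi> h) * sqrt (2 * norm (pt (ev z) - pt (ev w))) / min (1 - norm (F z)) (1 - norm (F w))"
    by (rule character_difference_le[OF ev_character[OF z] ev_character[OF w] gap_min_pos[OF z w] _ _ iso_mem[OF h]])
       (simp_all add: F_def)
  then show ?thesis by (simp add: ev_def T_iso[OF h] gap_def F_def)
qed

text \<open>
  For a single test function this is \<open>multiplier_gap\<close> with a constant that depends on its image under \<open>\<Phi>\<close>.
\<close>

lemma test_fun_gap: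
  assumes \<eta>: "0 < \<eta>" "\<eta> \<le> 1"
  shows "\<exists>C. \<forall>z\<in>ball 0 1. \<forall>w\<in>ball 0 1. \<forall>\<phi>. test_fun \<eta> \<phi> \<longrightarrow> cmod (\<phi> z - \<phi> w) \<le> C * gap z w"
proof -
  have gap_pos: "0 < gap z w" if "z \<in> ball 0 1" "w \<in> ball 0 1" "F z \<noteq> F w" for z w
    unfolding gap_def using gap_min_pos[OF that(1,2)] that(3) by (intro divide_pos_pos) auto
  have "\<exists>C. \<forall>q\<in>{(z, w). z \<in> ball 0 1 \<and> w \<in> ball 0 1 \<and> F z \<noteq> F w}. \<forall>\<phi>\<in>{\<phi>. test_fun \<eta> \<phi>}.
    cmod ((\<phi> (fst q) - \<phi> (snd q)) / of_real (gap (fst q) (snd q))) \<le> C"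
  proof (rule gliding_hump)
    fix q assume "q \<in> {(z, w). z \<in> ball 0 1 \<and> w \<in> ball 0 1 \<and> F z \<noteq> F w}"
    then obtain z w where q: "q = (z, w)" and z: "z \<in> ball 0 1" and w: "w \<in> ball 0 1" and ne: "F z \<noteq> F w" by auto
    have "cmod ((\<phi> z - \<phi> w) / of_real (gap z w)) \<le> 2 / gap z w" if "test_fun \<eta> \<phi>" for \<phi>
    proof -
      have "cmod (\<phi> z) \<le> 1" "cmod (\<phi> w) \<le> 1" using that z w by (auto simp: test_fun_def)
      then have "cmod (\<phi> z - \<phi> w) \<le> 2" using norm_triangle_ineq4[of "\<phi> z" "\<phi> w"] by linarith
      then show ?thesis using gap_pos[OF z w ne] by (simp add: norm_divide divide_right_mono)
    qed
    then show "\<exists>M. \<forall>\<phi>\<in>{\<phi>. test_fun \<eta> \<phi>}. cmod ((\<phi> (fst q) - \<phi> (snd q)) / of_real (gap (fst q) (snd q))) \<le> M"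
      unfolding q by auto
  next
    fix x :: "nat \<Rightarrow> complex \<Rightarrow> complex" and c :: "nat \<Rightarrow> complex"
    assume x: "\<And>k. x k \<in> {\<phi>. test_fun \<eta> \<phi>}" and c: "\<And>k. cmod (c k) \<le> (1/3)^k"
    have xt: "test_fun \<eta> (x k)" for k using x[of k] by simp
    define \<phi> where "\<phi> = disc_restrict (\<lambda>z. \<Sum>k. c k * x k z)"
    have \<phi>: "\<phi> \<in> D_mult" unfolding \<phi>_def by (rule test_fun_series_multiplier(1)[OF xt c \<eta>])
    have sm: "(\<lambda>k. c k * x k z) sums \<phi> z" if "z \<in> ball 0 1" for z
      using test_fun_series_multiplier(2)[OF xt c \<eta> that] that by (simp add: \<phi>_def disc_restrict_def)
    have "cmod (\<Sum>k. c k * ((x k (fst q) - x k (snd q)) / of_real (gap (fst q) (snd q)))) \<le> nrm (\<Phi> \<phi>)"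
      if qJ: "q \<in> {(z, w). z \<in> ball 0 1 \<and> w \<in> ball 0 1 \<and> F z \<noteq> F w}" for q
    proof -
      obtain z w where q: "q = (z, w)" and z: "z \<in> ball 0 1" and w: "w \<in> ball 0 1" and ne: "F z \<noteq> F w"
        using qJ by auto
      have "(\<lambda>k. (c k * x k z - c k * x k w) / of_real (gap z w)) sums ((\<phi> z - \<phi> w) / of_real (gap z w))"
        by (intro sums_divide sums_diff sm z w)
      then have eq: "(\<Sum>k. c k * ((x k z - x k w) / of_real (gap z w))) = (\<phi> z - \<phi> w) / of_real (gap z w)"
        by (simp add: sums_iff right_diff_distrib diff_divide_distrib)
      show ?thesis
        unfolding q fst_conv snd_conv eq using multiplier_gap[OF \<phi> z w] gap_pos[OF z w ne]
        by (simp add: norm_divide divide_le_eq)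
    qed
    then show "\<exists>M. \<forall>q\<in>{(z, w). z \<in> ball 0 1 \<and> w \<in> ball 0 1 \<and> F z \<noteq> F w}.
      cmod (\<Sum>k. c k * ((x k (fst q) - x k (snd q)) / of_real (gap (fst q) (snd q)))) \<le> M" by blast
  qed
  then obtain C where C: "\<And>z w \<phi>. z \<in> ball 0 1 \<Longrightarrow> w \<in> ball 0 1 \<Longrightarrow> F z \<noteq> F w \<Longrightarrow> test_fun \<eta> \<phi> \<Longrightarrow>
    cmod ((\<phi> z - \<phi> w) / of_real (gap z w)) \<le> C" by fastforce
  have "cmod (\<phi> z - \<phi> w) \<le> C * gap z w" if z: "z \<in> ball 0 1" and w: "w \<in> ball 0 1" and \<phi>: "test_fun \<eta> \<phi>" for z w \<phi>
  proof (cases "F z = F w")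
    case True
    have "cmod (disc_restrict \<phi> z - disc_restrict \<phi> w) \<le> nrm (\<Phi> (disc_restrict \<phi>)) * gap z w"
      by (rule multiplier_gap[OF test_fun_multiplier[OF \<phi> \<eta>] z w])
    then show ?thesis using True z w by (simp add: gap_def disc_restrict_def)
  next
    case False
    then show ?thesis using C[OF z w False \<phi>] gap_pos[OF z w False] by (simp add: norm_divide divide_le_eq)
  qed
  then show ?thesis by blast
qed

text \<open>
  With \<open>N\<close> points on the circle of radius \<open>1 - \<epsilon>\<close>, \<open>\<epsilon> = 1 / (4 * N\<^sup>2)\<close>, the distance of the images is at least a constant
  times \<open>\<epsilon> powr (6 * \<eta>)\<close>. By \<open>packing\<close>, \<open>N\<close> is at most a constant times \<open>\<epsilon> powr (-12 * \<eta> * d)\<close>, and \<open>\<eta>\<close> is chosen so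
  that this is only of the order \<open>sqrt N\<close>.
\<close>

lemma no_dirichlet_iso: False
proof -
  define d where "d = CARD('d)"
  have d: "1 \<le> real d" unfolding d_def using zero_less_card_finite[where 'a = 'd] by (metis One_nat_def Suc_leI of_nat_1 of_nat_mono)
  \<comment> \<open>The exponent 12 * \<eta> * d of the packing bound becomes 1/4.\<close>
  define \<eta> where "\<eta> = 1 / (48 * real d)"
  have \<eta>: "0 < \<eta>" "\<eta> \<le> 1" using d by (auto simp: \<eta>_def divide_le_eq)
  obtain c where c: "0 < c" "\<And>z. z \<in> ball 0 1 \<Longrightarrow> c * (1 - cmod z) powr \<eta> \<le> 1 - norm (F z)"
    using boundary_distance_bound[OF \<eta>(1)] by blast
  have c1: "c \<le> 1"
  proof -
    have "c \<le> 1 - norm (F 0)" using c(2)[of 0] by simp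
    then show ?thesis using norm_ge_zero[of "F 0"] by linarith
  qed
  obtain C0 where C0: "\<And>z w \<phi>. z \<in> ball 0 1 \<Longrightarrow> w \<in> ball 0 1 \<Longrightarrow> test_fun \<eta> \<phi> \<Longrightarrow> cmod (\<phi> z - \<phi> w) \<le> C0 * gap z w"
    using test_fun_gap[OF \<eta>] by blast
  define C where "C = max C0 1"
  have C1: "1 \<le> C" by (simp add: C_def)
  have gap0: "0 \<le> gap z w" if "z \<in> ball 0 1" "w \<in> ball 0 1" for z w
    unfolding gap_def using gap_min_pos[OF that] by (intro divide_nonneg_pos) auto
  have C: "cmod (\<phi> z - \<phi> w) \<le> C * gap z w" if "z \<in> ball 0 1" "w \<in> ball 0 1" "test_fun \<eta> \<phi>" for z w \<phi>
    by (rule order_trans[OF C0[OF that]]) (intro mult_right_mono gap0 that, simp add: C_def)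
  define K where "K = 6 + 1 / \<eta>"
  have K1: "1 \<le> K" using \<eta> by (simp add: K_def)
  define \<kappa> where "\<kappa> = (c / (K * C))\<^sup>2 / 2"
  have cKC: "0 < c / (K * C)" "c / (K * C) \<le> 1"
  proof -
    have "1 * 1 \<le> K * C" using K1 C1 by (intro mult_mono) auto
    then show "0 < c / (K * C)" "c / (K * C) \<le> 1" using c c1 by (auto simp: divide_le_eq)
  qed
  have \<kappa>: "0 < \<kappa>" "\<kappa> \<le> 1" using cKC power_le_one[of "c / (K * C)" 2] by (auto simp: \<kappa>_def)
  define Q where "Q = (10 * real d / \<kappa>) ^ (2 * d)"
  have main: "real N * (1 / (4 * (real N)\<^sup>2)) powr (1/4) \<le> Q" if N: "4 \<le> N" for N :: nat
  proof -
    \<comment> \<open>Then 2 * sqrt \<epsilon> = 1 / N is the spacing of the points below.\<close>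
    define \<epsilon> where "\<epsilon> = 1 / (4 * (real N)\<^sup>2)"
    have Nr: "4 \<le> real N" using N by simp
    then have N2: "16 \<le> (real N)\<^sup>2" using power_mono[of 4 "real N" 2] by simp
    have \<epsilon>: "0 < \<epsilon>" "\<epsilon> \<le> 1/64" using N2 Nr by (auto simp: \<epsilon>_def divide_le_eq)
    have \<epsilon>1: "\<epsilon> < 1" "\<epsilon> \<le> 1" using \<epsilon> by auto
    have sq: "sqrt \<epsilon> = 1 / (2 * real N)"
    proof -
      have "\<epsilon> = (1 / (2 * real N))\<^sup>2" by (simp add: \<epsilon>_def power2_eq_square)
      then show ?thesis by (simp only: real_sqrt_abs) simp
    qed
    have ln4: "4 \<le> - ln \<epsilon>"
    proof -
      have "ln \<epsilon> \<le> ln (1/64)" using \<epsilon> by (subst ln_le_cancel_iff) auto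
      also have "ln (1/64::real) = - (6 * ln 2)"
        using ln_realpow[of "2::real" 6] by (simp add: ln_div)
      finally show ?thesis using ln2_ge_two_thirds by linarith
    qed
    have lnK: "6 - ln \<epsilon> \<le> K * \<epsilon> powr (- \<eta>)"
    proof -
      have "ln (1 / \<epsilon>) \<le> (1 / \<epsilon>) powr \<eta> / \<eta>" using \<epsilon> \<epsilon>1 \<eta> by (intro ln_powr_bound) auto
      moreover have "(1 / \<epsilon>) powr \<eta> = \<epsilon> powr (- \<eta>)" using \<epsilon> by (simp add: powr_minus powr_divide inverse_eq_divide)
      moreover have "ln (1 / \<epsilon>) = - ln \<epsilon>" using \<epsilon> by (simp add: ln_div)
      moreover have "1 \<le> \<epsilon> powr (- \<eta>)" using \<epsilon> \<epsilon>1 \<eta> by (simp add: powr_minus one_le_inverse_iff powr_le1)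
      ultimately show ?thesis unfolding K_def by (simp add: distrib_right)
    qed
    \<comment> \<open>Points on the unit circle are kept apart by their real parts.\<close>
    define \<zeta> where "\<zeta> k = Complex (real k / real N) (sqrt (1 - (real k / real N)\<^sup>2))" for k :: nat
    have \<zeta>1: "cmod (\<zeta> k) = 1" if "k < N" for k
    proof -
      have "(real k / real N)\<^sup>2 \<le> 1" using that by (intro power_le_one) auto
      then show ?thesis by (simp add: \<zeta>_def cmod_def)
    qed
    have \<zeta>sep: "2 * sqrt \<epsilon> \<le> cmod (\<zeta> l - \<zeta> k)" if "k \<noteq> l" for k l
    proof -
      have "1 \<le> \<bar>real l - real k\<bar>" using that by linarith
      then have "1 / real N \<le> \<bar>real l - real k\<bar> / real N" by (intro divide_right_mono) auto
      also have "\<dots> = \<bar>Re (\<zeta> l - \<zeta> k)\<bar>" by (simp add: \<zeta>_def diff_divide_distrib[symmetric])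
      also have "\<dots> \<le> cmod (\<zeta> l - \<zeta> k)" by (rule abs_Re_le_cmod)
      finally show ?thesis by (simp add: sq)
    qed
    define p where "p k = of_real (1 - \<epsilon>) * \<zeta> k" for k
    have pn: "cmod (p k) = 1 - \<epsilon>" if "k < N" for k
      unfolding p_def norm_mult norm_of_real using \<zeta>1[OF that] \<epsilon>1 by simp
    have pb: "p k \<in> ball 0 1" if "k < N" for k using pn[OF that] \<epsilon> by simp
    define s where "s = \<kappa> * (\<epsilon> powr (6 * \<eta>))"
    have ep1: "\<epsilon> powr (6 * \<eta>) \<le> 1" using \<epsilon> \<epsilon>1 \<eta> by (intro powr_le1) auto
    have s: "0 < s" "s \<le> 1" using \<kappa> \<epsilon> ep1 by (auto simp: s_def intro!: mult_le_one)
    have sep: "s \<le> norm (F (p k) - F (p l))" if k: "k < N" and l: "l < N" and kl: "k \<noteq> l" for k l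
    proof -
      define D where "D = norm (F (p k) - F (p l))"
      have tf: "test_fun \<eta> (log_test \<eta> \<epsilon> (\<zeta> k))" by (rule log_test_test_fun[OF \<zeta>1[OF k] \<epsilon>(1) \<epsilon>1(2) \<eta>])
      have "\<epsilon> powr \<eta> / (6 - ln \<epsilon>) \<le> cmod (log_test \<eta> \<epsilon> (\<zeta> k) (p k) - log_test \<eta> \<epsilon> (\<zeta> k) (p l))"
        unfolding p_def by (rule log_test_separates[OF \<zeta>1[OF k] \<zeta>1[OF l] \<epsilon>(1) \<epsilon>1(1) ln4 \<zeta>sep[OF kl]])
      also have "\<dots> \<le> C * gap (p k) (p l)" by (rule C[OF pb[OF k] pb[OF l] tf])
      also have "gap (p k) (p l) \<le> sqrt (2 * D) / (c * \<epsilon> powr \<eta>)"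
        unfolding gap_def D_def using c(2)[OF pb[OF k]] c(2)[OF pb[OF l]] pn[OF k] pn[OF l] c(1) \<epsilon>(1) norm_F_lt1[OF pb[OF k]] norm_F_lt1[OF pb[OF l]]
        by (intro divide_left_mono mult_pos_pos) (auto simp: min_def)
      finally have 1: "\<epsilon> powr \<eta> / (6 - ln \<epsilon>) \<le> C * (sqrt (2 * D) / (c * \<epsilon> powr \<eta>))" using C1 by simp
      have e0: "0 < \<epsilon> powr \<eta>" using \<epsilon> by simp
      have "\<epsilon> powr \<eta> / (K * \<epsilon> powr (- \<eta>)) \<le> \<epsilon> powr \<eta> / (6 - ln \<epsilon>)"
        using lnK ln4 e0 K1 \<epsilon>(1) by (intro divide_left_mono mult_pos_pos) auto
      with 1 have 2: "\<epsilon> powr \<eta> / (K * \<epsilon> powr (- \<eta>)) \<le> C * (sqrt (2 * D) / (c * \<epsilon> powr \<eta>))" by linarith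
      have "c / (K * C) * \<epsilon> powr (3 * \<eta>) = (c * \<epsilon> powr \<eta> / C) * (\<epsilon> powr \<eta> / (K * \<epsilon> powr (- \<eta>)))"
      proof -
        have "\<epsilon> powr (3 * \<eta>) = \<epsilon> powr \<eta> * \<epsilon> powr \<eta> * \<epsilon> powr \<eta>" by (simp flip: powr_add)
        moreover have "\<epsilon> powr (- \<eta>) = inverse (\<epsilon> powr \<eta>)" by (rule powr_minus)
        ultimately show ?thesis by (simp add: field_simps)
      qed
      also have "\<dots> \<le> (c * \<epsilon> powr \<eta> / C) * (C * (sqrt (2 * D) / (c * \<epsilon> powr \<eta>)))"
        by (rule mult_left_mono[OF 2]) (use c C1 e0 in auto)
      also have "\<dots> = sqrt (2 * D)" using c C1 e0 by simp
      finally have "c / (K * C) * \<epsilon> powr (3 * \<eta>) \<le> sqrt (2 * D)" .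
      then have "(c / (K * C) * \<epsilon> powr (3 * \<eta>))\<^sup>2 \<le> (sqrt (2 * D))\<^sup>2"
        by (rule power_mono) (intro mult_nonneg_nonneg less_imp_le[OF cKC(1)] powr_ge_zero)
      also have "\<dots> = 2 * D" by (simp add: D_def)
      also have "(c / (K * C) * \<epsilon> powr (3 * \<eta>))\<^sup>2 = 2 * s"
      proof -
        have "(\<epsilon> powr (3 * \<eta>))\<^sup>2 = \<epsilon> powr (6 * \<eta>)" by (simp add: power2_eq_square flip: powr_add)
        then show ?thesis unfolding s_def \<kappa>_def power_mult_distrib by simp
      qed
      finally show ?thesis by (simp add: D_def)
    qed
    have "real N \<le> (10 * real d / s) ^ (2 * d)"
      unfolding d_def by (rule packing[OF s, of N "\<lambda>k. F (p k)"]) (use sep less_imp_le[OF norm_F_lt1[OF pb]] in auto)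
    also have "\<dots> = Q / (\<epsilon> powr (6 * \<eta>)) ^ (2 * d)"
      unfolding Q_def s_def by (simp add: power_divide power_mult_distrib)
    also have "(\<epsilon> powr (6 * \<eta>)) ^ (2 * d) = \<epsilon> powr (1/4)"
    proof -
      have "(\<epsilon> powr (6 * \<eta>)) ^ (2 * d) = \<epsilon> powr (6 * \<eta> * real (2 * d))"
        using \<epsilon> by (simp add: powr_realpow[symmetric] powr_powr)
      also have "6 * \<eta> * real (2 * d) = 1/4" using d by (simp add: \<eta>_def)
      finally show ?thesis .
    qed
    finally have "real N \<le> Q / \<epsilon> powr (1/4)" .
    then show ?thesis using \<epsilon> by (simp add: pos_le_divide_eq \<epsilon>_def[symmetric])
  qed
  obtain N0 :: nat where N0: "4 * Q ^ 4 + 4 < real N0" using reals_Archimedean2 by blast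
  define N where "N = N0 + 4"
  have Q0: "0 \<le> Q" unfolding Q_def using \<kappa> by simp
  have N4: "4 \<le> N" by (simp add: N_def)
  have Nr: "4 * Q ^ 4 < real N" "1 \<le> real N" using N0 by (auto simp: N_def)
  have "(real N * (1 / (4 * (real N)\<^sup>2)) powr (1/4)) ^ 4 \<le> Q ^ 4"
    by (rule power_mono[OF main[OF N4]]) simp
  also have "(real N * (1 / (4 * (real N)\<^sup>2)) powr (1/4)) ^ 4 = (real N) ^ 4 * (1 / (4 * (real N)\<^sup>2))"
  proof -
    have "((1 / (4 * (real N)\<^sup>2)) powr (1/4)) ^ 4 = (1 / (4 * (real N)\<^sup>2)) powr (1/4 * real 4)"
      by (subst powr_powr[symmetric], subst powr_realpow) (use Nr in auto)
    also have "\<dots> = 1 / (4 * (real N)\<^sup>2)" using Nr by simp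
    finally show ?thesis by (simp only: power_mult_distrib)
  qed
  also have "\<dots> = (real N)\<^sup>2 / 4" using Nr by (simp add: power4_eq_xxxx power2_eq_square)
  finally have "(real N)\<^sup>2 \<le> 4 * Q ^ 4" by simp
  moreover have "real N * 1 \<le> (real N)\<^sup>2" unfolding power2_eq_square using Nr by (intro mult_left_mono) auto
  ultimately show False using Nr by linarith
qed

end

section \<open>No isomorphism exists\<close>

theorem theorem4p2:
  "\<not> (\<exists>(V :: (complex ^ 'd) set) H ip.
        V \<subseteq> ball 0 1 \<and> rkhs V drury_arveson_kernel H ip \<and>
        algebra_isomorphic (Mult (ball 0 1) dirichlet_space) (Mult V H))"
proof
  assume "\<exists>(V :: (complex ^ 'd) set) H ip.
        V \<subseteq> ball 0 1 \<and> rkhs V drury_arveson_kernel H ip \<and>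
        algebra_isomorphic (Mult (ball 0 1) dirichlet_space) (Mult V H)"
  then obtain V :: "(complex ^ 'd) set" and H ip \<Phi> where V: "V \<subseteq> ball 0 1"
    and rk: "rkhs V drury_arveson_kernel H ip"
    and \<Phi>: "bij_betw \<Phi> D_mult (Mult V H)"
      "\<forall>f\<in>D_mult. \<forall>g\<in>D_mult. \<Phi> (\<lambda>x. f x + g x) = (\<lambda>y. \<Phi> f y + \<Phi> g y)"
      "\<forall>c. \<forall>f\<in>D_mult. \<Phi> (\<lambda>x. c * f x) = (\<lambda>y. c * \<Phi> f y)"
      "\<forall>f\<in>D_mult. \<forall>g\<in>D_mult. \<Phi> (\<lambda>x. f x * g x) = (\<lambda>y. \<Phi> f y * \<Phi> g y)"
    unfolding algebra_isomorphic_def by blast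
  have "dirichlet_iso V H ip \<Phi>"
    unfolding dirichlet_iso_def drury_arveson_rkhs_def drury_arveson_rkhs_axioms_def dirichlet_iso_axioms_def
    using rk V \<Phi> by blast
  then show False by (rule dirichlet_iso.no_dirichlet_iso)
qed

end
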